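(* Let $D$ be a weighted oriented graph with underlying simple graph $G$ such that $I(D)$ has homological linear quotients. Then $D$ is $D_i$-free for every $i=1,\dots,8$. Moreover, $G$ is co-chordal and $H_n^c$-free for every $n\ge 6$.
   Context: $R=\mathbb{K}[x_1,\dots,x_n]$ over a field $\mathbb{K}$. A weighted oriented graph $D$ is a finite simple graph $G$ (the underlying graph) in which each edge is given exactly one orientation, with a weight function $w:V(D)\to\{1,2,\dots\}$, $w_i=w(x_i)$; sources (vertices with no incoming edge) of $D$ are assumed to have weight $1$. The edge ideal is $I(D)=(x_ix_j^{w_j} : (x_i,x_j)\in E(D))$, where $(x_i,x_j)$ denotes an edge oriented $x_i\to x_j$. A monomial ideal $J$ with minimal monomial generating set $\mathcal{G}(J)$ has linear quotients if there is an order $u_1<\dots<u_m$ of $\mathcal{G}(J)$ such that $(u_1,\dots,u_{i-1}):u_i$ is generated by a subset of the variables for $i=2,\dots,m$ (the zero ideal has linear quotients). $HS_k(J)=(\mathbf{x}^{\mathbf{a}} : \beta_{k,\mathbf{a}}(J)\ne 0)$, where $\beta_{k,\mathbf{a}}(J)$ are the multigraded Betti numbers of the minimal multigraded free resolution of $J$. $J$ has homological linear quotients if $HS_k(J)$ has linear quotients for every $k\ge 0$. Patterns (no condition on unlisted weights; only the listed edges are present): $D_1$: $x_1\to x_2\to x_3$, $w(x_2)>1$, $w(x_3)>1$. $D_2$: $x_2\to x_1$, $x_2\to x_3$, $w(x_1)>1$, $w(x_3)>1$. $D_3$: $x_1\to x_2\to x_3\to x_1$, $w(x_1),w(x_2),w(x_3)>1$.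 $D_4$: $x_1\to x_2$, $x_3\to x_2$, $x_1\to x_3$, $w(x_2)>1$, $w(x_3)>1$. $D_5$: $x_1\to x_2\to x_3\to x_4$, $w(x_2)=1$, $w(x_3)>1$, $w(x_4)=1$. $D_6$: $x_1\to x_2\to x_3\to x_4$, $w(x_2)>1$, $w(x_3)=1$, $w(x_4)>1$. $D_7$: $x_1\to x_2\to x_3\to x_1$, $w(x_1)=1$, $w(x_2)>2$, $w(x_3)>2$. $D_8$: $x_2\to x_1$, $x_3\to x_4$ and an edge between $x_2,x_3$ of either orientation, $w(x_1)>1$, $w(x_2)=w(x_3)=1$, $w(x_4)>1$. $D$ is $D_i$-free if no induced weighted oriented subgraph $D[A]$, $A\subseteq V(D)$ (with inherited orientations and weights), is, up to renaming vertices, of the form $D_i$ for some weights satisfying the listed conditions. $G^c$ is the complement of $G$; a graph is chordal if it has no induced cycle of length greater than three, and co-chordal if its complement is chordal. For $n\ge 6$, $H_n$ is the graph on $\{x_1,\dots,x_n\}$ with edge set $\{x_ix_{i+1}: 1\le i\le n-5\}\cup\{x_{n-4}x_{n-2},\,x_{n-2}x_{n-3}\}\cup\{x_{n-1}x_j: 1\le j\le n,\ j\ne 1,n-1\}\cup\{x_nx_j: 1\le j\le n,\ j\ne n-3,n\}$. $G$ is $H_n^c$-free if it has no induced subgraph isomorphic to the complement $H_n^c$ of $H_n$. *)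

theory Defs
  imports "HOL-Library.Poly_Mapping" "Jordan_Normal_Form.Matrix_Kernel"
begin

section \<open>Monomials and ideals in a polynomial ring\<close>

text \<open>
  Monomials in the variables \<open>x\<^sub>v\<close> (\<open>v :: 'v\<close>) are identified with their exponent vectors, so
  divisibility of monomials is the pointwise order and their product is \<open>+\<close>. The type
  \<open>('v, 'k) mpoly\<close>, with the convolution product of the library, is the polynomial ring
  \<open>k[x\<^sub>v : v \<in> 'v]\<close>; for \<open>'v\<close> finite with \<open>n\<close> elements it is \<open>k[x\<^sub>1, \<dots>, x\<^sub>n]\<close>.
\<close>

type_synonym 'v expo = "'v \<Rightarrow>\<^sub>0 nat"
type_synonym ('v, 'k) mpoly = "('v \<Rightarrow>\<^sub>0 nat) \<Rightarrow>\<^sub>0 'k"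

definition xpow :: "'v expo \<Rightarrow> ('v, 'k::comm_ring_1) mpoly" where
  "xpow a = Poly_Mapping.single a 1"

definition var :: "'v \<Rightarrow> ('v, 'k::comm_ring_1) mpoly" where
  "var v = xpow (Poly_Mapping.single v 1)"

definition ideal_of :: "'r::comm_ring_1 set \<Rightarrow> 'r set" where
  "ideal_of S = Modules.module.span (*) S"

definition colon_ideal :: "'r::comm_ring_1 set \<Rightarrow> 'r \<Rightarrow> 'r set" where
  "colon_ideal J u = {f. f * u \<in> J}"

definition minimal_monomial_gens :: "('v, 'k::field) mpoly set \<Rightarrow> 'v expo set \<Rightarrow> bool" where
  "minimal_monomial_gens J A \<longleftrightarrow>
     ideal_of (xpow ` A) = J \<and> (\<forall>B. B \<subset> A \<longrightarrow> ideal_of (xpow ` B) \<noteq> J)"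

definition linear_quotients :: "('v, 'k::field) mpoly set \<Rightarrow> bool" where
  "linear_quotients J \<longleftrightarrow>
     (\<exists>us. distinct us \<and> minimal_monomial_gens J (set us) \<and>
        (\<forall>i. 0 < i \<and> i < length us \<longrightarrow>
           (\<exists>S. colon_ideal (ideal_of (xpow ` set (take i us))) (xpow (us ! i))
                = (ideal_of (var ` S) :: ('v, 'k) mpoly set))))"


section \<open>Minimal multigraded free resolutions\<close>

text \<open>
  A multigraded free resolution \<open>\<dots> \<rightarrow> F\<^sub>1 \<rightarrow> F\<^sub>0 \<rightarrow> J \<rightarrow> 0\<close> is given by homogeneous bases and
  matrices. The list \<open>degs k\<close> holds the multidegrees of the basis of
  \<open>F\<^sub>k = \<Oplus>\<^sub>j R(- degs k ! j)\<close>. The matrix of \<open>F\<^sub>k \<rightarrow> F\<^sub>k\<^sub>-\<^sub>1\<close> is \<open>d k\<close> for \<open>k > 0\<close>, and \<open>d 0\<close> is the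
  matrix of the augmentation \<open>F\<^sub>0 \<rightarrow> J \<subseteq> R\<close>, with \<open>R\<close> free on one generator of multidegree \<open>0\<close>.
\<close>

definition target_degs :: "(nat \<Rightarrow> 'v expo list) \<Rightarrow> nat \<Rightarrow> 'v expo list" where
  "target_degs degs k = (case k of 0 \<Rightarrow> [0] | Suc l \<Rightarrow> degs l)"

definition mat_image :: "'r::comm_ring_1 mat \<Rightarrow> 'r vec set" where
  "mat_image A = {A *\<^sub>v v | v. v \<in> carrier_vec (dim_col A)}"

text \<open>
  The homogeneity condition says that the image of the \<open>j\<close>-th basis vector of \<open>F\<^sub>k\<close> is homogeneous
  of multidegree \<open>degs k ! j\<close>.
\<close>

definition multigraded_free_resolution ::
  "('v, 'k::field) mpoly set \<Rightarrow> (nat \<Rightarrow> 'v expo list) \<Rightarrow> (nat \<Rightarrow> ('v, 'k) mpoly mat) \<Rightarrow> bool"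
  where
  "multigraded_free_resolution J degs d \<longleftrightarrow>
     (\<forall>k. d k \<in> carrier_mat (length (target_degs degs k)) (length (degs k))) \<and>
     (\<forall>k. \<forall>i < length (target_degs degs k). \<forall>j < length (degs k).
        \<forall>m \<in> Poly_Mapping.keys (d k $$ (i, j)). m + target_degs degs k ! i = degs k ! j) \<and>
     (\<lambda>v. v $ 0) ` mat_image (d 0) = J \<and>
     (\<forall>k. mat_kernel (d k) = mat_image (d (Suc k)))"

definition minimal_multigraded_free_resolution ::
  "('v, 'k::field) mpoly set \<Rightarrow> (nat \<Rightarrow> 'v expo list) \<Rightarrow> (nat \<Rightarrow> ('v, 'k) mpoly mat) \<Rightarrow> bool"
  where
  "minimal_multigraded_free_resolution J degs d \<longleftrightarrow>
     multigraded_free_resolution J degs d \<and>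
     (\<forall>k. \<forall>i < length (degs k). \<forall>j < length (degs (Suc k)).
        d (Suc k) $$ (i, j) \<in> ideal_of (range var))"

text \<open>
  Every monomial ideal in finitely many variables has a minimal multigraded free resolution, and it
  is unique up to isomorphism; the multidegrees of the bases do not depend on the one chosen.
\<close>

definition multigraded_betti :: "nat \<Rightarrow> 'v expo \<Rightarrow> ('v, 'k::field) mpoly set \<Rightarrow> nat" where
  "multigraded_betti k a J =
     (let degs = (SOME degs. \<exists>d. minimal_multigraded_free_resolution J degs d)
      in count_list (degs k) a)"

definition HS :: "nat \<Rightarrow> ('v, 'k::field) mpoly set \<Rightarrow> ('v, 'k) mpoly set" where
  "HS k J = ideal_of (xpow ` {a. multigraded_betti k a J \<noteq> 0})"

definition homological_linear_quotients :: "('v, 'k::field) mpoly set \<Rightarrow> bool" where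
  "homological_linear_quotients J \<longleftrightarrow> (\<forall>k. linear_quotients (HS k J))"


section \<open>Simple graphs\<close>

record 'a ugraph =
  uverts :: "'a set"
  uedges :: "'a set set"

definition complement_graph :: "'a ugraph \<Rightarrow> 'a ugraph" where
  "complement_graph G =
     \<lparr>uverts = uverts G, uedges = {e. e \<subseteq> uverts G \<and> card e = 2} - uedges G\<rparr>"

definition induced_ugraph :: "'a ugraph \<Rightarrow> 'a set \<Rightarrow> 'a ugraph" where
  "induced_ugraph G A = \<lparr>uverts = A, uedges = {e \<in> uedges G. e \<subseteq> A}\<rparr>"

definition ugraph_iso :: "'a ugraph \<Rightarrow> 'b ugraph \<Rightarrow> bool" where
  "ugraph_iso G H \<longleftrightarrow>
     (\<exists>f. bij_betw f (uverts G) (uverts H) \<and> uedges H = (\<lambda>e. f ` e) ` uedges G)"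

definition has_induced :: "'a ugraph \<Rightarrow> 'b ugraph \<Rightarrow> bool" where
  "has_induced G H \<longleftrightarrow> (\<exists>A \<subseteq> uverts G. ugraph_iso H (induced_ugraph G A))"

definition cycle_graph :: "nat \<Rightarrow> nat ugraph" where
  "cycle_graph m = \<lparr>uverts = {..<m}, uedges = {{i, Suc i mod m} | i. i < m}\<rparr>"

definition chordal :: "'a ugraph \<Rightarrow> bool" where
  "chordal G \<longleftrightarrow> (\<forall>m > 3. \<not> has_induced G (cycle_graph m))"

definition co_chordal :: "'a ugraph \<Rightarrow> bool" where
  "co_chordal G \<longleftrightarrow> chordal (complement_graph G)"

text \<open>Meaningful for \<open>n \<ge> 6\<close> only, where no subtraction below is truncated.\<close>

definition H_graph :: "nat \<Rightarrow> nat ugraph" where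
  "H_graph n =
     \<lparr>uverts = {1..n},
      uedges = {{i, i + 1} | i. 1 \<le> i \<and> i \<le> n - 5}
             \<union> {{n - 4, n - 2}, {n - 2, n - 3}}
             \<union> {{n - 1, j} | j. 1 \<le> j \<and> j \<le> n \<and> j \<noteq> 1 \<and> j \<noteq> n - 1}
             \<union> {{n, j} | j. 1 \<le> j \<and> j \<le> n \<and> j \<noteq> n - 3 \<and> j \<noteq> n}\<rparr>"


section \<open>Weighted oriented graphs\<close>

record 'a wograph =
  wverts :: "'a set"
  warcs :: "('a \<times> 'a) set"
  weight :: "'a \<Rightarrow> nat"

text \<open>
  The third condition excludes loops as well as pairs of opposite arcs, so that every edge of the
  underlying simple graph has exactly one orientation.
\<close>

definition weighted_oriented_graph :: "'a wograph \<Rightarrow> bool" where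
  "weighted_oriented_graph D \<longleftrightarrow>
     finite (wverts D) \<and>
     warcs D \<subseteq> wverts D \<times> wverts D \<and>
     (\<forall>x y. (x, y) \<in> warcs D \<longrightarrow> (y, x) \<notin> warcs D) \<and>
     (\<forall>x \<in> wverts D. 1 \<le> weight D x) \<and>
     (\<forall>x \<in> wverts D. (\<forall>y. (y, x) \<notin> warcs D) \<longrightarrow> weight D x = 1)"

definition underlying_graph :: "'a wograph \<Rightarrow> 'a ugraph" where
  "underlying_graph D = \<lparr>uverts = wverts D, uedges = {{x, y} | x y. (x, y) \<in> warcs D}\<rparr>"

definition edge_ideal :: "'v wograph \<Rightarrow> ('v, 'k::field) mpoly set" where
  "edge_ideal D = ideal_of {var x * var y ^ weight D y | x y. (x, y) \<in> warcs D}"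

definition induced_wograph :: "'a wograph \<Rightarrow> 'a set \<Rightarrow> 'a wograph" where
  "induced_wograph D A =
     \<lparr>wverts = A, warcs = {(x, y) \<in> warcs D. x \<in> A \<and> y \<in> A}, weight = weight D\<rparr>"

text \<open>
  Each predicate below holds for a graph that is, up to renaming vertices, of the given form. Weights
  that are not mentioned are unconstrained, so sources may have any weight here.
\<close>

definition is_D1 :: "'a wograph \<Rightarrow> bool" where
  "is_D1 H \<longleftrightarrow> (\<exists>x1 x2 x3. distinct [x1, x2, x3] \<and> wverts H = {x1, x2, x3} \<and>
     warcs H = {(x1, x2), (x2, x3)} \<and> weight H x2 > 1 \<and> weight H x3 > 1)"

definition is_D2 :: "'a wograph \<Rightarrow> bool" where
  "is_D2 H \<longleftrightarrow> (\<exists>x1 x2 x3. distinct [x1, x2, x3] \<and> wverts H = {x1, x2, x3} \<and>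
     warcs H = {(x2, x1), (x2, x3)} \<and> weight H x1 > 1 \<and> weight H x3 > 1)"

definition is_D3 :: "'a wograph \<Rightarrow> bool" where
  "is_D3 H \<longleftrightarrow> (\<exists>x1 x2 x3. distinct [x1, x2, x3] \<and> wverts H = {x1, x2, x3} \<and>
     warcs H = {(x1, x2), (x2, x3), (x3, x1)} \<and>
     weight H x1 > 1 \<and> weight H x2 > 1 \<and> weight H x3 > 1)"

definition is_D4 :: "'a wograph \<Rightarrow> bool" where
  "is_D4 H \<longleftrightarrow> (\<exists>x1 x2 x3. distinct [x1, x2, x3] \<and> wverts H = {x1, x2, x3} \<and>
     warcs H = {(x1, x2), (x3, x2), (x1, x3)} \<and> weight H x2 > 1 \<and> weight H x3 > 1)"

definition is_D5 :: "'a wograph \<Rightarrow> bool" where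
  "is_D5 H \<longleftrightarrow> (\<exists>x1 x2 x3 x4. distinct [x1, x2, x3, x4] \<and> wverts H = {x1, x2, x3, x4} \<and>
     warcs H = {(x1, x2), (x2, x3), (x3, x4)} \<and>
     weight H x2 = 1 \<and> weight H x3 > 1 \<and> weight H x4 = 1)"

definition is_D6 :: "'a wograph \<Rightarrow> bool" where
  "is_D6 H \<longleftrightarrow> (\<exists>x1 x2 x3 x4. distinct [x1, x2, x3, x4] \<and> wverts H = {x1, x2, x3, x4} \<and>
     warcs H = {(x1, x2), (x2, x3), (x3, x4)} \<and>
     weight H x2 > 1 \<and> weight H x3 = 1 \<and> weight H x4 > 1)"

definition is_D7 :: "'a wograph \<Rightarrow> bool" where
  "is_D7 H \<longleftrightarrow> (\<exists>x1 x2 x3. distinct [x1, x2, x3] \<and> wverts H = {x1, x2, x3} \<and>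
     warcs H = {(x1, x2), (x2, x3), (x3, x1)} \<and>
     weight H x1 = 1 \<and> weight H x2 > 2 \<and> weight H x3 > 2)"

definition is_D8 :: "'a wograph \<Rightarrow> bool" where
  "is_D8 H \<longleftrightarrow> (\<exists>x1 x2 x3 x4. distinct [x1, x2, x3, x4] \<and> wverts H = {x1, x2, x3, x4} \<and>
     (warcs H = {(x2, x1), (x3, x4), (x2, x3)} \<or> warcs H = {(x2, x1), (x3, x4), (x3, x2)}) \<and>
     weight H x1 > 1 \<and> weight H x2 = 1 \<and> weight H x3 = 1 \<and> weight H x4 > 1)"

definition pattern_free :: "('a wograph \<Rightarrow> bool) \<Rightarrow> 'a wograph \<Rightarrow> bool" where
  "pattern_free P D \<longleftrightarrow> \<not> (\<exists>A \<subseteq> wverts D. P (induced_wograph D A))"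

end

theory Submission
  imports Defs "HOL-Library.Function_Algebras"
begin

text \<open>
  The minimal generators of \<open>HS\<^sub>0(I(D)) = I(D)\<close> are the edges, so linear quotients order the edges. For
  monomial ideals with linear quotients an explicit resolution shows that the \<open>k\<close>-th multidegrees
  are \<open>u\<^sub>i\<close> times a product of \<open>k\<close> distinct variables of the colon ideal of \<open>u\<^sub>i\<close>. Here those variables
  avoid the edge \<open>u\<^sub>i\<close>, so a multidegree determines \<open>k\<close> and the resolution is minimal.

  Linear quotients of any ideal force, within the generators dividing the least common multiple
  of two given ones, steps in which only one variable is gained. The patterns \<open>D\<^sub>1, \<dots>, D\<^sub>5\<close> violate this for
  the edges and \<open>D\<^sub>6, D\<^sub>7, D\<^sub>8\<close> for the first multidegrees. The complement of the graph formed by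
  any initial segment of the edges stays chordal when the next edge is removed. On an induced
  complement of \<open>H\<^sub>n\<close> the multidegrees of homological degree \<open>n - 4\<close> have only two possible
  supports, each of which contains two vertices missing from the other.
\<close>

section \<open>Monomial ideals\<close>

text \<open>Betti numbers are read off a resolution picked by a choice operator, so nothing can be
  said about them before a minimal resolution is known to exist and any two are known to have the
  same degrees. Moreover \<open>HS 0 J = J\<close> is needed before any linear quotients of
  \<open>J\<close> are known. This is why minimal resolutions are built for arbitrary monomial
  ideals, although the explicit resolution takes over once the edges are ordered. The edge order is
  a graph-theoretic object: distinct edges have distinct supports, so \<open>v\<close> is a colon
  variable of an edge exactly when it lies off the edge and an earlier edge joins it to one of the
  ends, whatever the weights are. Chordality and the graphs \<open>H_graph n\<close> use only this,
  and the weights enter through the eight patterns. Homological degree n - 4 belongs to supports of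
  n - 2 vertices: one whisker together with all but one vertex of the path that remains when the two
  whiskers are removed.\<close>

abbreviation lookup :: "('a \<Rightarrow>\<^sub>0 'b::zero) \<Rightarrow> 'a \<Rightarrow> 'b" where
  "lookup \<equiv> Poly_Mapping.lookup"

abbreviation keys :: "('a \<Rightarrow>\<^sub>0 'b::zero) \<Rightarrow> 'a set" where
  "keys \<equiv> Poly_Mapping.keys"

abbreviation expo_var :: "'v \<Rightarrow> 'v expo" where
  "expo_var v \<equiv> Poly_Mapping.single v 1"

definition adds :: "'v expo \<Rightarrow> 'v expo \<Rightarrow> bool" (infix \<open>adds\<close> 50) where
  "a adds b \<longleftrightarrow> (\<forall>v. lookup a v \<le> lookup b v)"

lemma adds_refl [simp]: "a adds a"
  by (simp add: adds_def)

lemma adds_trans [trans]: "a adds b \<Longrightarrow> b adds c \<Longrightarrow> a adds c"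
  unfolding adds_def using order_trans by blast

lemma adds_antisym: "a adds b \<Longrightarrow> b adds a \<Longrightarrow> a = b"
  by (auto simp: adds_def intro!: poly_mapping_eqI antisym)

lemma adds_add [simp]: "a adds a + b" "a adds b + a"
  by (auto simp: adds_def lookup_add)

lemma adds_minus_add: "a adds b \<Longrightarrow> b - a + a = b"
  by (auto simp: adds_def lookup_add lookup_minus intro!: poly_mapping_eqI)

lemma adds_iff_add: "a adds b \<longleftrightarrow> (\<exists>c. b = c + a)"
  using adds_minus_add[of a b] by (metis adds_add(2))

lemma expo_var_adds_iff: "expo_var v adds m \<longleftrightarrow> 0 < lookup m v"
  by (auto simp: adds_def lookup_single when_def Suc_le_eq)

lemma adds_keys_mono: "a adds b \<Longrightarrow> keys a \<subseteq> keys b"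
  by (auto simp: adds_def in_keys_iff) (metis le_zero_eq not_gr_zero)

lemma finite_adds: "finite {a :: 'v::finite expo. a adds b}"
proof (rule finite_imageD)
  have "lookup ` {a. a adds b} \<subseteq> {f. \<forall>v. f v \<in> {..lookup b v}}"
    by (auto simp: adds_def)
  moreover have "finite {f. \<forall>v::'v. f v \<in> {..lookup b v}}"
    using finite_PiE[of "UNIV :: 'v set" "\<lambda>v. {..lookup b v}"]
    by (simp add: PiE_def Pi_def extensional_def)
  ultimately show "finite (lookup ` {a. a adds b})"
    by (rule finite_subset)
  show "inj_on lookup {a. a adds b}"
    by (rule inj_onI, rule poly_mapping_eqI) simp
qed

interpretation ring_module: Modules.module "(*) :: 'r::comm_ring_1 \<Rightarrow> 'r \<Rightarrow> 'r"
  by unfold_locales (simp_all add: algebra_simps)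

lemma ideal_of_zero: "0 \<in> ideal_of S"
  by (simp add: ideal_of_def ring_module.span_zero)

lemma ideal_of_add: "x \<in> ideal_of S \<Longrightarrow> y \<in> ideal_of S \<Longrightarrow> x + y \<in> ideal_of S"
  by (simp add: ideal_of_def ring_module.span_add)

lemma ideal_of_mult: "x \<in> ideal_of S \<Longrightarrow> r * x \<in> ideal_of S"
  by (simp add: ideal_of_def ring_module.span_scale)

lemma ideal_of_base: "x \<in> S \<Longrightarrow> x \<in> ideal_of S"
  by (simp add: ideal_of_def ring_module.span_base)

lemma ideal_of_sum: "(\<And>i. i \<in> I \<Longrightarrow> f i \<in> ideal_of S) \<Longrightarrow> (\<Sum>i\<in>I. f i) \<in> ideal_of S"
  unfolding ideal_of_def by (rule ring_module.span_sum)

lemma var_eq_xpow: "var v = xpow (expo_var v)"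
  by (simp add: var_def)

lemma xpow_mult: "xpow a * xpow b = xpow (a + b)"
  by (simp add: xpow_def mult_single)

lemma keys_xpow [simp]: "keys (xpow a :: ('v, 'k::field) mpoly) = {a}"
  by (simp add: xpow_def)

lemma var_power: "(var v :: ('v, 'k::field) mpoly) ^ n = xpow (Poly_Mapping.single v n)"
proof (induction n)
  case 0
  then show ?case by (simp add: xpow_def)
next
  case (Suc n)
  then show ?case by (simp add: var_eq_xpow xpow_mult flip: single_add)
qed

lemma sum_monomials: "p = (\<Sum>m\<in>keys p. Poly_Mapping.single m (lookup p m))"
  by (rule poly_mapping_eqI)
    (auto simp: lookup_sum lookup_single when_def in_keys_iff)

lemma single_eq_mult_xpow: "Poly_Mapping.single (c + a) x = Poly_Mapping.single c x * xpow a"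
  by (simp add: xpow_def mult_single)

text \<open>The polynomials all of whose terms are divisible by some generator form a submodule, and
  conversely such a polynomial is the sum of its terms. Membership in a monomial ideal thereby
  becomes divisibility of exponents.\<close>

theorem mem_ideal_of_xpow_iff:
  fixes f :: "('v, 'k::field) mpoly"
  shows "f \<in> ideal_of (xpow ` A) \<longleftrightarrow> (\<forall>m\<in>keys f. \<exists>a\<in>A. a adds m)"
proof
  assume "f \<in> ideal_of (xpow ` A)"
  then have "f \<in> ring_module.span (xpow ` A)" by (simp add: ideal_of_def)
  then show "\<forall>m\<in>keys f. \<exists>a\<in>A. a adds m"
  proof (induction rule: ring_module.span_induct)
    case base
    show ?case
    proof (rule ring_module.subspaceI)
      fix c x :: "('v, 'k) mpoly"
      assume x: "x \<in> {f. \<forall>m\<in>keys f. \<exists>a\<in>A. a adds m}"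
      have "\<exists>a\<in>A. a adds m" if m: "m \<in> keys (c * x)" for m
      proof -
        obtain k n where "m = k + n" "n \<in> keys x"
          using m Poly_Mapping.keys_mult[of c x] by blast
        then show ?thesis
          using x by simp (meson adds_add(2) adds_trans)
      qed
      then show "c * x \<in> {f. \<forall>m\<in>keys f. \<exists>a\<in>A. a adds m}"
        by blast
    next
      fix x y :: "('v, 'k) mpoly"
      assume "x \<in> {f. \<forall>m\<in>keys f. \<exists>a\<in>A. a adds m}" "y \<in> {f. \<forall>m\<in>keys f. \<exists>a\<in>A. a adds m}"
      then show "x + y \<in> {f. \<forall>m\<in>keys f. \<exists>a\<in>A. a adds m}"
        using Poly_Mapping.keys_add[of x y] by blast
    qed simp
  qed (auto, metis adds_refl)
next
  assume *: "\<forall>m\<in>keys f. \<exists>a\<in>A. a adds m"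
  have "(\<Sum>m\<in>keys f. Poly_Mapping.single m (lookup f m)) \<in> ideal_of (xpow ` A)"
  proof (rule ideal_of_sum)
    fix m assume "m \<in> keys f"
    then obtain a c where "a \<in> A" "m = c + a"
      using * by (auto simp: adds_iff_add)
    then show "Poly_Mapping.single m (lookup f m) \<in> ideal_of (xpow ` A)"
      by (metis single_eq_mult_xpow ideal_of_mult ideal_of_base imageI)
  qed
  then show "f \<in> ideal_of (xpow ` A)"
    by (simp flip: sum_monomials)
qed

lemma xpow_mem_ideal_of_iff:
  "(xpow m :: ('v, 'k::field) mpoly) \<in> ideal_of (xpow ` A) \<longleftrightarrow> (\<exists>a\<in>A. a adds m)"
  by (simp add: mem_ideal_of_xpow_iff)

lemma mem_ideal_of_var_iff:
  fixes f :: "('v, 'k::field) mpoly"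
  shows "f \<in> ideal_of (var ` S) \<longleftrightarrow> (\<forall>m\<in>keys f. \<exists>v\<in>S. 0 < lookup m v)"
proof -
  have "(var ` S :: ('v, 'k) mpoly set) = xpow ` expo_var ` S"
    by (auto simp: var_eq_xpow image_image)
  then show ?thesis
    using mem_ideal_of_xpow_iff[of f "expo_var ` S"]
    by (simp add: expo_var_adds_iff del: One_nat_def)
qed

text \<open>Minimality of a resolution thus says that no entry of \<open>d (Suc k)\<close> has a
  constant term.\<close>

lemma mem_ideal_of_vars_iff:
  fixes f :: "('v, 'k::field) mpoly"
  shows "f \<in> ideal_of (range var) \<longleftrightarrow> lookup f 0 = 0"
proof -
  have "(\<exists>v. 0 < lookup m v) \<longleftrightarrow> m \<noteq> 0" for m :: "'v expo"
    by (metis poly_mapping_eqI lookup_zero not_gr_zero)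
  then show ?thesis
    using mem_ideal_of_var_iff[of f UNIV] by (auto simp: in_keys_iff)
qed

lemma lookup_mult_xpow:
  fixes f :: "('v, 'k::field) mpoly"
  shows "lookup (f * xpow a) (m + a) = lookup f m"
proof -
  have "f * xpow a = (\<Sum>m\<in>keys f. Poly_Mapping.single (m + a) (lookup f m))"
    by (subst sum_monomials[of f], subst sum_distrib_right) (simp add: single_eq_mult_xpow)
  then have "lookup (f * xpow a) (m + a) = (\<Sum>k\<in>keys f. lookup f k when k = m)"
    by (simp add: lookup_sum lookup_single)
  then show ?thesis by (auto simp: when_def in_keys_iff)
qed

lemma keys_mult_xpow:
  fixes f :: "('v, 'k::field) mpoly"
  shows "keys (f * xpow a) = (\<lambda>m. m + a) ` keys f"
proof -
  have "keys (f * xpow a) \<subseteq> (\<lambda>m. m + a) ` keys f"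
    using keys_mult[of f "xpow a"] by auto
  moreover have "m + a \<in> keys (f * xpow a)" if "m \<in> keys f" for m
    using that lookup_mult_xpow[of f a m] by (simp add: in_keys_iff)
  ultimately show ?thesis by auto
qed

text \<open>A variable outside \<open>S\<close> is a nonzerodivisor modulo the prime ideal generated
  by \<open>S\<close>. This computes the colon ideals of the relations in the explicit
  resolution.\<close>

lemma var_mult_mem_ideal_of_var:
  fixes f :: "('v, 'k::field) mpoly"
  assumes "f * var v \<in> ideal_of (var ` S)" "v \<notin> S"
  shows "f \<in> ideal_of (var ` S)"
  unfolding mem_ideal_of_var_iff
proof
  fix m assume "m \<in> keys f"
  then have "m + expo_var v \<in> keys (f * var v)"
    unfolding var_eq_xpow by (simp only: keys_mult_xpow) blast
  then obtain w where "w \<in> S" "0 < lookup (m + expo_var v) w"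
    using assms(1) unfolding mem_ideal_of_var_iff by blast
  then show "\<exists>w\<in>S. 0 < lookup m w"
    using assms(2) by (auto simp: lookup_add lookup_single when_def split: if_splits)
qed

text \<open>\<open>homog b a p\<close> says that \<open>p\<close> is homogeneous of degree \<open>a\<close> in the shifted module \<open>R(- b)\<close>.\<close>

definition hpart :: "'v expo \<Rightarrow> 'v expo \<Rightarrow> ('v, 'k::zero) mpoly \<Rightarrow> ('v, 'k) mpoly" where
  "hpart b a p = Poly_Mapping.mapp (\<lambda>m x. x when m + b = a) p"

definition homog :: "'v expo \<Rightarrow> 'v expo \<Rightarrow> ('v, 'k::zero) mpoly \<Rightarrow> bool" where
  "homog b a p \<longleftrightarrow> (\<forall>m\<in>keys p. m + b = a)"

lemma lookup_hpart: "lookup (hpart b a p) m = (lookup p m when m + b = a)"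
  by (auto simp: hpart_def lookup_mapp when_def in_keys_iff)

lemma homog_hpart: "homog b a (hpart b a p)"
  by (auto simp: homog_def in_keys_iff lookup_hpart)

lemma hpart_homog: "homog b a p \<Longrightarrow> hpart b a p = p"
  by (rule poly_mapping_eqI) (auto simp: homog_def lookup_hpart when_def in_keys_iff)

lemma hpart_zero [simp]: "hpart b a 0 = 0"
  by (rule poly_mapping_eqI) (simp add: lookup_hpart)

lemma hpart_add: "hpart b a (p + q) = hpart b a p + hpart b a (q :: ('v, 'k::comm_monoid_add) mpoly)"
  by (rule poly_mapping_eqI) (simp add: lookup_hpart lookup_add when_def)

lemma hpart_sum:
  fixes f :: "'i \<Rightarrow> ('v, 'k::comm_monoid_add) mpoly"
  shows "hpart b a (\<Sum>i\<in>I. f i) = (\<Sum>i\<in>I. hpart b a (f i))"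
  by (induction I rule: infinite_finite_induct) (simp_all add: hpart_add)

lemma homog_single: "m + b = a \<Longrightarrow> homog b a (Poly_Mapping.single m x)"
  by (simp add: homog_def)

lemma homog_xpow: "m + b = a \<Longrightarrow> homog b a (xpow m)"
  by (simp add: xpow_def homog_single)

lemma homog_zero [simp]: "homog b a 0"
  by (simp add: homog_def)

text \<open>Each graded piece of the shifted ring is at most one-dimensional over the field, spanned
  by one monomial; in a fixed degree, linear algebra over the ring is linear algebra over
  scalars.\<close>

lemma homog_eq_single:
  assumes "homog b a p" "p \<noteq> 0"
  shows "b adds a \<and> p = Poly_Mapping.single (a - b) (lookup p (a - b))"
proof -
  obtain m where "m \<in> keys p" using assms(2) by (auto simp flip: keys_eq_empty)
  have "k = a - b" if "k \<in> keys p" for k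
    using that assms(1) by (auto simp: homog_def)
  moreover have "b adds a" using \<open>m \<in> keys p\<close> assms(1) by (auto simp: homog_def)
  ultimately show ?thesis
    by (auto intro!: poly_mapping_eqI simp: lookup_single when_def in_keys_iff)
qed

text \<open>Multiplication by a homogeneous \<open>p\<close> shifts all degrees by the same amount,
  so it commutes with taking components. Both sides are additive in \<open>q\<close>, which reduces
  the claim to single terms.\<close>

lemma hpart_mult_homog:
  fixes p q :: "('v, 'k::field) mpoly"
  assumes "homog b c p"
  shows "hpart b a (q * p) = hpart c a q * p"
proof (cases "p = 0")
  case False
  then obtain m x where m: "m + b = c" "p = Poly_Mapping.single m x"
    using homog_eq_single[OF assms False] adds_minus_add by blast
  have "hpart b a (Poly_Mapping.single k y * p) = hpart c a (Poly_Mapping.single k y) * p" for k y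
  proof (cases "k + c = a")
    case True
    then have "k + m + b = a" using m by (simp add: add.assoc)
    then show ?thesis using True m by (simp add: mult_single hpart_homog homog_single)
  next
    case False
    then have "k + m + b \<noteq> a" using m by (simp add: add.assoc)
    then have "hpart b a (Poly_Mapping.single (k + m) (y * x)) = 0"
      by (intro poly_mapping_eqI) (auto simp: lookup_hpart lookup_single when_def)
    moreover have "hpart c a (Poly_Mapping.single k y) = 0"
      using False by (intro poly_mapping_eqI) (auto simp: lookup_hpart lookup_single when_def)
    ultimately show ?thesis using m by (simp add: mult_single)
  qed
  then have "hpart b a ((\<Sum>m\<in>keys q. Poly_Mapping.single m (lookup q m)) * p)
      = hpart c a (\<Sum>m\<in>keys q. Poly_Mapping.single m (lookup q m)) * p"
    unfolding sum_distrib_right hpart_sum by simp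
  then show ?thesis
    by (simp flip: sum_monomials)
qed simp

lemma hpart_decomp:
  fixes p :: "('v, 'k::field) mpoly"
  assumes "finite F" "\<And>m. m \<in> keys p \<Longrightarrow> m + b \<in> F"
  shows "p = (\<Sum>a\<in>F. hpart b a p)"
proof (rule poly_mapping_eqI)
  fix m
  have "lookup (\<Sum>a\<in>F. hpart b a p) m = (\<Sum>a\<in>F. lookup p m when a = m + b)"
    by (simp add: lookup_sum lookup_hpart eq_commute[of "m + b"])
  also have "\<dots> = (lookup p m when m + b \<in> F)"
    using assms(1) by (simp add: when_def)
  also have "\<dots> = lookup p m"
    using assms(2)[of m] by (auto simp: when_def in_keys_iff)
  finally show "lookup p m = lookup (\<Sum>a\<in>F. hpart b a p) m" by simp
qed

section \<open>Comparison of free resolutions\<close>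

definition hom_mat :: "'v expo list \<Rightarrow> 'v expo list \<Rightarrow> ('v, 'k::field) mpoly mat \<Rightarrow> bool" where
  "hom_mat ds es A \<longleftrightarrow> A \<in> carrier_mat (length ds) (length es) \<and>
     (\<forall>i < length ds. \<forall>j < length es. homog (ds ! i) (es ! j) (A $$ (i, j)))"

lemma multigraded_free_resolution_iff:
  "multigraded_free_resolution J degs d \<longleftrightarrow>
     (\<forall>k. hom_mat (target_degs degs k) (degs k) (d k)) \<and>
     (\<lambda>v. v $ 0) ` mat_image (d 0) = J \<and>
     (\<forall>k. mat_kernel (d k) = mat_image (d (Suc k)))"
  unfolding multigraded_free_resolution_def hom_mat_def homog_def by blast

lemma factor_through_image:
  fixes B :: "'r::comm_ring_1 mat"
  assumes B: "B \<in> carrier_mat n q" and X: "X \<in> carrier_mat n r"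
    and im: "\<And>j. j < r \<Longrightarrow> col X j \<in> mat_image B"
  obtains Y where "Y \<in> carrier_mat q r" "B * Y = X"
proof -
  have "\<exists>v. v \<in> carrier_vec q \<and> B *\<^sub>v v = col X j" if "j < r" for j
    using im[OF that] B by (fastforce simp: mat_image_def)
  then obtain y where y: "\<And>j. j < r \<Longrightarrow> y j \<in> carrier_vec q \<and> B *\<^sub>v y j = col X j"
    by metis
  define Y where "Y = mat_of_cols q (map y [0..<r])"
  have Y: "Y \<in> carrier_mat q r"
    using mat_of_cols_carrier(1)[of q "map y [0..<r]"] by (simp add: Y_def)
  have "B * Y = X"
  proof (rule mat_col_eqI)
    fix j assume "j < dim_col X"
    then have j: "j < r" using X by simp
    then have "col Y j = y j" using y by (simp add: Y_def)
    then show "col (B * Y) j = col X j"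
      using y[OF j] col_mult2[OF B Y j] by metis
  qed (use B X Y in auto)
  then show ?thesis using that Y by blast
qed

text \<open>Any lift will do to begin with: cutting its entries down to the components of the right
  degree leaves the product unchanged, because \<open>B\<close> and \<open>X\<close> are
  homogeneous.\<close>

lemma factor_through_image_homog:
  assumes B: "hom_mat ds es B" and X: "hom_mat ds fs X"
    and im: "\<And>j. j < length fs \<Longrightarrow> col X j \<in> mat_image B"
  obtains Y where "hom_mat es fs Y" "B * Y = X"
proof -
  have Bc: "B \<in> carrier_mat (length ds) (length es)" and Xc: "X \<in> carrier_mat (length ds) (length fs)"
    using B X by (simp_all add: hom_mat_def)
  obtain Y where Y: "Y \<in> carrier_mat (length es) (length fs)" "B * Y = X"
    using factor_through_image[OF Bc Xc im] .
  define Z where "Z = mat (length es) (length fs) (\<lambda>(l, j). hpart (es ! l) (fs ! j) (Y $$ (l, j)))"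
  have "B * Z = X"
  proof (rule eq_matI)
    fix i j assume "i < dim_row X" "j < dim_col X"
    then have ij: "i < length ds" "j < length fs" using Xc by auto
    have "(B * Z) $$ (i, j) = (\<Sum>l<length es. Z $$ (l, j) * B $$ (i, l))"
      using Bc ij by (auto simp: Z_def scalar_prod_def lessThan_atLeast0 mult.commute intro!: sum.cong)
    also have "\<dots> = (\<Sum>l<length es. hpart (ds ! i) (fs ! j) (Y $$ (l, j) * B $$ (i, l)))"
    proof (intro sum.cong refl)
      fix l assume "l \<in> {..<length es}"
      then have "homog (ds ! i) (es ! l) (B $$ (i, l))"
        using B ij by (simp add: hom_mat_def)
      from hpart_mult_homog[OF this] \<open>l \<in> _\<close> show "Z $$ (l, j) * B $$ (i, l) =
        hpart (ds ! i) (fs ! j) (Y $$ (l, j) * B $$ (i, l))"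
        using ij by (simp add: Z_def)
    qed
    also have "\<dots> = hpart (ds ! i) (fs ! j) ((B * Y) $$ (i, j))"
      using Bc Y ij
      by (auto simp: hpart_sum[symmetric] scalar_prod_def lessThan_atLeast0 mult.commute
          intro!: sum.cong arg_cong[of _ _ "hpart _ _"])
    also have "\<dots> = X $$ (i, j)"
      using X ij Y by (simp add: hom_mat_def hpart_homog)
    finally show "(B * Z) $$ (i, j) = X $$ (i, j)" .
  qed (use Bc Xc Z_def in auto)
  moreover have "hom_mat es fs Z"
    by (simp add: hom_mat_def Z_def homog_hpart)
  ultimately show ?thesis using that by blast
qed

lemma col_mem_mat_kernel:
  fixes A :: "'r::comm_ring_1 mat"
  assumes "A \<in> carrier_mat n p" "X \<in> carrier_mat p r" "A * X = 0\<^sub>m n r" "j < r"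
  shows "col X j \<in> mat_kernel A"
  using assms by (intro mat_kernelI[of A n p]) (auto simp flip: col_mult2)

lemma col_mem_mat_image:
  fixes B :: "'r::comm_ring_1 mat"
  assumes "B \<in> carrier_mat n q" "j < q"
  shows "col B j \<in> mat_image B"
proof -
  have "col B j = B *\<^sub>v unit_vec q j"
    using assms by (intro eq_vecI) auto
  then show ?thesis
    using assms unfolding mat_image_def by auto
qed

lemma mult_eq_zero_if_image_eq_kernel:
  fixes A B :: "'r::comm_ring_1 mat"
  assumes A: "A \<in> carrier_mat n p" and B: "B \<in> carrier_mat p q" and ker: "mat_kernel A = mat_image B"
  shows "A * B = 0\<^sub>m n q"
proof (rule mat_col_eqI)
  fix j assume "j < dim_col (0\<^sub>m n q :: 'r mat)"
  then have j: "j < q" by simp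
  have "col B j \<in> mat_image B"
    using B j by (rule col_mem_mat_image)
  then show "col (A * B) j = col (0\<^sub>m n q) j"
    using mat_kernelD(2)[OF A] ker col_mult2[OF A B j] j by (metis col_zero)
qed (use A B in auto)

lemma hom_mat_mult:
  assumes "hom_mat ds es A" "hom_mat es fs B"
  shows "hom_mat ds fs (A * B)"
  unfolding hom_mat_def
proof (intro conjI allI impI)
  have A: "A \<in> carrier_mat (length ds) (length es)" and B: "B \<in> carrier_mat (length es) (length fs)"
    using assms by (auto simp: hom_mat_def)
  then show "A * B \<in> carrier_mat (length ds) (length fs)" by simp
  fix i j assume ij: "i < length ds" "j < length fs"
  have eq: "(A * B) $$ (i, j) = (\<Sum>l<length es. B $$ (l, j) * A $$ (i, l))"
    using A B ij by (auto simp: scalar_prod_def lessThan_atLeast0 mult.commute intro!: sum.cong)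
  also have "\<dots> = hpart (ds ! i) (fs ! j) \<dots>"
    unfolding hpart_sum
  proof (intro sum.cong refl)
    fix l assume "l \<in> {..<length es}"
    then have "homog (ds ! i) (es ! l) (A $$ (i, l))" "homog (es ! l) (fs ! j) (B $$ (l, j))"
      using assms ij by (auto simp: hom_mat_def)
    then show "B $$ (l, j) * A $$ (i, l) = hpart (ds ! i) (fs ! j) (B $$ (l, j) * A $$ (i, l))"
      by (simp add: hpart_mult_homog hpart_homog)
  qed
  finally show "homog (ds ! i) (fs ! j) ((A * B) $$ (i, j))"
    by (metis eq homog_hpart)
qed

text \<open>The comparison theorem in graded form: the lifts are built one position at a time from
  the exactness of the second resolution.\<close>

lemma chain_map_over_identity:
  assumes F: "multigraded_free_resolution J degs d" and G: "multigraded_free_resolution J degs' d'"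
  obtains P where "\<forall>k. hom_mat (degs' k) (degs k) (P k)" "d' 0 * P 0 = d 0"
    "\<forall>k. d' (Suc k) * P (Suc k) = P k * d (Suc k)"
proof -
  have hF: "hom_mat (target_degs degs k) (degs k) (d k)"
    and hG: "hom_mat (target_degs degs' k) (degs' k) (d' k)" for k
    using F G by (auto simp: multigraded_free_resolution_iff)
  have hFS: "hom_mat (degs k) (degs (Suc k)) (d (Suc k))"
    and hGS: "hom_mat (degs' k) (degs' (Suc k)) (d' (Suc k))" for k
    using hF[of "Suc k"] hG[of "Suc k"] by (simp_all add: target_degs_def)
  have hF0: "hom_mat [0] (degs 0) (d 0)" and hG0: "hom_mat [0] (degs' 0) (d' 0)"
    using hF[of 0] hG[of 0] by (simp_all add: target_degs_def)
  have kF: "mat_kernel (d k) = mat_image (d (Suc k))"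
    and kG: "mat_kernel (d' k) = mat_image (d' (Suc k))" for k
    using F G by (auto simp: multigraded_free_resolution_iff)
  have cF: "d k \<in> carrier_mat (length (target_degs degs k)) (length (degs k))"
    and cG: "d' k \<in> carrier_mat (length (target_degs degs' k)) (length (degs' k))" for k
    using hF hG by (auto simp: hom_mat_def)
  have ddF: "d k * d (Suc k) = 0\<^sub>m (length (target_degs degs k)) (length (degs (Suc k)))" for k
    using cF[of k] hFS[of k] kF by (intro mult_eq_zero_if_image_eq_kernel) (auto simp: hom_mat_def)
  have base: "\<exists>P. hom_mat (degs' 0) (degs 0) P \<and> d' 0 * P = d 0"
  proof (rule factor_through_image_homog[OF hG0 hF0])
    fix j assume j: "j < length (degs 0)"
    have c0: "d 0 \<in> carrier_mat 1 (length (degs 0))" "d' 0 \<in> carrier_mat 1 (length (degs' 0))"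
      using hF0 hG0 by (auto simp: hom_mat_def)
    have "col (d 0) j \<in> mat_image (d 0)"
      using c0(1) j by (rule col_mem_mat_image)
    then have "col (d 0) j $ 0 \<in> (\<lambda>v. v $ 0) ` mat_image (d' 0)"
      using F G by (auto simp: multigraded_free_resolution_iff)
    then obtain w where w: "w \<in> mat_image (d' 0)" "col (d 0) j $ 0 = w $ 0" by auto
    then have "dim_vec w = 1" using c0 by (auto simp: mat_image_def)
    then have "col (d 0) j = w" using w c0 by (intro eq_vecI) auto
    then show "col (d 0) j \<in> mat_image (d' 0)" using w by simp
  qed auto
  have inv0: "d' 0 * P * d (Suc 0) = 0\<^sub>m 1 (length (degs (Suc 0)))" if "d' 0 * P = d 0" for P
    using that ddF[of 0] by (simp add: target_degs_def)
  \<comment> \<open>The vanishing product says that \<open>P\<close> sends the image of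
    \<open>d (Suc k)\<close> into the kernel of \<open>d' k\<close>. It belongs to the invariant
    because the choice of the next lift sees only \<open>P\<close>, not the earlier maps.\<close>
  let ?P = "\<lambda>k P. hom_mat (degs' k) (degs k) P \<and>
    d' k * P * d (Suc k) = 0\<^sub>m (length (target_degs degs' k)) (length (degs (Suc k))) \<and>
    (k = 0 \<longrightarrow> d' 0 * P = d 0)"
  let ?R = "\<lambda>k P Q. d' (Suc k) * Q = P * d (Suc k)"
  have "\<exists>P. \<forall>k. ?P k (P k) \<and> ?R k (P k) (P (Suc k))"
  proof (rule dependent_nat_choice)
    show "\<exists>P. ?P 0 P" using base inv0 by (auto simp: target_degs_def)
  next
    fix P k
    assume P: "?P k P"
    then have Pc: "P \<in> carrier_mat (length (degs' k)) (length (degs k))" by (simp add: hom_mat_def)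
    have Fc: "d (Suc k) \<in> carrier_mat (length (degs k)) (length (degs (Suc k)))"
      and Gc: "d' (Suc k) \<in> carrier_mat (length (degs' k)) (length (degs' (Suc k)))"
      using hFS[of k] hGS[of k] by (auto simp: hom_mat_def)
    have hPd: "hom_mat (degs' k) (degs (Suc k)) (P * d (Suc k))"
      using P hFS by (auto intro: hom_mat_mult)
    obtain Q where Q: "hom_mat (degs' (Suc k)) (degs (Suc k)) Q" "d' (Suc k) * Q = P * d (Suc k)"
    proof (rule factor_through_image_homog[OF hGS hPd])
      fix j assume j: "j < length (degs (Suc k))"
      have "d' k * (P * d (Suc k)) = 0\<^sub>m (length (target_degs degs' k)) (length (degs (Suc k)))"
        using P assoc_mult_mat[OF cG[of k] Pc Fc] by simp
      then show "col (P * d (Suc k)) j \<in> mat_image (d' (Suc k))"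
        using col_mem_mat_kernel[OF cG[of k] mult_carrier_mat[OF Pc Fc] _ j] kG by blast
    qed auto
    have Fc2: "d (Suc (Suc k)) \<in> carrier_mat (length (degs (Suc k))) (length (degs (Suc (Suc k))))"
      using hFS[of "Suc k"] by (auto simp: hom_mat_def)
    have "P * d (Suc k) * d (Suc (Suc k)) = P * (d (Suc k) * d (Suc (Suc k)))"
      using Pc Fc Fc2 by (rule assoc_mult_mat)
    also have "\<dots> = 0\<^sub>m (length (degs' k)) (length (degs (Suc (Suc k))))"
      using ddF[of "Suc k"] Pc by (simp add: target_degs_def)
    finally have "d' (Suc k) * Q * d (Suc (Suc k))
      = 0\<^sub>m (length (target_degs degs' (Suc k))) (length (degs (Suc (Suc k))))"
      using Q by (simp add: target_degs_def)
    then show "\<exists>Q. ?P (Suc k) Q \<and> ?R k P Q" using Q by auto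
  qed
  then obtain P where "\<forall>k. hom_mat (degs' k) (degs k) (P k) \<and> (k = 0 \<longrightarrow> d' 0 * P k = d 0) \<and>
      d' (Suc k) * P (Suc k) = P k * d (Suc k)"
    by blast
  then show ?thesis by (intro that[of P]) auto
qed

text \<open>The homotopy is obtained by lifting \<open>E (Suc k) - h k * d (Suc k)\<close> through
  \<open>d (Suc (Suc k))\<close>. This difference is a cycle because
  \<open>(E k - d (Suc k) * h k) * d (Suc k)\<close> vanishes, a fact carried along in the
  recursion.\<close>

lemma null_homotopy:
  fixes d :: "nat \<Rightarrow> 'r::comm_ring_1 mat"
  assumes d: "\<And>k. d (Suc k) \<in> carrier_mat (n k) (n (Suc k))" and d0: "d 0 \<in> carrier_mat t (n 0)"
    and ker: "\<And>k. mat_kernel (d k) = mat_image (d (Suc k))"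
    and E: "\<And>k. E k \<in> carrier_mat (n k) (n k)" and E0: "d 0 * E 0 = 0\<^sub>m t (n 0)"
    and chain: "\<And>k. d (Suc k) * E (Suc k) = E k * d (Suc k)"
  obtains h where "\<forall>k. h k \<in> carrier_mat (n (Suc k)) (n k)" "E 0 = d (Suc 0) * h 0"
    "\<forall>k. E (Suc k) = d (Suc (Suc k)) * h (Suc k) + h k * d (Suc k)"
proof -
  have dd: "d (Suc k) * d (Suc (Suc k)) = 0\<^sub>m (n k) (n (Suc (Suc k)))" for k
    by (rule mult_eq_zero_if_image_eq_kernel[OF d d ker])
  let ?P = "\<lambda>k h. h \<in> carrier_mat (n (Suc k)) (n k) \<and>
    (E k - d (Suc k) * h) * d (Suc k) = 0\<^sub>m (n k) (n (Suc k)) \<and> (k = 0 \<longrightarrow> E 0 = d (Suc 0) * h)"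
  let ?R = "\<lambda>k h h'. E (Suc k) = d (Suc (Suc k)) * h' + h * d (Suc k)"
  have "\<exists>h. \<forall>k. ?P k (h k) \<and> ?R k (h k) (h (Suc k))"
  proof (rule dependent_nat_choice)
    obtain h where h: "h \<in> carrier_mat (n (Suc 0)) (n 0)" "d (Suc 0) * h = E 0"
    proof (rule factor_through_image[OF d E])
      show "col (E 0) j \<in> mat_image (d (Suc 0))" if "j < n 0" for j
        using col_mem_mat_kernel[OF d0 E E0 that] ker by simp
    qed auto
    then have "(E 0 - d (Suc 0) * h) * d (Suc 0) = 0\<^sub>m (n 0) (n (Suc 0))"
      using d[of 0] E[of 0] by (simp add: minus_r_inv_mat)
    then show "\<exists>h. ?P 0 h" using h by auto
  next
    fix h k
    assume A: "?P k h"
    then have hc: "h \<in> carrier_mat (n (Suc k)) (n k)" by simp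
    define X where "X = E (Suc k) - h * d (Suc k)"
    have X: "X \<in> carrier_mat (n (Suc k)) (n (Suc k))"
      using E d[of k] A by (auto simp: X_def)
    have "d (Suc k) * X = d (Suc k) * E (Suc k) - d (Suc k) * (h * d (Suc k))"
      unfolding X_def using d[of k] E[of "Suc k"] A by (intro mult_minus_distrib_mat) auto
    also have "\<dots> = E k * d (Suc k) - (d (Suc k) * h) * d (Suc k)"
      using assoc_mult_mat[OF d hc d] chain by simp
    also have "\<dots> = (E k - d (Suc k) * h) * d (Suc k)"
      using d[of k] A E[of k] by (intro minus_mult_distrib_mat[symmetric]) auto
    finally have dX: "d (Suc k) * X = 0\<^sub>m (n k) (n (Suc k))" using A by simp
    obtain h' where h': "h' \<in> carrier_mat (n (Suc (Suc k))) (n (Suc k))" "d (Suc (Suc k)) * h' = X"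
    proof (rule factor_through_image[OF d X])
      show "col X j \<in> mat_image (d (Suc (Suc k)))" if "j < n (Suc k)" for j
        using col_mem_mat_kernel[OF d X dX that] ker by simp
    qed auto
    have eq: "E (Suc k) = d (Suc (Suc k)) * h' + h * d (Suc k)"
      unfolding h' X_def using E[of "Suc k"] A d[of k] by (intro eq_matI) auto
    then have "E (Suc k) - d (Suc (Suc k)) * h' = h * d (Suc k)"
      using h' A d[of "Suc k"] d[of k] by (intro eq_matI) auto
    then have "(E (Suc k) - d (Suc (Suc k)) * h') * d (Suc (Suc k)) = h * (d (Suc k) * d (Suc (Suc k)))"
      using assoc_mult_mat[OF hc d d] by simp
    also have "\<dots> = 0\<^sub>m (n (Suc k)) (n (Suc (Suc k)))"
      using hc by (simp add: dd)
    finally show "\<exists>h'. ?P (Suc k) h' \<and> ?R k h h'" using h' eq by auto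
  qed
  then obtain h where "\<forall>k. h k \<in> carrier_mat (n (Suc k)) (n k) \<and> (k = 0 \<longrightarrow> E 0 = d (Suc 0) * h k) \<and>
      E (Suc k) = d (Suc (Suc k)) * h (Suc k) + h k * d (Suc k)"
    by blast
  then show ?thesis by (intro that[of h]) auto
qed

lemma ideal_of_mult_right: "x \<in> ideal_of S \<Longrightarrow> x * r \<in> ideal_of S"
  using ideal_of_mult[of x S r] by (simp add: mult.commute)

lemma mat_mult_index_sum:
  assumes "A \<in> carrier_mat n p" "B \<in> carrier_mat p q" "i < n" "j < q"
  shows "(A * B) $$ (i, j) = (\<Sum>l<p. A $$ (i, l) * B $$ (l, j))"
  using assms by (auto simp: scalar_prod_def lessThan_atLeast0 intro!: sum.cong)

lemma lookup_zero_mult: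
  fixes p q :: "('v, 'k::field) mpoly"
  assumes "lookup (p * q) 0 \<noteq> 0"
  shows "lookup p 0 \<noteq> 0" "lookup q 0 \<noteq> 0"
  using assms ideal_of_mult_right[of p "range var" q] ideal_of_mult[of q "range var" p]
  by (auto simp: mem_ideal_of_vars_iff)

text \<open>Two lifts of the identity of \<open>J\<close> are composed to a chain endomorphism of the minimal resolution;
  it is homotopic to the identity, and the homotopy formula has entries in the irrelevant ideal.\<close>

theorem minimal_resolution_degs_subset:
  assumes F: "minimal_multigraded_free_resolution J degs d"
    and G: "multigraded_free_resolution J degs' d'"
  shows "set (degs k) \<subseteq> set (degs' k)"
proof
  have F': "multigraded_free_resolution J degs d" and
    min: "\<And>k i j. i < length (degs k) \<Longrightarrow> j < length (degs (Suc k)) \<Longrightarrow>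
        d (Suc k) $$ (i, j) \<in> ideal_of (range var)"
    using F by (auto simp: minimal_multigraded_free_resolution_def)
  obtain P where P: "\<forall>k. hom_mat (degs' k) (degs k) (P k)" "d' 0 * P 0 = d 0"
    "\<forall>k. d' (Suc k) * P (Suc k) = P k * d (Suc k)"
    by (rule chain_map_over_identity[OF F' G])
  obtain Q where Q: "\<forall>k. hom_mat (degs k) (degs' k) (Q k)" "d 0 * Q 0 = d' 0"
    "\<forall>k. d (Suc k) * Q (Suc k) = Q k * d' (Suc k)"
    by (rule chain_map_over_identity[OF G F'])
  define n where "n k = length (degs k)" for k
  have Pc: "P k \<in> carrier_mat (length (degs' k)) (n k)"
    and Qc: "Q k \<in> carrier_mat (n k) (length (degs' k))" for k
    using P Q by (auto simp: hom_mat_def n_def)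
  have dc: "d (Suc k) \<in> carrier_mat (n k) (n (Suc k))" and d0: "d 0 \<in> carrier_mat 1 (n 0)"
    and dc': "d' (Suc k) \<in> carrier_mat (length (degs' k)) (length (degs' (Suc k)))"
    and d0': "d' 0 \<in> carrier_mat 1 (length (degs' 0))" for k
  proof -
    have "hom_mat (target_degs degs k) (degs k) (d k)" "hom_mat (target_degs degs' k) (degs' k) (d' k)" for k
      using F' G by (auto simp: multigraded_free_resolution_iff)
    from this[of 0] this[of "Suc k"]
    show "d (Suc k) \<in> carrier_mat (n k) (n (Suc k))" "d 0 \<in> carrier_mat 1 (n 0)"
      "d' (Suc k) \<in> carrier_mat (length (degs' k)) (length (degs' (Suc k)))"
      "d' 0 \<in> carrier_mat 1 (length (degs' 0))"
      by (simp_all add: hom_mat_def target_degs_def n_def)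
  qed
  have ker: "mat_kernel (d k) = mat_image (d (Suc k))" for k
    using F' by (auto simp: multigraded_free_resolution_iff)
  define E where "E k = Q k * P k - 1\<^sub>m (n k)" for k
  have E: "E k \<in> carrier_mat (n k) (n k)" for k
    unfolding E_def by (rule minus_carrier_mat) simp
  have E0: "d 0 * E 0 = 0\<^sub>m 1 (n 0)"
  proof -
    have "d 0 * E 0 = d 0 * (Q 0 * P 0) - d 0 * 1\<^sub>m (n 0)"
      unfolding E_def using d0 Pc[of 0] Qc[of 0] by (intro mult_minus_distrib_mat) auto
    also have "d 0 * (Q 0 * P 0) = d 0 * Q 0 * P 0"
      using d0 Pc[of 0] Qc[of 0] by (simp add: assoc_mult_mat)
    finally show ?thesis using d0 P Q by (simp add: minus_r_inv_mat)
  qed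
  have chain: "d (Suc k) * E (Suc k) = E k * d (Suc k)" for k
  proof -
    have "d (Suc k) * E (Suc k) = d (Suc k) * (Q (Suc k) * P (Suc k)) - d (Suc k) * 1\<^sub>m (n (Suc k))"
      unfolding E_def using dc[of k] Pc[of "Suc k"] Qc[of "Suc k"] by (intro mult_minus_distrib_mat) auto
    also have "d (Suc k) * (Q (Suc k) * P (Suc k)) = d (Suc k) * Q (Suc k) * P (Suc k)"
      using dc[of k] Pc[of "Suc k"] Qc[of "Suc k"] by (simp add: assoc_mult_mat)
    also have "\<dots> = Q k * (d' (Suc k) * P (Suc k))"
      unfolding Q(3)[rule_format] using dc'[of k] Pc[of "Suc k"] Qc[of k] by (simp add: assoc_mult_mat)
    also have "\<dots> = Q k * P k * d (Suc k)"
      unfolding P(3)[rule_format] using dc[of k] Pc[of k] Qc[of k] by (simp add: assoc_mult_mat)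
    also have "d (Suc k) * 1\<^sub>m (n (Suc k)) = 1\<^sub>m (n k) * d (Suc k)"
      using dc[of k] by simp
    also have "Q k * P k * d (Suc k) - 1\<^sub>m (n k) * d (Suc k) = E k * d (Suc k)"
      unfolding E_def using dc[of k] Pc[of k] Qc[of k]
      by (intro minus_mult_distrib_mat[symmetric]) auto
    finally show ?thesis .
  qed
  obtain h where h: "\<forall>k. h k \<in> carrier_mat (n (Suc k)) (n k)" "E 0 = d (Suc 0) * h 0"
    "\<forall>k. E (Suc k) = d (Suc (Suc k)) * h (Suc k) + h k * d (Suc k)"
    by (rule null_homotopy[of d n 1 E, OF dc d0 ker E E0 chain])
  have dh: "(d (Suc k) * h k) $$ (i, j) \<in> ideal_of (range var)" if "i < n k" "j < n k" for i j k
    using that min[of _ k] unfolding mat_mult_index_sum[OF dc[of k] h(1)[rule_format, of k] that]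
    by (intro ideal_of_sum ideal_of_mult_right) (auto simp: n_def)
  have hd: "(h k * d (Suc k)) $$ (i, j) \<in> ideal_of (range var)" if "i < n (Suc k)" "j < n (Suc k)" for i j k
    using that min[of _ k] unfolding mat_mult_index_sum[OF h(1)[rule_format, of k] dc[of k] that]
    by (intro ideal_of_sum ideal_of_mult) (auto simp: n_def)
  have Em: "E k $$ (i, j) \<in> ideal_of (range var)" if "i < n k" "j < n k" for i j
  proof (cases k)
    case 0
    then show ?thesis using dh[of i 0 j] that by (simp add: h)
  next
    case (Suc l)
    then show ?thesis
      using dh[of i "Suc l" j] hd[of i l j] that dc[of l] h(1)[rule_format, of l]
      by (simp add: h(3) ideal_of_add)
  qed
  fix a assume "a \<in> set (degs k)"
  then obtain i where i: "i < n k" "degs k ! i = a" by (auto simp: in_set_conv_nth n_def)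
  \<comment> \<open>Since \<open>E k\<close> is \<open>Q k * P k\<close> minus the identity, the
    diagonal entry of the product has constant term 1. Some summand then has a nonzero constant
    term, and a homogeneous entry of \<open>P k\<close> with a constant term joins equal
    degrees.\<close>
  have "lookup (E k $$ (i, i)) 0 = 0"
    using Em[of i i] i by (simp add: mem_ideal_of_vars_iff)
  moreover have "E k $$ (i, i) = (Q k * P k) $$ (i, i) - 1"
    using i Pc[of k] Qc[of k] by (simp add: E_def)
  ultimately have "lookup (\<Sum>l<length (degs' k). Q k $$ (i, l) * P k $$ (l, i)) 0 \<noteq> 0"
    unfolding mat_mult_index_sum[OF Qc Pc i(1) i(1)] by (simp add: lookup_minus)
  then obtain l where l: "l < length (degs' k)" "lookup (Q k $$ (i, l) * P k $$ (l, i)) 0 \<noteq> 0"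
    unfolding lookup_sum by (meson lessThan_iff sum.neutral)
  then have "0 \<in> keys (P k $$ (l, i))"
    using lookup_zero_mult by (auto simp: in_keys_iff)
  then have "degs' k ! l = a"
    using P(1)[rule_format, of k] l i by (fastforce simp: hom_mat_def homog_def n_def)
  then show "a \<in> set (degs' k)" using l by auto
qed

section \<open>Resolutions given by lists of vectors\<close>

text \<open>Vectors are functions on all naturals, so free modules of every rank sit inside one
  module and spans need no bookkeeping of dimensions; matrices return only when the resolution is
  assembled.\<close>

definition scale :: "'r::comm_ring_1 \<Rightarrow> (nat \<Rightarrow> 'r) \<Rightarrow> nat \<Rightarrow> 'r" where
  "scale c f = (\<lambda>i. c * f i)"

lemma scale_apply [simp]: "scale c f i = c * f i"
  by (simp add: scale_def)

interpretation fmod: Modules.module "scale :: 'r::comm_ring_1 \<Rightarrow> (nat \<Rightarrow> 'r) \<Rightarrow> nat \<Rightarrow> 'r"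
  by unfold_locales
    (rule ext, simp only: scale_apply plus_fun_apply distrib_left distrib_right mult.assoc mult_1)+

lemma sum_fun_apply: "(\<Sum>x\<in>A. f x) i = (\<Sum>x\<in>A. f x i)"
  by (induction A rule: infinite_finite_induct) simp_all

definition comb :: "(nat \<Rightarrow> 'r::comm_ring_1) list \<Rightarrow> (nat \<Rightarrow> 'r) \<Rightarrow> nat \<Rightarrow> 'r" where
  "comb gs c = (\<Sum>l<length gs. scale (c l) (gs ! l))"

lemma comb_apply: "comb gs c i = (\<Sum>l<length gs. c l * (gs ! l) i)"
  by (simp add: comb_def sum_fun_apply)

lemma comb_add: "comb gs (c + c') = comb gs c + comb gs c'"
  by (rule ext) (simp only: comb_apply sum.distrib distrib_right plus_fun_apply)

lemma comb_scale: "comb gs (scale r c) = scale r (comb gs c)"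
  by (rule ext) (simp only: comb_apply scale_apply sum_distrib_left mult.assoc)

lemma comb_zero: "comb gs 0 = 0"
  by (rule ext) (simp add: comb_apply)

lemma comb_unit:
  assumes "j < length gs"
  shows "comb gs (\<lambda>l. if l = j then 1 else 0) = gs ! j"
  using assms by (auto simp: fun_eq_iff comb_apply if_distrib[of "\<lambda>x. x * _"] cong: if_cong)

lemma comb_append_single:
  "comb (gs @ [g]) c = comb gs c + scale (c (length gs)) g"
  by (auto simp: fun_eq_iff comb_apply nth_append intro!: sum.cong)

lemma comb_cong: "(\<And>l. l < length gs \<Longrightarrow> c l = c' l) \<Longrightarrow> comb gs c = comb gs c'"
  by (simp add: comb_def)

lemma span_eq_range_comb: "fmod.span (set gs) = range (comb gs)"
proof
  have sub: "fmod.subspace (range (comb gs))"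
  proof (rule fmod.subspaceI)
    show "0 \<in> range (comb gs)"
      by (rule range_eqI[of _ _ 0]) (simp only: comb_zero)
    fix x assume "x \<in> range (comb gs)"
    then obtain c where c: "x = comb gs c" by blast
    show "scale a x \<in> range (comb gs)" for a
      by (rule range_eqI[of _ _ "scale a c"]) (simp only: c comb_scale)
    fix y assume "y \<in> range (comb gs)"
    then obtain c' where c': "y = comb gs c'" by blast
    show "x + y \<in> range (comb gs)"
      by (rule range_eqI[of _ _ "c + c'"]) (simp only: c c' comb_add)
  qed
  show "fmod.span (set gs) \<subseteq> range (comb gs)"
  proof (rule fmod.span_minimal[OF _ sub])
    show "set gs \<subseteq> range (comb gs)"
    proof
      fix g assume "g \<in> set gs"
      then obtain j where "j < length gs" "g = gs ! j" by (auto simp: in_set_conv_nth)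
      then show "g \<in> range (comb gs)"
        by (intro range_eqI[of _ _ "\<lambda>l. if l = j then 1 else 0"]) (simp add: comb_unit)
    qed
  qed
  show "range (comb gs) \<subseteq> fmod.span (set gs)"
    unfolding comb_def
    by clarify (intro fmod.span_sum fmod.span_scale, rule fmod.span_base, simp)
qed

text \<open>\<open>comb\<close> ignores coefficients beyond the list, so they are forced to be 0;
  otherwise the relations would not form a submodule of the free module on
  \<open>gs\<close>.\<close>

definition syz :: "(nat \<Rightarrow> 'r::comm_ring_1) list \<Rightarrow> (nat \<Rightarrow> 'r) set" where
  "syz gs = {c. (\<forall>l \<ge> length gs. c l = 0) \<and> comb gs c = 0}"

lemma subspace_syz: "fmod.subspace (syz gs)"
  by (rule fmod.subspaceI)
    (simp_all add: syz_def comb_add comb_scale comb_zero fmod.scale_zero_right)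

definition hom_fun :: "'v expo list \<Rightarrow> 'v expo \<Rightarrow> (nat \<Rightarrow> ('v, 'k::field) mpoly) \<Rightarrow> bool" where
  "hom_fun ds a f \<longleftrightarrow> (\<forall>i < length ds. homog (ds ! i) a (f i)) \<and> (\<forall>i \<ge> length ds. f i = 0)"

definition graded :: "'v expo list \<Rightarrow> 'v expo list \<Rightarrow> (nat \<Rightarrow> ('v, 'k::field) mpoly) list \<Rightarrow> bool" where
  "graded ds bs gs \<longleftrightarrow> length gs = length bs \<and> (\<forall>j < length bs. hom_fun ds (bs ! j) (gs ! j))"

definition hcut :: "'v expo list \<Rightarrow> 'v expo \<Rightarrow> (nat \<Rightarrow> ('v, 'k::field) mpoly) \<Rightarrow> nat \<Rightarrow> ('v, 'k) mpoly"
  where "hcut bs a c = (\<lambda>l. if l < length bs then hpart (bs ! l) a (c l) else 0)"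

lemma hom_fun_hcut: "hom_fun bs a (hcut bs a c)"
  by (simp add: hom_fun_def hcut_def homog_hpart)

lemma hcut_hom_fun: "hom_fun bs a c \<Longrightarrow> hcut bs a c = c"
  by (auto simp: hom_fun_def hcut_def hpart_homog fun_eq_iff)

text \<open>Homogeneous generators define a map that preserves degrees. Consequently the components
  of a syzygy are again syzygies.\<close>

lemma comb_hcut:
  assumes "graded ds bs gs"
  shows "comb gs (hcut bs a c) = hcut ds a (comb gs c)"
proof
  fix i
  show "comb gs (hcut bs a c) i = hcut ds a (comb gs c) i"
  proof (cases "i < length ds")
    case True
    have "comb gs (hcut bs a c) i = (\<Sum>l<length gs. hpart (ds ! i) a (c l * (gs ! l) i))"
      unfolding comb_apply
    proof (intro sum.cong refl)
      fix l assume "l \<in> {..<length gs}"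
      then have l: "l < length bs" using assms by (simp add: graded_def)
      then have "homog (ds ! i) (bs ! l) ((gs ! l) i)"
        using assms True by (simp add: graded_def hom_fun_def)
      from hpart_mult_homog[OF this] l
      show "hcut bs a c l * (gs ! l) i = hpart (ds ! i) a (c l * (gs ! l) i)"
        by (simp add: hcut_def)
    qed
    then show ?thesis using True by (simp add: hcut_def comb_apply hpart_sum)
  next
    case False
    then show ?thesis
      using assms by (simp add: comb_apply hcut_def graded_def hom_fun_def)
  qed
qed

lemma hcut_zero [simp]: "hcut ds a 0 = 0"
  by (simp add: hcut_def fun_eq_iff)

lemma hcut_mem_syz:
  assumes "graded ds bs gs" "c \<in> syz gs"
  shows "hcut bs a c \<in> syz gs"
  using assms comb_hcut[OF assms(1), of a c] by (auto simp: syz_def hcut_def graded_def)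

definition mat_of :: "nat \<Rightarrow> (nat \<Rightarrow> 'r) list \<Rightarrow> 'r mat" where
  "mat_of n gs = mat n (length gs) (\<lambda>(i, j). (gs ! j) i)"

lemma mat_of_mult_vec:
  fixes gs :: "(nat \<Rightarrow> 'r::comm_ring_1) list"
  shows "mat_of n gs *\<^sub>v vec (length gs) c = vec n (comb gs c)"
  by (intro eq_vecI)
    (auto simp: mat_of_def scalar_prod_def comb_apply lessThan_atLeast0 mult.commute intro!: sum.cong)

lemma mat_of_carrier [simp]: "mat_of n gs \<in> carrier_mat n (length gs)"
  by (simp add: mat_of_def)

lemma carrier_vec_eq: "v \<in> carrier_vec n \<longleftrightarrow> v = vec n (\<lambda>i. v $ i)"
  by (metis carrier_vec_dim_vec dim_vec eq_vecI index_vec carrier_vecD vec_carrier)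

lemma mat_image_mat_of:
  fixes gs :: "(nat \<Rightarrow> 'r::comm_ring_1) list"
  shows "mat_image (mat_of n gs) = vec n ` fmod.span (set gs)"
proof -
  have "mat_image (mat_of n gs) = {mat_of n gs *\<^sub>v v | v. v \<in> carrier_vec (length gs)}"
    by (simp add: mat_image_def mat_of_def)
  also have "\<dots> = range (\<lambda>c. mat_of n gs *\<^sub>v vec (length gs) c)"
    by (auto intro: rangeI) (metis carrier_vec_eq rangeI)
  finally show ?thesis
    by (auto simp: mat_of_mult_vec span_eq_range_comb)
qed

lemma mat_kernel_mat_of:
  fixes gs :: "(nat \<Rightarrow> 'r::comm_ring_1) list"
  assumes "\<And>g i. g \<in> set gs \<Longrightarrow> i \<ge> n \<Longrightarrow> g i = 0"
  shows "mat_kernel (mat_of n gs) = vec (length gs) ` syz gs"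
proof
  have *: "vec n (comb gs c) = 0\<^sub>v n \<longleftrightarrow> comb gs c = 0" for c
  proof
    assume "vec n (comb gs c) = 0\<^sub>v n"
    then have "comb gs c i = 0" if "i < n" for i
      using that by (metis index_vec index_zero_vec(1))
    moreover have "comb gs c i = 0" if "i \<ge> n" for i
      using that assms[OF nth_mem] by (simp add: comb_apply)
    ultimately show "comb gs c = 0" by (metis fun_eq_iff linorder_not_le zero_fun_apply)
  qed (auto intro!: eq_vecI)
  show "vec (length gs) ` syz gs \<subseteq> mat_kernel (mat_of n gs)"
    by (auto simp: mat_kernel[OF mat_of_carrier] mat_of_mult_vec * syz_def)
  show "mat_kernel (mat_of n gs) \<subseteq> vec (length gs) ` syz gs"
  proof
    fix v assume "v \<in> mat_kernel (mat_of n gs)"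
    then have v: "v \<in> carrier_vec (length gs)" "mat_of n gs *\<^sub>v v = 0\<^sub>v n"
      by (auto simp: mat_kernel[OF mat_of_carrier])
    define c where "c l = (if l < length gs then v $ l else 0)" for l
    have vc: "v = vec (length gs) c" using v(1) by (intro eq_vecI) (auto simp: c_def)
    then have "c \<in> syz gs" using v(2) by (auto simp: mat_of_mult_vec * syz_def c_def)
    then show "v \<in> vec (length gs) ` syz gs" using vc by blast
  qed
qed

theorem multigraded_free_resolution_of_lists:
  assumes gr: "\<And>k. graded (target_degs degs k) (degs k) (G k)"
    and J: "(\<lambda>f. f 0) ` fmod.span (set (G 0)) = J"
    and exact: "\<And>k. fmod.span (set (G (Suc k))) = syz (G k)"
  shows "multigraded_free_resolution J degs (\<lambda>k. mat_of (length (target_degs degs k)) (G k))"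
  unfolding multigraded_free_resolution_iff
proof (intro conjI allI)
  fix k
  show "hom_mat (target_degs degs k) (degs k) (mat_of (length (target_degs degs k)) (G k))"
    using gr[of k] by (auto simp: hom_mat_def mat_of_def graded_def hom_fun_def)
  have len: "length (G k) = length (degs k)" using gr[of k] by (simp add: graded_def)
  have "mat_kernel (mat_of (length (target_degs degs k)) (G k)) = vec (length (G k)) ` syz (G k)"
    by (rule mat_kernel_mat_of)
      (use gr[of k] in \<open>auto simp: in_set_conv_nth graded_def hom_fun_def\<close>)
  then show "mat_kernel (mat_of (length (target_degs degs k)) (G k)) =
    mat_image (mat_of (length (target_degs degs (Suc k))) (G (Suc k)))"
    by (simp add: mat_image_mat_of exact len target_degs_def)
next
  show "(\<lambda>v. v $ 0) ` mat_image (mat_of (length (target_degs degs 0)) (G 0)) = J"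
    unfolding mat_image_mat_of image_image J[symmetric] by (simp add: target_degs_def)
qed

text \<open>The ring as a free module of rank one, placed in coordinate 0; it is the target of the
  augmentation.\<close>

definition emb :: "'r::zero \<Rightarrow> nat \<Rightarrow> 'r" where
  "emb p = (\<lambda>i. if i = 0 then p else 0)"

lemma span_emb:
  fixes S :: "'r::comm_ring_1 set"
  shows "fmod.span (emb ` S) = emb ` ideal_of S"
proof
  have "fmod.subspace (emb ` ideal_of S)"
  proof (rule fmod.subspaceI)
    show "0 \<in> emb ` ideal_of S"
      by (rule image_eqI[of _ _ 0]) (auto simp: emb_def fun_eq_iff ideal_of_zero)
    show "x + y \<in> emb ` ideal_of S" if "x \<in> emb ` ideal_of S" "y \<in> emb ` ideal_of S" for x y
    proof -
      obtain p q where "p \<in> ideal_of S" "q \<in> ideal_of S" "x = emb p" "y = emb q"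
        using \<open>x \<in> _\<close> \<open>y \<in> _\<close> by blast
      then show ?thesis
        by (intro image_eqI[of _ _ "p + q"]) (auto simp: emb_def fun_eq_iff ideal_of_add)
    qed
    show "scale c x \<in> emb ` ideal_of S" if x: "x \<in> emb ` ideal_of S" for c x
    proof -
      obtain p where "p \<in> ideal_of S" "x = emb p" using x by blast
      then show ?thesis
        by (intro image_eqI[of _ _ "c * p"]) (auto simp: emb_def fun_eq_iff ideal_of_mult)
    qed
  qed
  then show "fmod.span (emb ` S) \<subseteq> emb ` ideal_of S"
    by (intro fmod.span_minimal) (auto intro: ideal_of_base)
  have "ideal_of S \<subseteq> {p. emb p \<in> fmod.span (emb ` S)}"
    unfolding ideal_of_def
  proof (rule ring_module.span_minimal)
    have "emb (0::'r) = 0" "emb (x + y) = emb x + emb y" "emb (c * x) = scale c (emb x)" for c x y :: 'r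
      by (auto simp: emb_def fun_eq_iff)
    then show "ring_module.subspace {p. emb p \<in> fmod.span (emb ` S)}"
      by (intro ring_module.subspaceI) (simp_all add: fmod.span_zero fmod.span_add fmod.span_scale)
  qed (auto intro: fmod.span_base)
  then show "emb ` ideal_of S \<subseteq> fmod.span (emb ` S)" by blast
qed

lemma emb_inject: "emb p = emb q \<longleftrightarrow> p = q"
  by (auto simp: emb_def fun_eq_iff)

lemma hom_fun_emb_xpow: "hom_fun [0] a (emb (xpow a))"
  by (auto simp: hom_fun_def emb_def homog_xpow)

lemma emb_apply_zero [simp]: "emb p 0 = p"
  by (simp add: emb_def)

section \<open>Minimal resolutions of monomial ideals\<close>

lemma hom_fun_minus:
  assumes "hom_fun ds a f" "hom_fun ds a g"
  shows "hom_fun ds a (f - g)"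
proof -
  have "homog b a (p - q)" if "homog b a p" "homog b a q" for b and p q :: "('a, 'b) mpoly"
    using that unfolding homog_def by (auto simp: in_keys_iff lookup_minus)
  then show ?thesis using assms by (simp add: hom_fun_def)
qed

lemma homog_mult:
  fixes p q :: "('v, 'k::field) mpoly"
  assumes "homog b c p" "homog c a q"
  shows "homog b a (q * p)"
  using hpart_mult_homog[OF assms(1), of a q] by (metis hpart_homog[OF assms(2)] homog_hpart)

lemma hom_fun_scale:
  assumes "hom_fun ds a f" "homog a b c"
  shows "hom_fun ds b (scale c f)"
  unfolding hom_fun_def
proof (intro conjI allI impI)
  show "homog (ds ! i) b (scale c f i)" if "i < length ds" for i
    unfolding scale_apply by (rule homog_mult) (use assms that in \<open>auto simp: hom_fun_def\<close>)
  show "scale c f i = 0" if "i \<ge> length ds" for i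
    using assms that by (simp add: hom_fun_def)
qed

lemma mult_xpow_eq_zero_iff:
  fixes p :: "('v, 'k::field) mpoly"
  shows "p * xpow t = 0 \<longleftrightarrow> p = 0"
  using keys_mult_xpow[of p t] by (metis image_is_empty keys_eq_empty)

text \<open>In degree \<open>a\<close> only the basis elements whose degree divides \<open>a\<close> matter, so above the least common
  multiple of their degrees no new syzygies arise. In a fixed degree the syzygies form a vector
  space, generated by one element for each possible last nonzero coordinate.\<close>

lemma syz_finitely_generated:
  fixes gs :: "(nat \<Rightarrow> ('v::finite, 'k::field) mpoly) list"
  assumes gr: "graded ds bs gs"
  obtains W where "finite W" "\<forall>w\<in>W. \<exists>a. hom_fun bs a w" "fmod.span W = syz gs"
proof -
  \<comment> \<open>Any common multiple of the degrees serves the purpose; the sum is the simplest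
    one.\<close>
  define L where "L = sum_list bs"
  have len: "length gs = length bs" using gr by (simp add: graded_def)
  have L: "bs ! l adds L" if "l < length bs" for l
  proof -
    have "b adds sum_list cs" if "b \<in> set cs" for b and cs :: "'v expo list"
      using that by (induction cs) (auto simp: add.commute intro: adds_trans)
    then show ?thesis using that by (simp add: L_def)
  qed
  \<comment> \<open>\<open>C a i\<close> collects the syzygies of degree \<open>a\<close> whose last
    nonzero coordinate is \<open>i\<close>. Choosing one element from each nonempty class gives the
    pivots of an echelon basis, for the finitely many \<open>a\<close> dividing
    \<open>L\<close>.\<close>
  define C where "C a i = {c \<in> syz gs. hom_fun bs a c \<and> c i \<noteq> 0 \<and> (\<forall>l>i. c l = 0)}" for a i
  define W where "W = {SOME c. c \<in> C a i | a i. a adds L \<and> i < length bs \<and> C a i \<noteq> {}}"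
  have "W \<subseteq> (\<lambda>(a, i). SOME c. c \<in> C a i) ` ({a. a adds L} \<times> {..<length bs})"
    by (auto simp: W_def)
  then have fin: "finite W"
    by (rule finite_subset) (intro finite_imageI finite_cartesian_product finite_adds finite_lessThan)
  have W: "\<exists>a i. w \<in> C a i" if "w \<in> W" for w
  proof -
    obtain a i where "w = (SOME c. c \<in> C a i)" "C a i \<noteq> {}"
      using \<open>w \<in> W\<close> by (auto simp: W_def)
    then have "w \<in> C a i" by (simp add: some_in_eq)
    then show ?thesis by blast
  qed
  have low: "c \<in> fmod.span W" if "c \<in> syz gs" "hom_fun bs a c" "a adds L" "\<forall>l\<ge>n. c l = 0" "n \<le> length bs"
    for a c n
    using that
  proof (induction n arbitrary: c)
    case 0
    then have "c = 0" by (intro ext) simp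
    then show ?case by (simp only: fmod.span_zero)
  next
    case (Suc n)
    show ?case
    proof (cases "c n = 0")
      case True
      then have "\<forall>l\<ge>n. c l = 0" using Suc.prems(4) by (metis Suc_leI le_neq_implies_less)
      then show ?thesis using Suc by auto
    next
      case False
      define w where "w = (SOME c. c \<in> C a n)"
      have "c \<in> C a n" using Suc.prems False by (auto simp: C_def)
      then have ne: "C a n \<noteq> {}" by blast
      then have w: "w \<in> C a n" by (simp add: w_def some_in_eq)
      have wW: "w \<in> W"
        unfolding W_def w_def using ne Suc.prems by (intro CollectI exI[of _ a] exI[of _ n]) auto
      have "w n \<noteq> 0" "homog (bs ! n) a (w n)" "homog (bs ! n) a (c n)"
        using w Suc.prems by (auto simp: C_def hom_fun_def)
      then obtain x y where xy: "w n = Poly_Mapping.single (a - bs ! n) x"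
        "c n = Poly_Mapping.single (a - bs ! n) y" "x \<noteq> 0"
        using homog_eq_single[of "bs ! n" a "w n"] homog_eq_single[of "bs ! n" a "c n"] False
        by (metis single_zero)
      \<comment> \<open>Both pivot entries are scalar multiples of the same monomial, so a scalar,
        of degree 0, clears coordinate \<open>n\<close>.\<close>
      define r where "r = Poly_Mapping.single (0::'v expo) (y / x)"
      have "c - scale r w \<in> fmod.span W"
      proof (rule Suc.IH)
        show "c - scale r w \<in> syz gs"
          using Suc.prems(1) w subspace_syz[of gs]
          by (auto simp: C_def intro!: fmod.subspace_diff fmod.subspace_scale)
        show "hom_fun bs a (c - scale r w)"
          using Suc.prems(2) w
          by (intro hom_fun_minus hom_fun_scale[of bs a w]) (auto simp: C_def r_def homog_single)
        show "\<forall>l\<ge>n. (c - scale r w) l = 0"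
        proof (intro allI impI)
          fix l assume "n \<le> l"
          then consider "l = n" | "l > n" by linarith
          then show "(c - scale r w) l = 0"
          proof cases
            case 1
            then show ?thesis using xy by (simp add: r_def mult_single)
          next
            case 2
            then show ?thesis using Suc.prems(4) w by (simp add: C_def)
          qed
        qed
      qed (use Suc.prems in auto)
      then have "c - scale r w + scale r w \<in> fmod.span W"
        using fmod.span_scale[OF fmod.span_base[OF wW]] by (rule fmod.span_add)
      then show ?thesis by (simp only: diff_add_cancel)
    qed
  qed
  have hom: "c \<in> fmod.span W" if c: "c \<in> syz gs" "hom_fun bs a c" for a c
  proof -
    \<comment> \<open>Subtraction is truncated, so \<open>a'\<close> is the greatest common divisor
      of \<open>a\<close> and \<open>L\<close>. Every basis degree dividing \<open>a\<close> divides
      \<open>a'\<close> as well, hence the whole syzygy is divisible by the monomial of exponent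
      \<open>t\<close>.\<close>
    define t where "t = a - L"
    define a' where "a' = a - t"
    have look: "lookup a' v = min (lookup a v) (lookup L v)" for v
      by (simp add: a'_def t_def lookup_minus)
    have a: "a = a' + t"
      by (rule poly_mapping_eqI) (simp add: lookup_add a'_def t_def lookup_minus)
    define c' where "c' l = Poly_Mapping.single (a' - bs ! l) (lookup (c l) (a - bs ! l))" for l
    have deg: "bs ! l adds a'" and cc': "c l = c' l * xpow t" if "c l \<noteq> 0" for l
    proof -
      have l: "l < length bs" using that c(2) by (cases "l < length bs") (auto simp: hom_fun_def)
      then have *: "bs ! l adds a" "c l = Poly_Mapping.single (a - bs ! l) (lookup (c l) (a - bs ! l))"
        using homog_eq_single[of "bs ! l" a "c l"] c(2) that by (auto simp: hom_fun_def)
      show d: "bs ! l adds a'" using *(1) L[OF l] by (simp add: adds_def look)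
      have "a - bs ! l = (a' - bs ! l) + t"
        using d by (intro poly_mapping_eqI, subst a) (simp add: adds_def lookup_add lookup_minus)
      then show "c l = c' l * xpow t"
        using *(2) by (simp add: c'_def xpow_def mult_single)
    qed
    have c'0: "c' l = 0" if "c l = 0" for l using that by (simp add: c'_def)
    have cs: "c = scale (xpow t) c'"
    proof
      show "c l = scale (xpow t) c' l" for l
        using cc'[of l] c'0[of l] by (cases "c l = 0") (simp_all add: mult.commute)
    qed
    have "c' \<in> syz gs"
    proof -
      have "comb gs c' i = 0" for i
      proof -
        have "scale (xpow t) (comb gs c') i = 0"
          using c(1) by (simp only: cs comb_scale syz_def mem_Collect_eq) simp
        then show ?thesis using mult_xpow_eq_zero_iff[of "comb gs c' i" t] by (simp add: mult.commute)
      qed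
      then show ?thesis using c(1) c'0 by (auto simp: syz_def fun_eq_iff)
    qed
    moreover have "hom_fun bs a' c'"
      unfolding hom_fun_def
    proof (intro conjI allI impI)
      show "homog (bs ! i) a' (c' i)" if "i < length bs" for i
        using deg[of i] c'0[of i] adds_minus_add[of "bs ! i" a']
        by (cases "c i = 0") (auto simp: c'_def intro!: homog_single)
      show "c' i = 0" if "i \<ge> length bs" for i
        using that c(2) c'0 by (simp add: hom_fun_def)
    qed
    moreover have "a' adds L" by (simp add: adds_def look)
    ultimately have "c' \<in> fmod.span W"
      using low[of c' a' "length bs"] by (simp add: hom_fun_def)
    then show ?thesis by (subst cs) (rule fmod.span_scale)
  qed
  have "c \<in> fmod.span W" if c: "c \<in> syz gs" for c
  proof -
    define F where "F = (\<Union>l<length bs. (\<lambda>m. m + bs ! l) ` keys (c l))"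
    have "c l = (\<Sum>a\<in>F. hcut bs a c) l" for l
    proof (cases "l < length bs")
      case True
      have "c l = (\<Sum>a\<in>F. hpart (bs ! l) a (c l))"
        by (rule hpart_decomp) (use True in \<open>auto simp: F_def\<close>)
      then show ?thesis using True by (simp add: sum_fun_apply hcut_def)
    next
      case False
      then show ?thesis using c by (simp add: sum_fun_apply hcut_def syz_def len)
    qed
    then have "c = (\<Sum>a\<in>F. hcut bs a c)" by (rule ext)
    also have "\<dots> \<in> fmod.span W"
      by (intro fmod.span_sum hom[OF hcut_mem_syz[OF gr c] hom_fun_hcut])
    finally show ?thesis .
  qed
  moreover have "fmod.span W \<subseteq> syz gs"
    using W by (intro fmod.span_minimal subspace_syz) (auto simp: C_def)
  ultimately show ?thesis
    using that[of W] fin W by (auto simp: C_def)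
qed

text \<open>The columns of the next differential are such relations, so its entries lie in the
  irrelevant ideal.\<close>

definition minimal_syz :: "(nat \<Rightarrow> ('v, 'k::field) mpoly) list \<Rightarrow> bool" where
  "minimal_syz gs \<longleftrightarrow> (\<forall>c\<in>syz gs. \<forall>l. lookup (c l) 0 = 0)"

lemma minimal_generators:
  fixes W :: "(nat \<Rightarrow> ('v, 'k::field) mpoly) set"
  assumes fin: "finite W" and hom: "\<forall>w\<in>W. \<exists>a. hom_fun ds a w"
  obtains bs gs where "graded ds bs gs" "fmod.span (set gs) = fmod.span W" "minimal_syz gs"
proof -
  obtain V where V: "V \<subseteq> W" "fmod.span V = fmod.span W"
    and least: "\<And>U. U \<subseteq> W \<Longrightarrow> fmod.span U = fmod.span W \<Longrightarrow> card V \<le> card U"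
    using ex_has_least_nat[of "\<lambda>U. U \<subseteq> W \<and> fmod.span U = fmod.span W" W card] by auto
  have finV: "finite V" using V(1) fin by (rule finite_subset)
  then obtain gs where gs: "set gs = V" "distinct gs"
    using finite_distinct_list by blast
  define bs where "bs = map (\<lambda>w. SOME a. hom_fun ds a w) gs"
  have gr: "graded ds bs gs"
    unfolding graded_def
  proof (intro conjI allI impI)
    fix j assume "j < length bs"
    then have "gs ! j \<in> W" "bs ! j = (SOME a. hom_fun ds a (gs ! j))"
      using gs V(1) by (auto simp: bs_def)
    then show "hom_fun ds (bs ! j) (gs ! j)" using hom by (metis someI)
  qed (simp add: bs_def)
  have len: "length gs = length bs" by (simp add: bs_def)
  have "lookup (c i) 0 = 0" if c: "c \<in> syz gs" for c i
  proof (rule ccontr)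
    assume nz: "lookup (c i) 0 \<noteq> 0"
    then have i: "i < length gs" using c by (cases "i < length gs") (auto simp: syz_def)
    \<comment> \<open>In degree \<open>bs ! i\<close> the coefficient of the generator
      \<open>i\<close> is reduced to its constant term, which is invertible.\<close>
    define e where "e = hcut bs (bs ! i) c"
    have e: "e \<in> syz gs" unfolding e_def by (rule hcut_mem_syz[OF gr c])
    define x where "x = lookup (c i) 0"
    have ei: "e i = Poly_Mapping.single 0 x"
      using i len by (auto simp: e_def hcut_def lookup_hpart lookup_single x_def when_def
          intro!: poly_mapping_eqI)
    have "comb gs e = scale (e i) (gs ! i) + (\<Sum>l\<in>{..<length gs} - {i}. scale (e l) (gs ! l))"
      unfolding comb_def using i by (subst sum.remove[of _ i]) auto
    then have "scale (e i) (gs ! i) = - (\<Sum>l\<in>{..<length gs} - {i}. scale (e l) (gs ! l))"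
      using e by (simp add: syz_def eq_neg_iff_add_eq_0)
    moreover have V': "gs ! l \<in> V - {gs ! i}" if "l \<in> {..<length gs} - {i}" for l
      using that gs i by (auto simp: nth_eq_iff_index_eq)
    ultimately have "scale (e i) (gs ! i) \<in> fmod.span (V - {gs ! i})"
      by (metis (no_types, lifting) fmod.span_neg fmod.span_sum fmod.span_scale fmod.span_base)
    then have "scale (Poly_Mapping.single 0 (1 / x)) (scale (e i) (gs ! i)) \<in> fmod.span (V - {gs ! i})"
      by (rule fmod.span_scale)
    moreover have "Poly_Mapping.single 0 (1 / x) * Poly_Mapping.single 0 x = (1 :: ('v, 'k) mpoly)"
      using nz by (simp add: mult_single x_def flip: single_one)
    ultimately have "gs ! i \<in> fmod.span (V - {gs ! i})"
      by (simp add: ei fmod.scale_scale fmod.scale_one)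
    then have "v \<in> fmod.span (V - {gs ! i})" if "v \<in> V" for v
      using that fmod.span_base[of v "V - {gs ! i}"] by (cases "v = gs ! i") auto
    then have "V \<subseteq> fmod.span (V - {gs ! i})" by (rule subsetI)
    then have "fmod.span (V - {gs ! i}) = fmod.span V"
      by (metis Diff_subset fmod.span_minimal fmod.span_mono fmod.subspace_span subset_antisym)
    then have "card V \<le> card (V - {gs ! i})"
      using V by (intro least) auto
    moreover have mem: "gs ! i \<in> V" using i gs by auto
    ultimately show False using card_Diff1_less[OF finV mem] by linarith
  qed
  then show ?thesis using that[of bs gs] gr gs V by (simp add: minimal_syz_def)
qed

lemma minimal_resolution_of_lists:
  assumes gr: "\<And>k. graded (target_degs degs k) (degs k) (G k)"
    and J: "(\<lambda>f. f 0) ` fmod.span (set (G 0)) = J"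
    and exact: "\<And>k. fmod.span (set (G (Suc k))) = syz (G k)"
    and min: "\<And>k. minimal_syz (G k)"
  shows "minimal_multigraded_free_resolution J degs (\<lambda>k. mat_of (length (target_degs degs k)) (G k))"
  unfolding minimal_multigraded_free_resolution_def
proof (intro conjI allI impI)
  show "multigraded_free_resolution J degs (\<lambda>k. mat_of (length (target_degs degs k)) (G k))"
    using gr J exact by (rule multigraded_free_resolution_of_lists)
  fix k i j assume ij: "i < length (degs k)" "j < length (degs (Suc k))"
  then have j: "j < length (G (Suc k))" using gr[of "Suc k"] by (simp add: graded_def)
  then have "G (Suc k) ! j \<in> syz (G k)"
    using exact[of k] by (metis fmod.span_base nth_mem)
  then show "mat_of (length (target_degs degs (Suc k))) (G (Suc k)) $$ (i, j) \<in> ideal_of (range var)"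
    using ij j min[of k] by (simp add: mat_of_def target_degs_def mem_ideal_of_vars_iff minimal_syz_def)
qed

text \<open>Minimal generators of the syzygies are taken again and again, starting from the
  monomials; finite generation keeps each step possible. Existence gives meaning to the choice made
  in \<open>multigraded_betti\<close>.\<close>

theorem monomial_ideal_minimal_resolution:
  fixes A :: "'v::finite expo set"
  assumes "finite A"
  obtains degs d where
    "minimal_multigraded_free_resolution (ideal_of (xpow ` A) :: ('v, 'k::field) mpoly set) degs d"
proof -
  define J :: "('v, 'k) mpoly set" where "J = ideal_of (xpow ` A)"
  obtain bs0 gs0 where base: "graded [0] bs0 gs0" "minimal_syz gs0"
    "fmod.span (set gs0) = fmod.span (emb ` (xpow ` A :: ('v, 'k) mpoly set))"
  proof (rule minimal_generators)
    show "finite (emb ` (xpow ` A :: ('v, 'k) mpoly set))" using assms by simp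
    show "\<forall>w\<in>emb ` (xpow ` A :: ('v, 'k) mpoly set). \<exists>a. hom_fun [0] a w"
      using hom_fun_emb_xpow by blast
  qed blast
  have J: "(\<lambda>f. f 0) ` fmod.span (set gs0) = J"
    unfolding base(3) span_emb J_def[symmetric] by (simp add: image_image)
  let ?P = "\<lambda>(k::nat) x. (\<exists>ds. graded ds (fst x) (snd x)) \<and> minimal_syz (snd x) \<and>
    (k = 0 \<longrightarrow> x = (bs0, gs0))"
  let ?R = "\<lambda>x y. graded (fst x) (fst y) (snd y) \<and> fmod.span (set (snd y)) = syz (snd x)"
  have "\<exists>X. \<forall>k. ?P k (X k) \<and> ?R (X k) (X (Suc k))"
  proof (rule dependent_nat_choice)
    show "\<exists>x. ?P 0 x" using base by auto
  next
    fix x :: "'v expo list \<times> (nat \<Rightarrow> ('v, 'k) mpoly) list" and k :: nat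
    assume "?P k x"
    then obtain ds where "graded ds (fst x) (snd x)" by blast
    then obtain W where W: "finite W" "\<forall>w\<in>W. \<exists>a. hom_fun (fst x) a w" "fmod.span W = syz (snd x)"
      by (rule syz_finitely_generated)
    obtain bs gs where "graded (fst x) bs gs" "fmod.span (set gs) = fmod.span W" "minimal_syz gs"
      using W(1,2) by (rule minimal_generators)
    then show "\<exists>y. ?P (Suc k) y \<and> ?R x y"
      using W(3) by (intro exI[of _ "(bs, gs)"]) auto
  qed
  then obtain X where X: "\<forall>k. ?P k (X k) \<and> ?R (X k) (X (Suc k))" by blast
  have X0: "X 0 = (bs0, gs0)" using X by blast
  have "graded (target_degs (\<lambda>k. fst (X k)) k) (fst (X k)) (snd (X k))" for k
    using X base by (cases k) (simp_all add: target_degs_def X0)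
  moreover have "(\<lambda>f. f 0) ` fmod.span (set (snd (X 0))) = J"
    by (simp add: X0 J)
  ultimately have "minimal_multigraded_free_resolution J (\<lambda>k. fst (X k))
      (\<lambda>k. mat_of (length (target_degs (\<lambda>k. fst (X k)) k)) (snd (X k)))"
    by (rule minimal_resolution_of_lists) (use X in auto)
  then show ?thesis using that unfolding J_def by blast
qed

section \<open>Resolutions of ideals with linear quotients\<close>

abbreviation gens :: "('a \<times> 'b \<times> 'c) list \<Rightarrow> 'c list" where
  "gens X \<equiv> map (\<lambda>(b, S, g). g) X"

abbreviation labels :: "('a \<times> 'b \<times> 'c) list \<Rightarrow> ('a \<times> 'b) list" where
  "labels X \<equiv> map (\<lambda>(b, S, g). (b, S)) X"

text \<open>A triple \<open>(b, S, g)\<close> consists of a generator \<open>g\<close>, its degree \<open>b\<close> and the variables \<open>S\<close> of its colon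
  ideal.\<close>

inductive module_linear_quotients ::
  "('v expo \<times> 'v list \<times> (nat \<Rightarrow> ('v, 'k::field) mpoly)) list \<Rightarrow> bool" where
  Nil: "module_linear_quotients []"
| snoc: "module_linear_quotients X \<Longrightarrow> distinct S \<Longrightarrow>
    (\<forall>f. scale f g \<in> fmod.span (set (gens X)) \<longleftrightarrow> f \<in> ideal_of (var ` set S)) \<Longrightarrow>
    module_linear_quotients (X @ [(b, S, g)])"

definition syz_labels :: "'v expo \<times> 'v list \<Rightarrow> ('v expo \<times> 'v list) list" where
  "syz_labels = (\<lambda>(b, S). map (\<lambda>q. (b + expo_var (S ! q), take q S)) [0..<length S])"

lemma hom_fun_append: "hom_fun ds a f \<Longrightarrow> hom_fun (ds @ es) a f"
  by (auto simp: hom_fun_def nth_append)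

lemma graded_append_single:
  "graded ds (bs @ [b]) (gs @ [g]) \<longleftrightarrow> graded ds bs gs \<and> hom_fun ds b g"
  by (auto simp: graded_def nth_append All_less_Suc)

lemma mem_syz_append_single_iff:
  "c \<in> syz (gs @ [g]) \<longleftrightarrow>
     (\<forall>l > length gs. c l = 0) \<and> comb gs c + scale (c (length gs)) g = 0"
  unfolding syz_def mem_Collect_eq comb_append_single by (simp add: Suc_le_eq)

lemma syz_subset_syz_append_single:
  "syz gs = {c \<in> syz (gs @ [g]). c (length gs) = 0}"
proof (rule Set.set_eqI)
  fix c
  have "scale 0 g = 0" by (rule fmod.scale_zero_left)
  then show "c \<in> syz gs \<longleftrightarrow> c \<in> {c \<in> syz (gs @ [g]). c (length gs) = 0}"
    unfolding mem_Collect_eq mem_syz_append_single_iff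
    by (auto simp: syz_def le_less)
qed

text \<open>For every variable \<open>v\<close> of the colon ideal of a generator \<open>g\<close> a relation expresses \<open>v g\<close>
  by the earlier generators; these relations generate, and the colon ideal of such a relation is
  generated by the variables of the colon ideal of \<open>g\<close> preceding \<open>v\<close>.\<close>

theorem module_linear_quotients_syz:
  fixes X :: "('v expo \<times> 'v list \<times> (nat \<Rightarrow> ('v, 'k::field) mpoly)) list"
  assumes "module_linear_quotients X" "graded ds (map fst X) (gens X)"
  shows "\<exists>Y :: ('v expo \<times> 'v list \<times> (nat \<Rightarrow> ('v, 'k) mpoly)) list.
    module_linear_quotients Y \<and> graded (map fst X) (map fst Y) (gens Y) \<and>
    fmod.span (set (gens Y)) = syz (gens X) \<and>
    labels Y = concat (map syz_labels (labels X))"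
  using assms
proof (induction X rule: module_linear_quotients.induct)
  case Nil
  have "syz ([] :: (nat \<Rightarrow> ('v, 'k) mpoly) list) = {0}"
    by (auto simp: syz_def comb_def fun_eq_iff)
  then have "fmod.span {} = syz ([] :: (nat \<Rightarrow> ('v, 'k) mpoly) list)"
    by (simp only: fmod.span_empty)
  let ?Y = "[] :: ('v expo \<times> 'v list \<times> (nat \<Rightarrow> ('v, 'k) mpoly)) list"
  show ?case
  proof (intro exI[of _ ?Y] conjI)
    show "module_linear_quotients ?Y" by (rule module_linear_quotients.Nil)
    show "fmod.span (set (gens ?Y)) = syz (gens ?Y)"
      using \<open>fmod.span {} = _\<close> by (simp only: list.map list.set)
  qed (simp_all add: graded_def)
next
  case (snoc X S g b)
  define p where "p = length X"
  define G where "G = gens X"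
  have lenG: "length G = p" by (simp add: G_def p_def)
  have gen: "gens (X @ [(b, S, g)]) = G @ [g]" by (simp add: G_def)
  have grX: "graded ds (map fst X) G"
    and hg: "hom_fun ds b g"
    using snoc.prems graded_append_single[of ds "map fst X" b G g] by (simp_all add: G_def)
  obtain Y where Y: "module_linear_quotients Y" "graded (map fst X) (map fst Y) (gens Y)"
    "fmod.span (set (gens Y)) = syz G" "labels Y = concat (map syz_labels (labels X))"
    using snoc.IH grX unfolding G_def by blast
  have colon: "scale f g \<in> fmod.span (set G) \<longleftrightarrow> f \<in> ideal_of (var ` set S)" for f
    using snoc.hyps unfolding G_def by blast
  have "\<exists>h. h \<in> syz (G @ [g]) \<and> h p = var v \<and> hom_fun (map fst X @ [b]) (b + expo_var v) h"
    if v: "v \<in> set S" for v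
  proof -
    \<comment> \<open>The earlier generators express \<open>- v g\<close>, so the coefficient
      \<open>v\<close> in the last position \<open>p\<close> completes their coefficients to a
      relation.\<close>
    have "- var v \<in> ideal_of (var ` set S)"
      using ideal_of_mult[OF ideal_of_base[of "var v" "var ` set S"], of "-1"] v by auto
    then have "scale (- var v) g \<in> range (comb G)"
      by (simp only: colon span_eq_range_comb[symmetric])
    then obtain c where c: "comb G c = scale (- var v) g" by (metis rangeE)
    define c' where "c' = hcut (map fst X) (b + expo_var v) c"
    have "homog b (b + expo_var v) (- var v :: ('v, 'k) mpoly)"
      by (simp add: homog_def var_eq_xpow xpow_def add.commute flip: single_uminus)
    then have "hom_fun ds (b + expo_var v) (scale (- var v) g)"
      using hg by (rule hom_fun_scale[rotated])
    then have c': "comb G c' = scale (- var v) g"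
      unfolding c'_def comb_hcut[OF grX] c by (rule hcut_hom_fun)
    define h where "h l = (if l = p then var v else c' l)" for l
    have "comb G h = comb G c'" by (rule comb_cong) (simp add: h_def lenG)
    then have "comb G h + scale (h p) g = 0"
      unfolding c' by (auto simp: h_def fun_eq_iff)
    moreover have zero: "h l = 0" if "l > p" for l
      using that by (simp add: h_def c'_def hcut_def p_def)
    ultimately have "h \<in> syz (G @ [g])" by (simp add: mem_syz_append_single_iff lenG)
    moreover have hom: "homog (if i < p then fst (X ! i) else b) (b + expo_var v) (h i)" if "i < Suc p" for i
    proof (cases "i = p")
      case True
      then show ?thesis by (simp add: h_def var_eq_xpow homog_xpow add.commute)
    next
      case False
      then show ?thesis using that by (simp add: h_def c'_def hcut_def p_def homog_hpart)
    qed
    have "hom_fun (map fst X @ [b]) (b + expo_var v) h"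
      unfolding hom_fun_def
    proof (intro conjI allI impI)
      show "homog ((map fst X @ [b]) ! i) (b + expo_var v) (h i)" if "i < length (map fst X @ [b])" for i
        using hom[of i] that by (auto simp: nth_append p_def less_Suc_eq split: if_splits)
      show "h i = 0" if "i \<ge> length (map fst X @ [b])" for i
        using zero[of i] that by (simp add: p_def)
    qed
    ultimately show ?thesis by (intro exI[of _ h]) (simp add: h_def)
  qed
  then obtain h where h: "\<And>v. v \<in> set S \<Longrightarrow> h v \<in> syz (G @ [g]) \<and> h v p = var v \<and>
      hom_fun (map fst X @ [b]) (b + expo_var v) (h v)"
    by metis
  \<comment> \<open>The relations are added one variable at a time. After \<open>q\<close> of them
    the span consists of all syzygies whose last coefficient lies in the ideal of the first
    \<open>q\<close> variables; this invariant also yields the colon ideal of the next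
    relation.\<close>
  define Z where "Z q = Y @ map (\<lambda>i. (b + expo_var (S ! i), take i S, h (S ! i))) [0..<q]" for q
  have Z: "module_linear_quotients (Z q) \<and>
      fmod.span (set (gens (Z q))) = {c \<in> syz (G @ [g]). c p \<in> ideal_of (var ` set (take q S))}"
    if "q \<le> length S" for q
    using that
  proof (induction q)
    case 0
    have "p' \<in> ideal_of (var ` {}) \<longleftrightarrow> p' = 0" for p' :: "('v, 'k) mpoly"
      by (simp only: mem_ideal_of_var_iff) (simp flip: keys_eq_empty)
    then have "syz G = {c \<in> syz (G @ [g]). c p \<in> ideal_of (var ` set (take 0 S))}"
      using syz_subset_syz_append_single[of G g] by (simp add: lenG)
    then show ?case using Y unfolding Z_def by (simp del: scale_apply)
  next
    case (Suc q)
    define v where "v = S ! q"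
    have q: "q < length S" using Suc.prems by simp
    have v: "v \<in> set S" using q by (simp add: v_def)
    have v': "v \<notin> set (take q S)"
      using q nth_eq_iff_index_eq[OF snoc.hyps(2)] by (auto simp: v_def in_set_conv_nth)
    have take: "set (take (Suc q) S) = insert v (set (take q S))"
      using Suc.prems by (simp add: take_Suc_conv_app_nth v_def)
    have Zq: "Z (Suc q) = Z q @ [(b + expo_var v, take q S, h v)]"
      by (simp add: Z_def v_def)
    have IH: "module_linear_quotients (Z q)"
      "fmod.span (set (gens (Z q))) = {c \<in> syz (G @ [g]). c p \<in> ideal_of (var ` set (take q S))}"
      using Suc.IH[OF less_imp_le[OF q]] by blast+
    have "\<forall>f. scale f (h v) \<in> fmod.span (set (gens (Z q))) \<longleftrightarrow> f \<in> ideal_of (var ` set (take q S))"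
    proof
      fix f
      have "scale f (h v) \<in> fmod.span (set (gens (Z q))) \<longleftrightarrow>
          f * var v \<in> ideal_of (var ` set (take q S))"
        unfolding IH(2) using h[OF v] fmod.subspace_scale[OF subspace_syz, of "h v" "G @ [g]" f]
        by simp
      also have "\<dots> \<longleftrightarrow> f \<in> ideal_of (var ` set (take q S))"
        using var_mult_mem_ideal_of_var[OF _ v'] ideal_of_mult_right by blast
      finally show "scale f (h v) \<in> fmod.span (set (gens (Z q))) \<longleftrightarrow>
          f \<in> ideal_of (var ` set (take q S))" .
    qed
    then have "module_linear_quotients (Z (Suc q))"
      unfolding Zq
      by (rule module_linear_quotients.snoc[OF IH(1) distinct_take[OF snoc.hyps(2)]])
    moreover have "fmod.span (set (gens (Z (Suc q)))) =
        {c \<in> syz (G @ [g]). c p \<in> ideal_of (var ` set (take (Suc q) S))}"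
    proof (rule Set.set_eqI)
      fix x
      have "set (gens (Z (Suc q))) = insert (h v) (set (gens (Z q)))"
        by (simp add: Zq)
      then have "x \<in> fmod.span (set (gens (Z (Suc q)))) \<longleftrightarrow>
          (\<exists>f. x - scale f (h v) \<in> fmod.span (set (gens (Z q))))"
        by (simp only: fmod.span_insert mem_Collect_eq)
      also have "\<dots> \<longleftrightarrow> (\<exists>f. x \<in> syz (G @ [g]) \<and> x p - f * var v \<in> ideal_of (var ` set (take q S)))"
      proof (rule ex_cong1)
        fix f
        have s: "scale f (h v) \<in> syz (G @ [g])"
          using h[OF v] fmod.subspace_scale[OF subspace_syz] by blast
        have "x - scale f (h v) \<in> syz (G @ [g]) \<longleftrightarrow> x \<in> syz (G @ [g])"
          using fmod.subspace_diff[OF subspace_syz _ s, of x]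
            fmod.subspace_add[OF subspace_syz _ s, of "x - scale f (h v)"]
          by (auto simp only: diff_add_cancel)
        moreover have "(x - scale f (h v)) p = x p - f * var v"
          using h[OF v] by simp
        ultimately show "x - scale f (h v) \<in> fmod.span (set (gens (Z q))) \<longleftrightarrow>
            x \<in> syz (G @ [g]) \<and> x p - f * var v \<in> ideal_of (var ` set (take q S))"
          by (simp only: IH(2) mem_Collect_eq)
      qed
      also have "\<dots> \<longleftrightarrow> x \<in> syz (G @ [g]) \<and> x p \<in> ideal_of (insert (var v) (var ` set (take q S)))"
        unfolding ideal_of_def ring_module.span_insert by simp
      finally show "x \<in> fmod.span (set (gens (Z (Suc q)))) \<longleftrightarrow>
          x \<in> {c \<in> syz (G @ [g]). c p \<in> ideal_of (var ` set (take (Suc q) S))}"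
        by (simp only: take image_insert mem_Collect_eq)
    qed
    ultimately show ?case ..
  qed
  \<comment> \<open>The last coefficient of any syzygy lies in the colon ideal of \<open>g\<close>,
    so with all of \<open>S\<close> used up no syzygy is missed.\<close>
  have "c p \<in> ideal_of (var ` set S)" if "c \<in> syz (G @ [g])" for c
  proof -
    have "scale (c p) g = - comb G c"
      using that unfolding mem_syz_append_single_iff lenG by (simp add: eq_neg_iff_add_eq_0 add.commute)
    also have "\<dots> \<in> fmod.span (set G)"
      by (intro fmod.span_neg) (simp only: span_eq_range_comb rangeI)
    finally show ?thesis by (simp only: colon)
  qed
  then have span: "fmod.span (set (gens (Z (length S)))) = syz (G @ [g])"
    using Z[of "length S"] by auto
  have "graded (map fst X @ [b]) (map fst (Z q)) (gens (Z q))" if "q \<le> length S" for q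
    using that
  proof (induction q)
    case 0
    then show ?case using Y(2) by (simp add: Z_def graded_def hom_fun_append)
  next
    case (Suc q)
    have "Z (Suc q) = Z q @ [(b + expo_var (S ! q), take q S, h (S ! q))]" by (simp add: Z_def)
    then show ?case
      using Suc h[of "S ! q"] by (simp add: graded_append_single)
  qed
  from this[of "length S"] have "graded (map fst (X @ [(b, S, g)])) (map fst (Z (length S))) (gens (Z (length S)))"
    by simp
  moreover have "labels (Z (length S)) = concat (map syz_labels (labels (X @ [(b, S, g)])))"
    using Y(4) by (simp add: Z_def syz_labels_def case_prod_unfold comp_def)
  ultimately show ?case
    using Z[of "length S"] span
    by (intro exI[of _ "Z (length S)"] conjI) (simp_all only: gen order_refl)
qed

definition esum :: "'v set \<Rightarrow> 'v expo" where
  "esum T = (\<Sum>v\<in>T. expo_var v)"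

definition expand :: "('v expo \<times> 'v list) list \<Rightarrow> ('v expo \<times> 'v list) list" where
  "expand L = concat (map syz_labels L)"

lemma set_expand_pow: "set ((expand ^^ k) L) = (\<Union>x\<in>set L. set ((expand ^^ k) [x]))"
proof (induction k arbitrary: L)
  case (Suc k)
  have "set ((expand ^^ Suc k) L) = (\<Union>y\<in>set (expand L). set ((expand ^^ k) [y]))"
    by (subst Suc.IH[symmetric]) (simp add: funpow_swap1)
  also have "\<dots> = (\<Union>x\<in>set L. \<Union>y\<in>set (expand [x]). set ((expand ^^ k) [y]))"
    by (auto simp: expand_def)
  also have "\<dots> = (\<Union>x\<in>set L. set ((expand ^^ Suc k) [x]))"
    by (subst Suc.IH[symmetric]) (simp add: funpow_swap1)
  finally show ?case .
qed simp

text \<open>Each expansion picks a position of the list and keeps only the smaller ones. A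
  \<open>k\<close>-element set is therefore produced by choosing its elements in decreasing order of
  position.\<close>

lemma degrees_expand_pow:
  assumes "distinct S"
  shows "fst ` set ((expand ^^ k) [(b, S)]) = {b + esum T | T. T \<subseteq> set S \<and> card T = k}"
  using assms
proof (induction k arbitrary: b S)
  case 0
  have "{b + esum T | T. T \<subseteq> set S \<and> card T = 0} = {b}"
    using finite_subset[of _ "set S"] by (auto simp: esum_def intro: exI[of _ "{}"])
  then show ?case by simp
next
  case (Suc k)
  have "(expand ^^ Suc k) [(b, S)] = (expand ^^ k) (syz_labels (b, S))"
    by (simp add: funpow_swap1 expand_def)
  then have "fst ` set ((expand ^^ Suc k) [(b, S)]) =
      (\<Union>x\<in>set (syz_labels (b, S)). fst ` set ((expand ^^ k) [x]))"
    using set_expand_pow[of k "syz_labels (b, S)"] by auto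
  also have "\<dots> = (\<Union>q<length S. fst ` set ((expand ^^ k) [(b + expo_var (S ! q), take q S)]))"
    by (auto simp: syz_labels_def)
  also have "\<dots> = (\<Union>q<length S. {b + expo_var (S ! q) + esum T | T. T \<subseteq> set (take q S) \<and> card T = k})"
    using Suc by (intro SUP_cong refl) (simp add: distinct_take)
  also have "\<dots> = {b + esum T | T. T \<subseteq> set S \<and> card T = Suc k}" (is "?A = ?B")
  proof
    show "?A \<subseteq> ?B"
    proof clarify
      fix q T assume q: "q < length S" "T \<subseteq> set (take q S)" "k = card T"
      have "finite T" using q(2) finite_subset by blast
      moreover have "S ! q \<notin> T"
        using q Suc.prems by (auto simp: in_set_conv_nth nth_eq_iff_index_eq dest!: subsetD)
      moreover have "insert (S ! q) T \<subseteq> set S"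
        using q by (auto dest: in_set_takeD)
      ultimately show "\<exists>T'. b + expo_var (S ! q) + esum T = b + esum T' \<and> T' \<subseteq> set S \<and>
          card T' = Suc (card T)"
        by (intro exI[of _ "insert (S ! q) T"]) (simp add: esum_def add.assoc)
    qed
    show "?B \<subseteq> ?A"
    proof clarify
      fix T assume T: "T \<subseteq> set S" "card T = Suc k"
      have finT: "finite T" using T(1) finite_subset by blast
      define I where "I = {q. q < length S \<and> S ! q \<in> T}"
      have I: "finite I" "I \<noteq> {}"
        using T by (auto simp: I_def in_set_conv_nth subset_iff) (metis card.empty equals0I nat.distinct(1))
      define q where "q = Max I"
      have q: "q < length S" "S ! q \<in> T" "\<And>r. r \<in> I \<Longrightarrow> r \<le> q"
        using Max_in[OF I] Max_ge[OF I(1)] by (auto simp: q_def I_def)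
      have "T - {S ! q} \<subseteq> set (take q S)"
      proof
        fix v assume v: "v \<in> T - {S ! q}"
        then have "v \<in> set S" using T by blast
        then obtain r where r: "r < length S" "v = S ! r" by (auto simp: in_set_conv_nth)
        then have "r \<le> q" "r \<noteq> q" using v q(3)[of r] by (auto simp: I_def)
        then show "v \<in> set (take q S)" using r by (auto simp: in_set_conv_nth)
      qed
      moreover have "card (T - {S ! q}) = k" using T q finT by simp
      moreover have "b + esum T = b + expo_var (S ! q) + esum (T - {S ! q})"
        using q finT by (simp add: esum_def add.assoc sum.remove)
      ultimately show "b + esum T \<in> ?A" using q(1) by blast
    qed
  qed
  finally show ?case .
qed

lemma set_take_nth: "i \<le> length xs \<Longrightarrow> set (take i xs) = (\<lambda>k. xs ! k) ` {..<i}"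
  using nth_image[of i xs] by (simp add: lessThan_atLeast0)

text \<open>The iterated mapping cone: linear quotients pass from a list of generators to generators
  of its syzygies, so the construction can be repeated, and the labels alone record the
  degrees.\<close>

theorem linear_quotients_resolution:
  fixes us :: "'v::finite expo list" and V :: "nat \<Rightarrow> 'v set"
  assumes colon: "\<And>i. i < length us \<Longrightarrow>
    colon_ideal (ideal_of (xpow ` set (take i us))) (xpow (us ! i)) =
      (ideal_of (var ` V i) :: ('v, 'k::field) mpoly set)"
  obtains degs and d :: "nat \<Rightarrow> ('v, 'k::field) mpoly mat" where
    "multigraded_free_resolution (ideal_of (xpow ` set us)) degs d"
    "\<And>k. set (degs k) = {us ! i + esum T | i T. i < length us \<and> T \<subseteq> V i \<and> card T = k}"
proof -
  obtain vs where vs: "\<And>i. set (vs i) = V i" "\<And>i. distinct (vs i)"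
    using finite_distinct_list[OF finite[of "V _"]] by metis
  define X0 :: "('v expo \<times> 'v list \<times> (nat \<Rightarrow> ('v, 'k) mpoly)) list"
    where "X0 = map (\<lambda>i. (us ! i, vs i, emb (xpow (us ! i)))) [0..<length us]"
  have lqX0: "module_linear_quotients X0"
  proof -
    have "module_linear_quotients (take i X0)" if "i \<le> length us" for i
      using that
    proof (induction i)
      case (Suc i)
      have len: "length X0 = length us" by (simp add: X0_def)
      have i: "take (Suc i) X0 = take i X0 @ [(us ! i, vs i, emb (xpow (us ! i)))]"
        using Suc.prems by (simp add: take_Suc_conv_app_nth X0_def)
      have "set (gens (take i X0)) = emb ` xpow ` set (take i us)"
        using Suc.prems by (auto simp: set_take_nth X0_def image_image)
      moreover have "scale f (emb (xpow (us ! i))) = emb (f * xpow (us ! i))" for f :: "('v, 'k) mpoly"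
        by (auto simp: emb_def fun_eq_iff)
      ultimately have "scale f (emb (xpow (us ! i))) \<in> fmod.span (set (gens (take i X0))) \<longleftrightarrow>
          f \<in> ideal_of (var ` set (vs i))" for f :: "('v, 'k) mpoly"
        using colon[of i] Suc.prems
        by (simp only: span_emb vs) (auto simp: colon_ideal_def emb_inject)
      then show ?case
        unfolding i using Suc vs(2)
        by (intro module_linear_quotients.snoc) (auto simp del: scale_apply)
    qed (simp add: module_linear_quotients.Nil)
    from this[of "length us"] show ?thesis by (simp add: X0_def)
  qed
  have grX0: "graded [0] (map fst X0) (gens X0)"
    by (simp add: graded_def X0_def hom_fun_emb_xpow)
  let ?P = "\<lambda>(k::nat) x. module_linear_quotients x \<and> (\<exists>ds. graded ds (map fst x) (gens x)) \<and>
    (k = 0 \<longrightarrow> x = X0)"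
  let ?R = "\<lambda>x y. graded (map fst x) (map fst y) (gens y) \<and>
    fmod.span (set (gens y)) = syz (gens x) \<and> labels y = expand (labels x)"
  have "\<exists>X. \<forall>k. ?P k (X k) \<and> ?R (X k) (X (Suc k))"
  proof (rule dependent_nat_choice)
    show "\<exists>x. ?P 0 x" using lqX0 grX0 by auto
  next
    fix x :: "('v expo \<times> 'v list \<times> (nat \<Rightarrow> ('v, 'k) mpoly)) list" and k :: nat
    assume "?P k x"
    then obtain ds where "module_linear_quotients x" "graded ds (map fst x) (gens x)" by blast
    from module_linear_quotients_syz[OF this] show "\<exists>y. ?P (Suc k) y \<and> ?R x y"
      unfolding expand_def by blast
  qed
  then obtain X where X: "\<forall>k. ?P k (X k) \<and> ?R (X k) (X (Suc k))" by blast
  have X_0: "X 0 = X0" using X by blast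
  define degs where "degs k = map fst (X k)" for k
  have "graded (target_degs degs k) (degs k) (gens (X k))" for k
    using X grX0 by (cases k) (simp_all add: target_degs_def X_0 degs_def)
  moreover have "(\<lambda>f. f 0) ` fmod.span (set (gens (X 0))) = ideal_of (xpow ` set us)"
  proof -
    have "set (gens X0) = emb ` xpow ` set us"
    proof -
      have "gens X0 = map (\<lambda>u. emb (xpow u)) us"
        by (rule nth_equalityI) (simp_all add: X0_def)
      then show ?thesis by (simp add: image_image)
    qed
    then show ?thesis unfolding X_0 by (simp only: span_emb) (simp add: image_image)
  qed
  ultimately have "multigraded_free_resolution (ideal_of (xpow ` set us)) degs
      (\<lambda>k. mat_of (length (target_degs degs k)) (gens (X k)))"
    by (rule multigraded_free_resolution_of_lists) (use X in auto)
  moreover have "set (degs k) = {us ! i + esum T | i T. i < length us \<and> T \<subseteq> V i \<and> card T = k}" for k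
  proof -
    have "labels (X k) = (expand ^^ k) (labels X0)"
      by (induction k) (use X X_0 in auto)
    moreover have "degs k = map fst (labels (X k))"
      by (simp add: degs_def case_prod_unfold)
    ultimately have "set (degs k) = fst ` set ((expand ^^ k) (labels X0))" by simp
    also have "\<dots> = (\<Union>x\<in>set (labels X0). fst ` set ((expand ^^ k) [x]))"
      by (subst set_expand_pow) (rule image_UN)
    also have "\<dots> = (\<Union>i<length us. fst ` set ((expand ^^ k) [(us ! i, vs i)]))"
      by (auto simp: X0_def)
    also have "\<dots> = (\<Union>i<length us. {us ! i + esum T | T. T \<subseteq> V i \<and> card T = k})"
      using degrees_expand_pow[OF vs(2)] by (simp add: vs)
    finally show ?thesis by blast
  qed
  ultimately show ?thesis using that by blast
qed

section \<open>Homological shift ideals\<close>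

text \<open>The chosen resolution and the given one are both minimal, so the comparison applies in
  both directions. Comparing sets of degrees suffices since only nonvanishing is asked.\<close>

lemma multigraded_betti_nonzero_iff:
  fixes J :: "('v::finite, 'k::field) mpoly set"
  assumes F: "minimal_multigraded_free_resolution J degs d"
  shows "multigraded_betti k a J \<noteq> 0 \<longleftrightarrow> a \<in> set (degs k)"
proof -
  define degs' where "degs' = (SOME degs. \<exists>d. minimal_multigraded_free_resolution J degs d)"
  have "\<exists>d'. minimal_multigraded_free_resolution J degs' d'"
    unfolding degs'_def by (rule someI_ex[of "\<lambda>degs. \<exists>d. minimal_multigraded_free_resolution J degs d"]) (use F in blast)
  then obtain d' where F': "minimal_multigraded_free_resolution J degs' d'" ..
  have "set (degs k) = set (degs' k)"
    using minimal_resolution_degs_subset[OF F] minimal_resolution_degs_subset[OF F'] F F'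
    unfolding minimal_multigraded_free_resolution_def by blast
  then show ?thesis
    unfolding multigraded_betti_def degs'_def[symmetric] Let_def count_list_0_iff by simp
qed

lemma HS_eq:
  fixes J :: "('v::finite, 'k::field) mpoly set"
  assumes "minimal_multigraded_free_resolution J degs d"
  shows "HS k J = ideal_of (xpow ` set (degs k))"
  unfolding HS_def multigraded_betti_nonzero_iff[OF assms] by simp

lemma ideal_of_subset: "S \<subseteq> ideal_of T \<Longrightarrow> ideal_of S \<subseteq> ideal_of T"
  unfolding ideal_of_def by (intro ring_module.span_minimal ring_module.subspace_span)

text \<open>The ideal is generated by the entries of the augmentation, and in a minimal resolution
  each entry is a nonzero scalar times the monomial of its degree.\<close>

theorem HS_zero:
  fixes A :: "'v::finite expo set"
  assumes "finite A"
  shows "HS 0 (ideal_of (xpow ` A)) = (ideal_of (xpow ` A) :: ('v, 'k::field) mpoly set)"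
proof -
  define J :: "('v, 'k) mpoly set" where "J = ideal_of (xpow ` A)"
  obtain degs d where F: "minimal_multigraded_free_resolution J degs d"
    using monomial_ideal_minimal_resolution[OF assms] unfolding J_def by blast
  then have res: "multigraded_free_resolution J degs d"
    and min: "\<And>k i j. i < length (degs k) \<Longrightarrow> j < length (degs (Suc k)) \<Longrightarrow>
        d (Suc k) $$ (i, j) \<in> ideal_of (range var)"
    by (auto simp: minimal_multigraded_free_resolution_def)
  define n where "n = length (degs 0)"
  have hom: "hom_mat (target_degs degs k) (degs k) (d k)" for k
    using res unfolding multigraded_free_resolution_iff by blast
  have h0: "hom_mat [0] (degs 0) (d 0)" using hom[of 0] by (simp add: target_degs_def)
  have h1: "hom_mat (degs 0) (degs (Suc 0)) (d (Suc 0))" using hom[of "Suc 0"] by (simp add: target_degs_def)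
  have d0: "d 0 \<in> carrier_mat 1 n" and d1: "d (Suc 0) \<in> carrier_mat n (length (degs (Suc 0)))"
    using h0 h1 by (simp_all add: hom_mat_def n_def)
  have im: "(\<lambda>v. v $ 0) ` mat_image (d 0) = J" and ker: "mat_kernel (d 0) = mat_image (d (Suc 0))"
    using res by (auto simp: multigraded_free_resolution_def)
  define c where "c j = d 0 $$ (0, j)" for j
  have homog: "homog 0 (degs 0 ! j) (c j)" if "j < n" for j
    using h0 that by (simp add: hom_mat_def c_def n_def)
  \<comment> \<open>A zero column would put a unit vector into the kernel, that is, into the image
    of a matrix with entries in the irrelevant ideal.\<close>
  have nz: "c j \<noteq> 0" if j: "j < n" for j
  proof
    assume "c j = 0"
    then have "col (d 0) j = 0\<^sub>v 1" using d0 j by (intro eq_vecI) (auto simp: c_def)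
    moreover have "d 0 *\<^sub>v unit_vec n j = col (d 0) j" using d0 j by (intro eq_vecI) auto
    ultimately have "unit_vec n j \<in> mat_kernel (d 0)" by (intro mat_kernelI[OF d0]) auto
    then obtain w where w: "w \<in> carrier_vec (length (degs (Suc 0)))" "unit_vec n j = d (Suc 0) *\<^sub>v w"
      using d1 unfolding ker mat_image_def by auto
    have "(d (Suc 0) *\<^sub>v w) $ j = (\<Sum>l<length (degs (Suc 0)). d (Suc 0) $$ (j, l) * w $ l)"
      using d1 w(1) j by (auto simp: scalar_prod_def lessThan_atLeast0 intro!: sum.cong)
    also have "\<dots> \<in> ideal_of (range var)"
      using min j by (intro ideal_of_sum ideal_of_mult_right) (auto simp: n_def)
    finally have "(1 :: ('v, 'k) mpoly) \<in> ideal_of (range var)"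
      using j by (simp flip: w(2))
    then show False by (simp add: mem_ideal_of_vars_iff)
  qed
  have single: "\<exists>x. x \<noteq> 0 \<and> c j = Poly_Mapping.single (degs 0 ! j) x" if j: "j < n" for j
    using homog_eq_single[OF homog[OF j] nz[OF j]] nz[OF j] by (metis diff_zero single_zero)
  have "xpow ` set (degs 0) \<subseteq> J"
  proof (clarsimp simp: in_set_conv_nth)
    fix j assume "j < length (degs 0)"
    then have j: "j < n" by (simp add: n_def)
    have "col (d 0) j \<in> mat_image (d 0)" using d0 j by (rule col_mem_mat_image)
    then have "c j \<in> J"
      using im d0 j by (auto simp: c_def image_iff intro!: bexI[of _ "col (d 0) j"])
    moreover obtain x where x: "x \<noteq> 0" "c j = Poly_Mapping.single (degs 0 ! j) x"
      using single[OF j] by blast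
    moreover have "xpow (degs 0 ! j) = Poly_Mapping.single 0 (1 / x) * c j"
      using x by (simp add: mult_single xpow_def)
    ultimately show "xpow (degs 0 ! j) \<in> J"
      unfolding J_def using ideal_of_mult by metis
  qed
  then have "ideal_of (xpow ` set (degs 0)) \<subseteq> J"
    unfolding J_def by (rule ideal_of_subset)
  moreover have "J \<subseteq> ideal_of (xpow ` set (degs 0))"
  proof
    fix f assume "f \<in> J"
    then obtain v where v: "v \<in> carrier_vec n" "f = (d 0 *\<^sub>v v) $ 0"
      using d0 unfolding im[symmetric] mat_image_def by auto
    then have "f = (\<Sum>j<n. v $ j * c j)"
      using d0 by (auto simp: scalar_prod_def lessThan_atLeast0 c_def mult.commute intro!: sum.cong)
    also have "\<dots> \<in> ideal_of (xpow ` set (degs 0))"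
    proof (intro ideal_of_sum ideal_of_mult)
      fix j assume "j \<in> {..<n}"
      then obtain x where "c j = Poly_Mapping.single (degs 0 ! j) x" "j < length (degs 0)"
        using single[of j] by (auto simp: n_def)
      then show "c j \<in> ideal_of (xpow ` set (degs 0))"
        by (auto simp: mem_ideal_of_xpow_iff intro!: bexI[of _ "degs 0 ! j"])
    qed
    finally show "f \<in> ideal_of (xpow ` set (degs 0))" .
  qed
  ultimately show ?thesis
    using HS_eq[OF F, of 0] by (simp add: J_def)
qed

section \<open>Linear quotients as a condition on lists of exponents\<close>

definition lq_vars :: "'v expo list \<Rightarrow> nat \<Rightarrow> 'v set" where
  "lq_vars us i = {v. \<exists>k<i. us ! k adds us ! i + expo_var v}"

text \<open>Linear quotients without reference to the field. The last clause says that
  \<open>us ! j\<close>, divided by its greatest common divisor with \<open>us ! i\<close>, is a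
  multiple of a variable of the colon ideal.\<close>

definition lq_list :: "'v expo list \<Rightarrow> bool" where
  "lq_list us \<longleftrightarrow> distinct us \<and>
     (\<forall>a\<in>set us. \<forall>b\<in>set us. a adds b \<longrightarrow> a = b) \<and>
     (\<forall>i<length us. \<forall>j<i. \<exists>v\<in>lq_vars us i. lookup (us ! i) v < lookup (us ! j) v)"

lemma ideal_of_xpow_subset_iff:
  "ideal_of (xpow ` A) \<subseteq> (ideal_of (xpow ` B) :: ('v, 'k::field) mpoly set) \<longleftrightarrow>
     (\<forall>a\<in>A. \<exists>b\<in>B. b adds a)"
proof
  assume "ideal_of (xpow ` A) \<subseteq> (ideal_of (xpow ` B) :: ('v, 'k) mpoly set)"
  then have "(xpow a :: ('v, 'k) mpoly) \<in> ideal_of (xpow ` B)" if "a \<in> A" for a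
    using ideal_of_base[of "xpow a" "xpow ` A"] that by blast
  then show "\<forall>a\<in>A. \<exists>b\<in>B. b adds a" by (simp add: xpow_mem_ideal_of_iff)
next
  assume "\<forall>a\<in>A. \<exists>b\<in>B. b adds a"
  then show "ideal_of (xpow ` A) \<subseteq> (ideal_of (xpow ` B) :: ('v, 'k) mpoly set)"
    by (intro ideal_of_subset) (auto simp: xpow_mem_ideal_of_iff)
qed

text \<open>The set of variables in the definition is determined by the colon ideal, since testing
  single variables for membership recovers it. Minimality makes the generators an antichain, and an
  antichain generating the same ideal already lies in \<open>U\<close>.\<close>

theorem linear_quotients_list:
  assumes "linear_quotients (ideal_of (xpow ` U) :: ('v, 'k::field) mpoly set)"
  obtains us where "lq_list us" "set us \<subseteq> U" "\<forall>a\<in>U. \<exists>u\<in>set us. u adds a"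
    "\<And>i. i < length us \<Longrightarrow> colon_ideal (ideal_of (xpow ` set (take i us))) (xpow (us ! i)) =
      (ideal_of (var ` lq_vars us i) :: ('v, 'k) mpoly set)"
proof -
  obtain us where us: "distinct us"
    "minimal_monomial_gens (ideal_of (xpow ` U) :: ('v, 'k) mpoly set) (set us)"
    and colon: "\<And>i. 0 < i \<Longrightarrow> i < length us \<Longrightarrow> \<exists>S.
      colon_ideal (ideal_of (xpow ` set (take i us))) (xpow (us ! i)) =
        (ideal_of (var ` S) :: ('v, 'k) mpoly set)"
    using assms unfolding linear_quotients_def by blast
  have eq: "ideal_of (xpow ` set us) = (ideal_of (xpow ` U) :: ('v, 'k) mpoly set)"
    and min: "\<And>B. B \<subset> set us \<Longrightarrow> ideal_of (xpow ` B) \<noteq> (ideal_of (xpow ` U) :: ('v, 'k) mpoly set)"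
    using us(2) by (auto simp: minimal_monomial_gens_def)
  have usU: "\<forall>u\<in>set us. \<exists>a\<in>U. a adds u" and Uus: "\<forall>a\<in>U. \<exists>u\<in>set us. u adds a"
    using eq by (auto simp flip: ideal_of_xpow_subset_iff[where ?'k = 'k])
  have anti: "a = b" if ab: "a \<in> set us" "b \<in> set us" "a adds b" for a b
  proof (rule ccontr)
    assume "a \<noteq> b"
    have "ideal_of (xpow ` (set us - {b})) = (ideal_of (xpow ` set us) :: ('v, 'k) mpoly set)"
    proof
      show "ideal_of (xpow ` (set us - {b})) \<subseteq> (ideal_of (xpow ` set us) :: ('v, 'k) mpoly set)"
        unfolding ideal_of_xpow_subset_iff using adds_refl by blast
      show "ideal_of (xpow ` set us) \<subseteq> (ideal_of (xpow ` (set us - {b})) :: ('v, 'k) mpoly set)"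
        unfolding ideal_of_xpow_subset_iff using ab \<open>a \<noteq> b\<close>
        by (metis adds_refl insert_Diff insert_iff)
    qed
    then show False using min[of "set us - {b}"] ab eq by blast
  qed
  have sub: "set us \<subseteq> U"
  proof
    fix u assume u: "u \<in> set us"
    then obtain a where a: "a \<in> U" "a adds u" using usU by blast
    then obtain u' where u': "u' \<in> set us" "u' adds a" using Uus by blast
    then have "u' = u" using anti u adds_trans[OF u'(2) a(2)] by blast
    then show "u \<in> U" using a u' adds_antisym by blast
  qed
  have mono_colon: "xpow m \<in> colon_ideal (ideal_of (xpow ` set (take i us)) :: ('v, 'k) mpoly set) (xpow (us ! i))
      \<longleftrightarrow> (\<exists>k<i. us ! k adds m + us ! i)" if "i < length us" for m i
    using that
    by (auto simp: colon_ideal_def xpow_mult xpow_mem_ideal_of_iff set_take_nth)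
  have lq: "colon_ideal (ideal_of (xpow ` set (take i us))) (xpow (us ! i)) =
      (ideal_of (var ` lq_vars us i) :: ('v, 'k) mpoly set)" if i: "i < length us" for i
  proof (cases "i = 0")
    \<comment> \<open>The definition of linear quotients is silent about the first generator; its
      colon ideal is zero and \<open>lq_vars us 0\<close> is empty.\<close>
    case True
    have "f * xpow (us ! i) = 0 \<longleftrightarrow> f = 0" for f :: "('v, 'k) mpoly"
      by (rule mult_xpow_eq_zero_iff)
    moreover have "f \<in> ideal_of {} \<longleftrightarrow> f = 0" for f :: "('v, 'k) mpoly"
      using mem_ideal_of_var_iff[of f "{}"] by (simp flip: keys_eq_empty)
    ultimately show ?thesis using True by (auto simp: lq_vars_def colon_ideal_def)
  next
    case False
    then obtain S where S: "colon_ideal (ideal_of (xpow ` set (take i us))) (xpow (us ! i)) =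
        (ideal_of (var ` S) :: ('v, 'k) mpoly set)"
      using colon[of i] i by blast
    have "v \<in> S \<longleftrightarrow> v \<in> lq_vars us i" for v
    proof -
      have "v \<in> S \<longleftrightarrow> (var v :: ('v, 'k) mpoly) \<in> ideal_of (var ` S)"
        unfolding mem_ideal_of_var_iff
        by (auto simp: var_eq_xpow lookup_single when_def split: if_splits)
      also have "\<dots> \<longleftrightarrow> v \<in> lq_vars us i"
        unfolding S[symmetric] var_eq_xpow using mono_colon[OF i]
        by (simp add: lq_vars_def add.commute del: One_nat_def)
      finally show ?thesis .
    qed
    then have "S = lq_vars us i" by blast
    then show ?thesis using S by simp
  qed
  have "\<exists>v\<in>lq_vars us i. lookup (us ! i) v < lookup (us ! j) v" if ij: "i < length us" "j < i" for i j
  proof -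
    have "us ! j adds (us ! j - us ! i) + us ! i"
      by (auto simp: adds_def lookup_add lookup_minus)
    then have "(xpow (us ! j - us ! i) :: ('v, 'k) mpoly) \<in> ideal_of (var ` lq_vars us i)"
      using mono_colon[OF ij(1)] ij by (auto simp flip: lq)
    then show ?thesis
      by (auto simp: mem_ideal_of_var_iff lookup_minus)
  qed
  then have "lq_list us"
    using us(1) anti by (simp add: lq_list_def)
  then show ?thesis using that sub Uus lq by blast
qed

text \<open>A matrix entry with a constant term would join equal degrees in adjacent positions,
  which \<open>sep\<close> excludes. So the explicit resolution is already minimal.\<close>

theorem HS_linear_quotients:
  fixes us :: "'v::finite expo list"
  assumes colon: "\<And>i. i < length us \<Longrightarrow>
      colon_ideal (ideal_of (xpow ` set (take i us))) (xpow (us ! i)) =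
      (ideal_of (var ` V i) :: ('v, 'k::field) mpoly set)"
    and sep: "\<And>i j S T. i < length us \<Longrightarrow> j < length us \<Longrightarrow> S \<subseteq> V i \<Longrightarrow> T \<subseteq> V j \<Longrightarrow>
      us ! i + esum S = us ! j + esum T \<Longrightarrow> card S = card T"
  shows "HS k (ideal_of (xpow ` set us) :: ('v, 'k) mpoly set) =
    ideal_of (xpow ` {us ! i + esum T | i T. i < length us \<and> T \<subseteq> V i \<and> card T = k})"
proof -
  obtain degs and d :: "nat \<Rightarrow> ('v, 'k) mpoly mat" where
    res: "multigraded_free_resolution (ideal_of (xpow ` set us)) degs d" and
    degs: "\<And>k. set (degs k) = {us ! i + esum T | i T. i < length us \<and> T \<subseteq> V i \<and> card T = k}"
    using linear_quotients_resolution[OF colon] by blast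
  have "d (Suc k) $$ (i, j) \<in> ideal_of (range var)"
    if ij: "i < length (degs k)" "j < length (degs (Suc k))" for k i j
  proof (rule ccontr)
    assume "d (Suc k) $$ (i, j) \<notin> ideal_of (range var)"
    then have "0 \<in> keys (d (Suc k) $$ (i, j))"
      by (simp add: mem_ideal_of_vars_iff in_keys_iff)
    moreover have "\<forall>m\<in>keys (d (Suc k) $$ (i, j)). m + target_degs degs (Suc k) ! i = degs (Suc k) ! j"
    proof -
      have "hom_mat (target_degs degs (Suc k)) (degs (Suc k)) (d (Suc k))"
        using res unfolding multigraded_free_resolution_iff by blast
      then show ?thesis using ij by (simp add: hom_mat_def homog_def target_degs_def)
    qed
    ultimately have "degs k ! i = degs (Suc k) ! j"
      by (fastforce simp: target_degs_def)
    then have "degs k ! i \<in> set (degs k)" "degs k ! i \<in> set (degs (Suc k))"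
      using nth_mem[OF ij(1)] nth_mem[OF ij(2)] by simp_all
    then obtain i' S j' T where "i' < length us" "S \<subseteq> V i'" "card S = k" "degs k ! i = us ! i' + esum S"
      "j' < length us" "T \<subseteq> V j'" "card T = Suc k" "degs k ! i = us ! j' + esum T"
      unfolding degs mem_Collect_eq by blast
    then show False using sep[of i' j' S T] by simp
  qed
  then have "minimal_multigraded_free_resolution (ideal_of (xpow ` set us)) degs d"
    using res by (simp add: minimal_multigraded_free_resolution_def)
  from HS_eq[OF this, of k] show ?thesis by (simp only: degs)
qed

section \<open>Chordality\<close>

text \<open>A hole is a chordless path \<open>c 0\<close>, ..., \<open>c l\<close> closed by the
  edge between its ends, so it has \<open>l + 1\<close> vertices, at least four. Singling out the
  closing edge prepares the search for a triangle over it.\<close>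

definition no_hole :: "('a \<Rightarrow> 'a \<Rightarrow> bool) \<Rightarrow> bool" where
  "no_hole R \<longleftrightarrow> \<not> (\<exists>l c. 3 \<le> l \<and> inj_on c {..l::nat} \<and> (\<forall>i<l. R (c i) (c (Suc i))) \<and>
     R (c 0) (c l) \<and> (\<forall>i j. i < j \<and> j \<le> l \<and> j \<noteq> Suc i \<and> \<not> (i = 0 \<and> j = l) \<longrightarrow> \<not> R (c i) (c j)))"

text \<open>A chord splits the cycle, and the part that retains the edge from \<open>c 0\<close> to
  \<open>c l\<close> is a shorter cycle. Induction on the length ends with a triangle over that
  edge.\<close>

lemma cycle_edge_in_triangle:
  assumes hole: "no_hole R" and sym: "\<And>x y. R x y \<Longrightarrow> R y x"
    and "2 \<le> l" "inj_on c {..l::nat}" "\<forall>i<l. R (c i) (c (Suc i))" "R (c 0) (c l)"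
  shows "\<exists>x. 0 < x \<and> x < l \<and> R (c 0) (c x) \<and> R (c x) (c l)"
  using assms(3-)
proof (induction l arbitrary: c rule: less_induct)
  case (less l)
  show ?case
  proof (cases "l = 2")
    case True
    then show ?thesis using less.prems(3) by (intro exI[of _ 1]) (auto simp: numeral_2_eq_2)
  next
    case False
    then have "3 \<le> l" using less.prems(1) by simp
    then obtain i j where ij: "i < j" "j \<le> l" "j \<noteq> Suc i" "\<not> (i = 0 \<and> j = l)" "R (c i) (c j)"
      using hole less.prems unfolding no_hole_def by blast
    \<comment> \<open>The chord bypasses \<open>s\<close> vertices, those strictly between its ends,
      and \<open>e\<close> skips exactly these.\<close>
    define s where "s = j - Suc i"
    define e where "e k = (if k \<le> i then k else k + s)" for k
    have s: "0 < s" "s < l - 1" using ij by (auto simp: s_def)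
    have e: "e k \<le> l" if "k \<le> l - s" for k using that ij by (auto simp: e_def s_def)
    have inje: "inj_on e {..l - s}" by (auto simp: inj_on_def e_def)
    have "\<exists>x. 0 < x \<and> x < l - s \<and> R ((c \<circ> e) 0) ((c \<circ> e) x) \<and> R ((c \<circ> e) x) ((c \<circ> e) (l - s))"
    proof (rule less.IH)
      show "l - s < l" "2 \<le> l - s" using s by auto
      show "inj_on (c \<circ> e) {..l - s}"
        using inje e by (intro comp_inj_on inj_on_subset[OF less.prems(2)]) auto
      show "\<forall>k<l - s. R ((c \<circ> e) k) ((c \<circ> e) (Suc k))"
      proof (intro allI impI)
        fix k assume k: "k < l - s"
        consider "k < i" | "k = i" | "k > i" by linarith
        then show "R ((c \<circ> e) k) ((c \<circ> e) (Suc k))"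
        proof cases
          case 2
          then have "e (Suc k) = j" "e k = i" using ij by (auto simp: e_def s_def)
          then show ?thesis using ij by simp
        qed (use less.prems(3) k ij in \<open>auto simp: e_def\<close>)
      qed
      have "e (l - s) = l" using ij by (auto simp: e_def s_def)
      then show "R ((c \<circ> e) 0) ((c \<circ> e) (l - s))"
        using less.prems(4) by (simp add: e_def)
    qed
    then obtain x where x: "0 < x" "x < l - s" "R (c (e 0)) (c (e x))" "R (c (e x)) (c (e (l - s)))"
      by auto
    have "e (l - s) = l" "e 0 = 0" "0 < e x" "e x < l" using x ij by (auto simp: e_def s_def)
    then show ?thesis using x by (intro exI[of _ "e x"]) auto
  qed
qed

text \<open>The triangle over the edge that closes a new hole must have \<open>f\<close> as a side, since \<open>f\<close> is the only
  chord. So \<open>f\<close> cuts off a single vertex, and the rest of the hole is an old one unless it is a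
  triangle.\<close>

lemma no_hole_remove_edge:
  assumes hole: "no_hole R" and sym: "\<And>x y. R x y \<Longrightarrow> R y x"
    and R': "\<And>x y. R' x y \<longleftrightarrow> R x y \<and> {x, y} \<noteq> f"
    and square: "\<And>a c b d. f = {a, c} \<Longrightarrow> distinct [a, b, c, d] \<Longrightarrow> \<not> R b d \<Longrightarrow>
      R a b \<Longrightarrow> R b c \<Longrightarrow> R c d \<Longrightarrow> R d a \<Longrightarrow> False"
  shows "no_hole R'"
  unfolding no_hole_def
proof (rule notI, elim exE conjE)
  fix l :: nat and c
  assume l: "3 \<le> l" and inj: "inj_on c {..l}" and path: "\<forall>i<l. R' (c i) (c (Suc i))"
    and close: "R' (c 0) (c l)"
    and chordless: "\<forall>i j. i < j \<and> j \<le> l \<and> j \<noteq> Suc i \<and> \<not> (i = 0 \<and> j = l) \<longrightarrow> \<not> R' (c i) (c j)"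
  have path': "\<forall>i<l. R (c i) (c (Suc i))" and close': "R (c 0) (c l)"
    using path close by (auto simp: R')
  obtain x where x: "0 < x" "x < l" "R (c 0) (c x)" "R (c x) (c l)"
    using cycle_edge_in_triangle[OF hole sym _ inj path' close'] l by auto
  have chord: "{c i, c j} = f" if "i < j" "j \<le> l" "j \<noteq> Suc i" "\<not> (i = 0 \<and> j = l)" "R (c i) (c j)" for i j
    using chordless that by (auto simp: R')
  have neq: "c i \<noteq> c j" if "i \<noteq> j" "i \<le> l" "j \<le> l" for i j
    using that inj by (auto simp: inj_on_def)
  \<comment> \<open>A segment of the hole closed by \<open>f\<close> is chordless in
    \<open>R\<close>, because \<open>f\<close> is the only possible chord; so it is at most a
    triangle.\<close>
  have sub: "l' = 2 \<or> l' < 2"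
    if "inj_on (c \<circ> (+) k) {..l'}" "k + l' \<le> l" "l' < l" "R (c k) (c (k + l'))" "{c k, c (k + l')} = f" for k l'
  proof (rule ccontr)
    assume "\<not> ?thesis"
    then have l': "3 \<le> l'" by simp
    have "\<not> R (c (k + i)) (c (k + j))" if ij: "i < j" "j \<le> l'" "j \<noteq> Suc i" "\<not> (i = 0 \<and> j = l')" for i j
    proof
      assume "R (c (k + i)) (c (k + j))"
      then have "{c (k + i), c (k + j)} = {c k, c (k + l')}"
        using chord[of "k + i" "k + j"] that ij \<open>k + l' \<le> l\<close> \<open>l' < l\<close> \<open>{c k, c (k + l')} = f\<close> by auto
      then show False
        using neq[of "k + i" k] neq[of "k + j" "k + l'"] neq[of "k + i" "k + l'"] ij \<open>k + l' \<le> l\<close>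
        by (auto simp: doubleton_eq_iff)
    qed
    then show False
      using hole that l' path' unfolding no_hole_def
      by (elim notE) (intro exI[of _ l'] exI[of _ "c \<circ> (+) k"], auto)
  qed
  have "(x = 1 \<and> {c 1, c l} = f) \<or> (x = l - 1 \<and> {c 0, c (l - 1)} = f)"
  proof (cases "x = 1")
    case True
    then show ?thesis using chord[of 1 l] x l by auto
  next
    case False
    then have "{c 0, c x} = f" using chord[of 0 x] x by auto
    moreover have "x = l - 1"
    proof (rule ccontr)
      assume "x \<noteq> l - 1"
      then have "{c x, c l} = f" using chord[of x l] x by auto
      then show False
        using \<open>{c 0, c x} = f\<close> neq[of 0 l] neq[of 0 x] x by (auto simp: doubleton_eq_iff)
    qed
    ultimately show ?thesis by simp
  qed
  then show False
  proof
    assume f: "x = 1 \<and> {c 1, c l} = f"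
    have "inj_on (c \<circ> (+) 1) {..l - 1}"
      using l by (intro comp_inj_on inj_on_subset[OF inj]) auto
    from sub[OF this] f x l have l3: "l = 3" by auto
    \<comment> \<open>What is left is a four-cycle with diagonal \<open>f\<close> whose other
      diagonal is missing in \<open>R\<close>, the configuration excluded by
      \<open>square\<close>.\<close>
    have "\<not> R (c 2) (c 0)"
      using chord[of 0 2] sym[of "c 2" "c 0"] f l3 neq[of 0 1] neq[of 0 3] by (auto simp: doubleton_eq_iff)
    moreover have "R (c 1) (c 2)" "R (c 2) (c 3)" "R (c 0) (c 1)"
      using path' l3 by (simp_all add: numeral_2_eq_2 numeral_3_eq_3)
    moreover have "distinct [c 1, c 2, c 3, c 0]"
      using neq l3 by auto
    moreover have "R (c 3) (c 0)" using sym[OF close'] l3 by simp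
    ultimately show False using square[of "c 1" "c 3" "c 2" "c 0"] f l3 by blast
  next
    assume f: "x = l - 1 \<and> {c 0, c (l - 1)} = f"
    have "inj_on (c \<circ> (+) 0) {..l - 1}"
      using inj_on_subset[OF inj, of "{..l - 1}"] by (auto simp: comp_def)
    from sub[OF this] f x l have "l - 1 = 2" by auto
    then have l3: "l = 3" by simp
    have "\<not> R (c 1) (c 3)"
      using chord[of 1 3] f l3 neq[of 0 1] neq[of 0 3] by (auto simp: doubleton_eq_iff)
    moreover have "R (c 0) (c 1)" "R (c 1) (c 2)" "R (c 2) (c 3)"
      using path' l3 by (simp_all add: numeral_2_eq_2 numeral_3_eq_3)
    moreover have "distinct [c 0, c 1, c 2, c 3]"
      using neq l3 by auto
    moreover have "R (c 3) (c 0)" using sym[OF close'] l3 by simp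
    moreover have "f = {c 0, c 2}" using f l3 by (simp add: numeral_2_eq_2)
    ultimately show False using square[of "c 0" "c 2" "c 1" "c 3"] by blast
  qed
qed

section \<open>Edge ideals with linear quotients\<close>

definition elcm :: "'v expo \<Rightarrow> 'v expo \<Rightarrow> 'v expo" where
  "elcm a b = a + (b - a)"

lemma lookup_elcm [simp]: "lookup (elcm a b) v = max (lookup a v) (lookup b v)"
  by (simp add: elcm_def lookup_add lookup_minus)

lemma adds_elcm_self [simp]: "a adds elcm a b" "b adds elcm a b"
  by (simp_all add: adds_def)

text \<open>Equivalently, \<open>a\<close> divided by its greatest common divisor with
  \<open>b\<close> is neither 1 nor a variable: passing from \<open>b\<close> to \<open>a\<close> is
  not a linear step.\<close>

definition far :: "'v expo \<Rightarrow> 'v expo \<Rightarrow> bool" where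
  "far a b \<longleftrightarrow> (\<forall>v. \<not> a adds b + expo_var v)"

lemma farI2:
  assumes "v \<noteq> w" "lookup b v < lookup a v" "lookup b w < lookup a w"
  shows "far a b"
  unfolding far_def adds_def
proof (intro allI notI)
  fix x assume "\<forall>v. lookup a v \<le> lookup (b + expo_var x) v"
  from this[rule_format, of v] this[rule_format, of w] assms show False
    by (auto simp: lookup_add lookup_single when_def split: if_splits)
qed

lemma farI1:
  assumes "lookup b v + 1 < lookup a v"
  shows "far a b"
  unfolding far_def adds_def
proof (intro allI notI)
  fix x assume "\<forall>v. lookup a v \<le> lookup (b + expo_var x) v"
  from this[rule_format, of v] assms show False
    by (auto simp: lookup_add lookup_single when_def split: if_splits)
qed

lemma far_irrefl: "far a b \<Longrightarrow> a \<noteq> b"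
  unfolding far_def using adds_add(1) by blast

lemma keys_add_eq: "keys (a + b :: 'v expo) = keys a \<union> keys b"
  by (auto simp: in_keys_iff lookup_add)

lemma keys_elcm: "keys (elcm a b) = keys a \<union> keys b"
  by (auto simp: in_keys_iff max_def split: if_splits)

section \<open>Linear steps within a least common multiple\<close>

lemma lq_list_step:
  assumes "lq_list us" "i < length us" "j < i"
  obtains k v where "k < i" "us ! k adds us ! i + expo_var v" "lookup (us ! i) v < lookup (us ! j) v"
  using assms unfolding lq_list_def lq_vars_def by blast

text \<open>The gained variable \<open>v\<close> has a higher exponent in \<open>w\<close> than in
  \<open>u\<close>, so \<open>u\<close> times \<open>v\<close> still divides the least common
  multiple.\<close>

lemma adds_elcm_step:
  assumes "x adds u + expo_var v" "lookup u v < lookup w v"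
  shows "x adds elcm u w"
proof -
  have "lookup x z \<le> max (lookup u z) (lookup w z)" for z
    using assms(1)[unfolded adds_def, rule_format, of z] assms(2)
    by (auto simp: lookup_add lookup_single when_def split: if_splits)
  then show ?thesis by (simp add: adds_def)
qed

lemma elcm_adds_iff: "elcm a b adds c \<longleftrightarrow> a adds c \<and> b adds c"
  by (auto simp: adds_def)

text \<open>Induction on the larger of two positions. The later generator has a linear step to an
  earlier one within the least common multiple: either this step crosses the boundary of
  \<open>C\<close>, or it replaces the later generator by an earlier one on the same side.\<close>

lemma lq_list_cross:
  assumes lq: "lq_list us" and "p \<in> set us" "q \<in> set us" "C p" "\<not> C q"
  obtains x y where "x \<in> set us" "y \<in> set us" "x adds elcm p q" "y adds elcm p q" "C x" "\<not> C y"
    "\<not> far x y \<or> \<not> far y x"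
proof -
  have main: "\<exists>x\<in>set us. \<exists>y\<in>set us. x adds elcm (us ! i) (us ! j) \<and>
      y adds elcm (us ! i) (us ! j) \<and> C x \<noteq> C y \<and> \<not> far x y"
    if "max i j < n" "i < length us" "j < length us" "C (us ! i) \<noteq> C (us ! j)" for i j n
    using that
  proof (induction n arbitrary: i j)
    case (Suc n)
    have step: "\<exists>x\<in>set us. \<exists>y\<in>set us. x adds elcm (us ! i) (us ! j) \<and>
        y adds elcm (us ! i) (us ! j) \<and> C x \<noteq> C y \<and> \<not> far x y"
      if ij: "j < i" "i < length us" "C (us ! i) \<noteq> C (us ! j)" "i < Suc n" for i j
    proof -
      obtain k v where k: "k < i" "us ! k adds us ! i + expo_var v" "lookup (us ! i) v < lookup (us ! j) v"
        using lq_list_step[OF lq ij(2,1)] .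
      have ka: "us ! k adds elcm (us ! i) (us ! j)" using k(2,3) by (rule adds_elcm_step)
      show ?thesis
      proof (cases "C (us ! k) = C (us ! i)")
        case False
        then show ?thesis
          using k ka ij by (intro bexI[of _ "us ! k"] bexI[of _ "us ! i"]) (auto simp: far_def)
      next
        case True
        have "max k j < n" "k < length us" "j < length us" "C (us ! k) \<noteq> C (us ! j)"
          using ij k True by auto
        from Suc.IH[OF this] obtain x y where xy: "x \<in> set us" "y \<in> set us"
          "x adds elcm (us ! k) (us ! j)" "y adds elcm (us ! k) (us ! j)" "C x \<noteq> C y" "\<not> far x y"
          by blast
        have "elcm (us ! k) (us ! j) adds elcm (us ! i) (us ! j)"
          using ka by (simp add: elcm_adds_iff)
        from adds_trans[OF xy(3) this] adds_trans[OF xy(4) this] show ?thesis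
          using xy by blast
      qed
    qed
    consider "i = j" | "j < i" | "i < j" by linarith
    then show ?case
    proof cases
      case 3
      have "elcm (us ! j) (us ! i) = elcm (us ! i) (us ! j)"
        by (rule poly_mapping_eqI) (simp add: max.commute)
      then show ?thesis using step[of i j] 3 Suc.prems by auto
    qed (use step[of j i] Suc.prems in auto)
  qed simp
  obtain i j where "i < length us" "us ! i = p" "j < length us" "us ! j = q"
    using assms by (auto simp: in_set_conv_nth)
  then obtain x y where "x \<in> set us" "y \<in> set us" "x adds elcm p q" "y adds elcm p q"
    "C x \<noteq> C y" "\<not> far x y"
    using main[of i j "Suc (max i j)"] assms by auto
  then show ?thesis using that[of x y] that[of y x] by (cases "C x") auto
qed

text \<open>Whichever of \<open>p\<close> and \<open>q\<close> comes later has a linear step to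
  another generator within the least common multiple, but every candidate is far from it.\<close>

lemma lq_list_far_pair:
  assumes lq: "lq_list us" and "p \<in> set us" "q \<in> set us" "p \<noteq> q"
    and far: "\<And>x. x \<in> set us \<Longrightarrow> x adds elcm p q \<Longrightarrow> (x \<noteq> p \<longrightarrow> far x p) \<and> (x \<noteq> q \<longrightarrow> far x q)"
  shows False
proof -
  have *: False if ij: "j < i" "i < length us" "us ! i = a" "us ! j = b"
    and far: "\<And>x. x \<in> set us \<Longrightarrow> x adds elcm a b \<Longrightarrow> x \<noteq> a \<Longrightarrow> far x a" for i j a b
  proof -
    obtain k v where k: "k < i" "us ! k adds us ! i + expo_var v" "lookup (us ! i) v < lookup (us ! j) v"
      using lq_list_step[OF lq ij(2,1)] .
    have "us ! k adds elcm a b" using k(2,3) ij by (metis adds_elcm_step)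
    moreover have "us ! k \<noteq> us ! i"
      using lq k(1) ij(2) by (simp add: lq_list_def nth_eq_iff_index_eq)
    ultimately show False using far[of "us ! k"] k ij by (auto simp: far_def)
  qed
  obtain i j where ij: "i < length us" "us ! i = p" "j < length us" "us ! j = q"
    using assms by (auto simp: in_set_conv_nth)
  have comm: "elcm q p = elcm p q"
    by (rule poly_mapping_eqI) (simp add: max.commute)
  consider "i = j" | "j < i" | "i < j" by linarith
  then show False
  proof cases
    case 1
    then show False using ij assms by simp
  next
    case 2
    then show False using *[of j i p q] ij far by blast
  next
    case 3
    then show False using *[of i j q p] ij far comm by metis
  qed
qed

section \<open>Generators indexed by edges and their positions in the order\<close>

definition arc_expo :: "'v wograph \<Rightarrow> 'v \<times> 'v \<Rightarrow> 'v expo" where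
  "arc_expo D = (\<lambda>(x, y). expo_var x + Poly_Mapping.single y (weight D y))"

lemma keys_arc_expo:
  assumes D: "weighted_oriented_graph D" and xy: "(x, y) \<in> warcs D"
  shows "keys (arc_expo D (x, y)) = {x, y}"
proof -
  have "0 < weight D y" using D xy by (force simp: weighted_oriented_graph_def)
  then show ?thesis by (auto simp: arc_expo_def keys_add_eq)
qed

definition adj :: "'v wograph \<Rightarrow> 'v \<Rightarrow> 'v \<Rightarrow> bool" where
  "adj D x y \<longleftrightarrow> (x, y) \<in> warcs D \<or> (y, x) \<in> warcs D"

definition edge_expo :: "'v wograph \<Rightarrow> 'v \<Rightarrow> 'v \<Rightarrow> 'v expo" where
  "edge_expo D x y = (if (x, y) \<in> warcs D then arc_expo D (x, y) else arc_expo D (y, x))"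

definition rank :: "'v wograph \<Rightarrow> 'v expo list \<Rightarrow> 'v \<Rightarrow> 'v \<Rightarrow> nat" where
  "rank D us x y = (THE i. i < length us \<and> us ! i = edge_expo D x y)"

locale edge_order =
  fixes D :: "'v::finite wograph" and us :: "'v expo list"
  assumes wog: "weighted_oriented_graph D"
    and lq: "lq_list us"
    and set_us: "set us = arc_expo D ` warcs D"
begin

abbreviation A :: "'v \<Rightarrow> 'v \<Rightarrow> bool" where "A \<equiv> adj D"
abbreviation ex :: "'v \<Rightarrow> 'v \<Rightarrow> 'v expo" where "ex \<equiv> edge_expo D"
abbreviation r :: "'v \<Rightarrow> 'v \<Rightarrow> nat" where "r \<equiv> rank D us"

lemma adj_sym: "A x y \<longleftrightarrow> A y x"
  by (auto simp: adj_def)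

lemma adj_irrefl: "\<not> A x x"
  using wog by (auto simp: adj_def weighted_oriented_graph_def)

lemma edge_expo_sym: "ex x y = ex y x" if "A x y"
  using that wog by (auto simp: edge_expo_def adj_def weighted_oriented_graph_def)

lemma rank_sym: "r x y = r y x" if "A x y"
  using edge_expo_sym[OF that] by (simp add: rank_def)

lemma keys_edge_expo: "A x y \<Longrightarrow> keys (ex x y) = {x, y}"
  by (auto simp: edge_expo_def adj_def keys_arc_expo[OF wog])

lemma edge_expo_mem: "A x y \<Longrightarrow> ex x y \<in> set us"
  by (auto simp: set_us edge_expo_def adj_def)

lemma mem_set_us: "u \<in> set us \<Longrightarrow> \<exists>x y. A x y \<and> u = ex x y"
  by (force simp: set_us edge_expo_def adj_def)

lemma edge_expo_inject:
  assumes "A a b" "A c d" "keys (ex a b) = keys (ex c d)"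
  shows "ex a b = ex c d"
proof -
  have "{a, b} = {c, d}" using assms by (simp add: keys_edge_expo)
  then show ?thesis using edge_expo_sym[OF assms(1)] by (auto simp: doubleton_eq_iff)
qed

lemma set_us_inject: "u \<in> set us \<Longrightarrow> w \<in> set us \<Longrightarrow> keys u = keys w \<Longrightarrow> u = w"
  using mem_set_us edge_expo_inject by metis

lemma card_keys_us: "u \<in> set us \<Longrightarrow> card (keys u) = 2"
  using mem_set_us[of u] keys_edge_expo adj_irrefl by (metis card_2_iff)

lemma
  assumes "A x y"
  shows rank_less: "r x y < length us" and nth_rank: "us ! r x y = ex x y"
proof -
  have "\<exists>!i. i < length us \<and> us ! i = ex x y"
    using edge_expo_mem[OF assms] lq distinct_Ex1[of us "ex x y"] by (auto simp: lq_list_def)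
  from theI'[OF this] show "r x y < length us" "us ! r x y = ex x y"
    by (simp_all add: rank_def)
qed

lemma index_eq_rank:
  assumes "i < length us"
  obtains x y where "A x y" "i = r x y" "us ! i = ex x y"
proof -
  obtain x y where xy: "A x y" "us ! i = ex x y" using mem_set_us[OF nth_mem[OF assms]] by blast
  then have "i = r x y"
    using rank_less[OF xy(1)] nth_rank[OF xy(1)] assms lq nth_eq_iff_index_eq[of us i "r x y"]
    by (simp add: lq_list_def)
  then show ?thesis using that xy by blast
qed

lemma rank_eq_iff: "A a b \<Longrightarrow> A c d \<Longrightarrow> r a b = r c d \<longleftrightarrow> {a, b} = {c, d}"
  by (metis doubleton_eq_iff keys_edge_expo nth_rank rank_sym)

text \<open>If \<open>v\<close> were on the edge, the earlier generator dividing
  \<open>us ! i\<close> times \<open>v\<close> would have the same two-vertex support, and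
  generators with equal supports are equal because each edge has one orientation.\<close>

lemma lq_vars_disjoint:
  assumes i: "i < length us" and v: "v \<in> lq_vars us i"
  shows "v \<notin> keys (us ! i)"
proof
  assume vk: "v \<in> keys (us ! i)"
  obtain k where k: "k < i" "us ! k adds us ! i + expo_var v" using v by (auto simp: lq_vars_def)
  from adds_keys_mono[OF k(2)] have "keys (us ! k) \<subseteq> keys (us ! i)"
    using vk by (auto simp: keys_add_eq split: if_splits)
  moreover have "card (keys (us ! k)) = 2" "card (keys (us ! i)) = 2"
    using k i by (auto intro!: card_keys_us nth_mem)
  ultimately have "keys (us ! k) = keys (us ! i)" by (intro card_subset_eq) auto
  then have "us ! k = us ! i" using k i by (intro set_us_inject) auto
  then show False using k i lq by (simp add: lq_list_def nth_eq_iff_index_eq)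
qed

lemma mem_lq_varsE:
  assumes ab: "A a b" and v: "v \<in> lq_vars us (r a b)"
  obtains x where "x \<in> {a, b}" "A v x" "r v x < r a b" "ex v x adds ex a b + expo_var v" "v \<notin> {a, b}"
proof -
  have v': "v \<notin> {a, b}"
    using lq_vars_disjoint[OF rank_less[OF ab] v] by (simp add: nth_rank ab keys_edge_expo)
  obtain k where k: "k < r a b" "us ! k adds ex a b + expo_var v"
    using v ab by (auto simp: lq_vars_def nth_rank)
  have kl: "k < length us" using k rank_less[OF ab] by simp
  obtain x y where xy: "A x y" "k = r x y" "us ! k = ex x y" using index_eq_rank[OF kl] .
  have "{x, y} \<subseteq> insert v {a, b}"
    using adds_keys_mono[OF k(2)] xy ab by (auto simp: keys_add_eq keys_edge_expo split: if_splits)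
  moreover have "{x, y} \<noteq> {a, b}" using k xy rank_eq_iff[OF xy(1) ab] by auto
  moreover have "x \<noteq> y" "a \<noteq> b" using xy(1) ab adj_irrefl by auto
  ultimately have "x = v \<and> y \<in> {a, b} \<or> y = v \<and> x \<in> {a, b}" by blast
  then show ?thesis
  proof
    assume "x = v \<and> y \<in> {a, b}"
    then show ?thesis using that[of y] xy k v' by auto
  next
    assume yv: "y = v \<and> x \<in> {a, b}"
    then have "A v x" "r v x = k" "ex v x = us ! k"
      using xy adj_sym rank_sym[OF xy(1)] edge_expo_sym[OF xy(1)] by auto
    then show ?thesis using that[of x] yv k v' by auto
  qed
qed

lemma earlier_edge:
  assumes ab: "A a b" and cd: "A c d" and less: "r c d < r a b"
  obtains v where "v \<in> {c, d}" "v \<in> lq_vars us (r a b)"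
proof -
  obtain v where v: "v \<in> lq_vars us (r a b)" "lookup (ex a b) v < lookup (ex c d) v"
    using lq rank_less[OF ab] less unfolding lq_list_def by (metis ab cd nth_rank)
  then have "v \<in> keys (ex c d)" by (auto simp: in_keys_iff)
  then show ?thesis using that[of v] v cd by (simp add: keys_edge_expo)
qed

text \<open>The earlier edge \<open>vx\<close> yields a colon variable among \<open>v\<close> and
  \<open>x\<close>, and \<open>x\<close> is impossible since it lies on \<open>ab\<close>. This
  holds for all weights, even if the generator of \<open>vx\<close> does not divide that of
  \<open>ab\<close> times \<open>v\<close>.\<close>

lemma lq_varsI:
  assumes "A a b" "A v x" "x \<in> {a, b}" "v \<notin> {a, b}" "r v x < r a b"
  shows "v \<in> lq_vars us (r a b)"
proof -
  obtain w where w: "w \<in> {v, x}" "w \<in> lq_vars us (r a b)"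
    using earlier_edge[OF assms(1,2,5)] .
  then have "w \<notin> {a, b}" using mem_lq_varsE[OF assms(1)] by metis
  then show ?thesis using w assms by auto
qed

text \<open>The later of two disjoint edges has a colon variable on the earlier one, hence an edge
  to it that precedes the later edge.\<close>

lemma disjoint_edges:
  assumes ab: "A a b" and cd: "A c d" and "{a, b} \<inter> {c, d} = {}"
  obtains x y where "x \<in> {a, b}" "y \<in> {c, d}" "A x y" "r x y < max (r a b) (r c d)"
proof -
  have *: "\<exists>x\<in>{a, b}. \<exists>y\<in>{c, d}. A x y \<and> r x y < r a b"
    if edges: "A a b" "A c d" "r c d < r a b" for a b c d
  proof -
    obtain v where v: "v \<in> {c, d}" "v \<in> lq_vars us (r a b)" using earlier_edge[OF edges] .
    obtain x where "x \<in> {a, b}" "A v x" "r v x < r a b" using mem_lq_varsE[OF edges(1) v(2)] by metis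
    then show ?thesis using v(1) adj_sym rank_sym by metis
  qed
  have "{a, b} \<noteq> {c, d}" using assms(3) by auto
  then have "r a b \<noteq> r c d" using rank_eq_iff ab cd by simp
  then consider "r a b < r c d" | "r c d < r a b" by linarith
  then show ?thesis
  proof cases
    case 1
    then obtain x y where "x \<in> {c, d}" "y \<in> {a, b}" "A x y" "r x y < r c d" using *[OF cd ab] by blast
    then show ?thesis using that[of y x] 1 adj_sym rank_sym by (metis max.commute max.strict_order_iff max_less_iff_conj)
  next
    case 2
    then obtain x y where "x \<in> {a, b}" "y \<in> {c, d}" "A x y" "r x y < r a b" using *[OF ab cd] by blast
    then show ?thesis using that[of x y] by simp
  qed
qed

text \<open>Adjacency in the complement of the graph of the first \<open>t\<close> edges. Each
  vertex is also related to itself, which does not affect holes since their vertices are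
  distinct.\<close>

definition late :: "nat \<Rightarrow> 'v \<Rightarrow> 'v \<Rightarrow> bool" where
  "late t x y \<longleftrightarrow> \<not> (A x y \<and> r x y < t)"

lemma late_sym: "late t x y \<Longrightarrow> late t y x"
  unfolding late_def using adj_sym rank_sym by metis

text \<open>Induction from the complete graph at \<open>t = 0\<close>. If the next edge opened a
  square, the two diagonals of the square would be disjoint edges already present with no present
  edge between them, against \<open>disjoint_edges\<close>.\<close>

lemma no_hole_late: "no_hole (late t)"
proof (induction t)
  case 0
  show ?case
    unfolding no_hole_def late_def
    by (rule notI, elim exE conjE, drule spec[of _ 0], drule spec[of _ 2]) auto
next
  case (Suc t)
  \<comment> \<open>Past the end of the list nothing is removed, as no \<open>{x, y}\<close> is
    empty.\<close>
  define f where "f = (if t < length us then keys (us ! t) else {})"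
  show ?case
  proof (rule no_hole_remove_edge[OF Suc late_sym])
    fix x y
    show "late (Suc t) x y \<longleftrightarrow> late t x y \<and> {x, y} \<noteq> f"
    proof (cases "A x y")
      case True
      have "r x y = t \<longleftrightarrow> {x, y} = f"
      proof
        assume "r x y = t"
        then show "{x, y} = f" using True rank_less[OF True] nth_rank[OF True] by (auto simp: f_def keys_edge_expo)
      next
        assume *: "{x, y} = f"
        then have t: "t < length us" by (auto simp: f_def split: if_splits)
        obtain a b where "A a b" "t = r a b" "us ! t = ex a b" using index_eq_rank[OF t] .
        then show "r x y = t" using * True rank_eq_iff t by (simp add: f_def keys_edge_expo)
      qed
      then show ?thesis using True by (auto simp: late_def)
    next
      case False
      have "{x, y} \<noteq> f"
      proof
        assume *: "{x, y} = f"
        then have t: "t < length us" by (auto simp: f_def split: if_splits)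
        obtain a b where "A a b" "us ! t = ex a b" using index_eq_rank[OF t] .
        then show False using * t False adj_sym by (auto simp: f_def keys_edge_expo doubleton_eq_iff)
      qed
      then show ?thesis using False by (auto simp: late_def)
    qed
  next
    fix a c b d
    assume f: "f = {a, c}" and dist: "distinct [a, b, c, d]" and bd: "\<not> late t b d"
      and sq: "late t a b" "late t b c" "late t c d" "late t d a"
    then have t: "t < length us" by (auto simp: f_def split: if_splits)
    obtain x y where xy: "A x y" "t = r x y" "us ! t = ex x y" using index_eq_rank[OF t] .
    have "{x, y} = {a, c}" using f xy t by (simp add: f_def keys_edge_expo)
    then have ac: "A a c" "r a c = t" using xy adj_sym rank_sym by (auto simp: doubleton_eq_iff)
    have bd': "A b d" "r b d < t" using bd by (auto simp: late_def)
    obtain z w where zw: "z \<in> {a, c}" "w \<in> {b, d}" "A z w" "r z w < max (r a c) (r b d)"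
      using disjoint_edges[OF ac(1) bd'(1)] dist by auto
    then have "\<not> late t z w" using ac bd' by (simp add: late_def)
    then show False using zw(1,2) sq late_sym by blast
  qed
qed

lemma late_triangle:
  assumes "2 \<le> l" "inj_on c {..l::nat}" "\<forall>i<l. late t (c i) (c (Suc i))" "late t (c 0) (c l)"
  obtains x where "0 < x" "x < l" "late t (c 0) (c x)" "late t (c x) (c l)"
  using cycle_edge_in_triangle[OF no_hole_late late_sym assms] by blast

end

section \<open>Forbidden patterns\<close>

lemma lookup_esum: "lookup (esum T) v = (if v \<in> T then 1 else 0)" for T :: "'v::finite set"
  by (simp add: esum_def lookup_sum lookup_single when_def)

lemma keys_esum: "keys (esum T) = T" for T :: "'v::finite set"
  by (auto simp: in_keys_iff lookup_esum split: if_splits)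

lemma lookup_arc_expo:
  "lookup (arc_expo D (x, y)) z = (if z = x then 1 else 0) + (if z = y then weight D y else 0)"
  by (auto simp: arc_expo_def lookup_add lookup_single when_def)

lemma has_inducedE:
  assumes ind: "has_induced G H" and H: "\<And>e. e \<in> uedges H \<Longrightarrow> e \<subseteq> uverts H"
  obtains f where "inj_on f (uverts H)" "f ` uverts H \<subseteq> uverts G"
    "\<And>x y. x \<in> uverts H \<Longrightarrow> y \<in> uverts H \<Longrightarrow> {f x, f y} \<in> uedges G \<longleftrightarrow> {x, y} \<in> uedges H"
proof -
  obtain S f where S: "S \<subseteq> uverts G" and f: "inj_on f (uverts H)" "f ` uverts H = S"
    and e: "uedges (induced_ugraph G S) = (\<lambda>e. f ` e) ` uedges H"
    using ind unfolding has_induced_def ugraph_iso_def by (auto simp: induced_ugraph_def bij_betw_def)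
  have "{f x, f y} \<in> uedges G \<longleftrightarrow> {x, y} \<in> uedges H" if xy: "x \<in> uverts H" "y \<in> uverts H" for x y
  proof -
    have "{f x, f y} \<in> uedges G \<longleftrightarrow> {f x, f y} \<in> uedges (induced_ugraph G S)"
      using xy f by (auto simp: induced_ugraph_def)
    also have "\<dots> \<longleftrightarrow> (\<exists>e\<in>uedges H. f ` {x, y} = f ` e)"
      unfolding e by auto
    also have "\<dots> \<longleftrightarrow> (\<exists>e\<in>uedges H. {x, y} = e)"
      using inj_on_image_eq_iff[OF f(1), of "{x, y}"] H xy by (intro bex_cong refl) simp
    finally show ?thesis by simp
  qed
  then show ?thesis using that S f by blast
qed

lemma mem_underlying_graph: "{x, y} \<in> uedges (underlying_graph D) \<longleftrightarrow> adj D x y"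
  by (auto simp: underlying_graph_def adj_def doubleton_eq_iff)

lemmas lookup_simps = lookup_arc_expo lookup_add lookup_single when_def

context edge_order
begin

abbreviation arc :: "'v \<times> 'v \<Rightarrow> 'v expo" where "arc \<equiv> arc_expo D"

text \<open>The degrees in position \<open>k\<close> of the explicit resolution: generators,
  possibly redundant, of the \<open>k\<close>-th homological shift ideal.\<close>

definition U :: "nat \<Rightarrow> 'v expo set" where
  "U k = {us ! i + esum T | i T. i < length us \<and> T \<subseteq> lq_vars us i \<and> card T = k}"

lemma mem_U_iff:
  "x \<in> U k \<longleftrightarrow> (\<exists>a b T. A a b \<and> x = ex a b + esum T \<and> T \<subseteq> lq_vars us (r a b) \<and> card T = k)"
proof
  assume "x \<in> U k"
  then obtain i T where iT: "x = us ! i + esum T" "i < length us" "T \<subseteq> lq_vars us i" "card T = k"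
    by (auto simp: U_def)
  obtain a b where "A a b" "i = r a b" "us ! i = ex a b" using index_eq_rank[OF iT(2)] .
  then show "\<exists>a b T. A a b \<and> x = ex a b + esum T \<and> T \<subseteq> lq_vars us (r a b) \<and> card T = k"
    using iT by (intro exI[of _ a] exI[of _ b] exI[of _ T]) simp
next
  assume "\<exists>a b T. A a b \<and> x = ex a b + esum T \<and> T \<subseteq> lq_vars us (r a b) \<and> card T = k"
  then obtain a b T where "A a b" "x = ex a b + esum T" "T \<subseteq> lq_vars us (r a b)" "card T = k"
    by blast
  then show "x \<in> U k"
    unfolding U_def using rank_less nth_rank by (intro CollectI exI[of _ "r a b"] exI[of _ T]) auto
qed

lemma us_within:
  assumes "u \<in> set us" "keys u \<subseteq> S"
  obtains x y where "(x, y) \<in> warcs D" "x \<in> S" "y \<in> S" "u = arc (x, y)"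
proof -
  obtain x y where xy: "(x, y) \<in> warcs D" "u = arc (x, y)" using assms(1) by (auto simp: set_us)
  then show ?thesis using that keys_arc_expo[OF wog xy(1)] assms(2) by auto
qed

lemma arc_expo_mem: "(x, y) \<in> warcs D \<Longrightarrow> arc (x, y) \<in> set us"
  by (auto simp: set_us)

text \<open>A least common multiple of two generators of a pattern is supported on its vertices, so
  only arcs of the pattern divide it. This confines the analysis to the induced subgraph.\<close>

lemma us_within_elcm:
  assumes arcs: "{(x, y) \<in> warcs D. x \<in> S \<and> y \<in> S} = W"
    and p: "p \<in> arc ` W" and q: "q \<in> arc ` W"
    and x: "x \<in> set us" "x adds elcm p q"
  shows "x \<in> arc ` W"
proof -
  have keysW: "keys w \<subseteq> S" if "w \<in> arc ` W" for w
    using that keys_arc_expo[OF wog] unfolding arcs[symmetric] by auto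
  have "keys x \<subseteq> S"
    using adds_keys_mono[OF x(2)] keysW[OF p] keysW[OF q] by (auto simp: keys_elcm)
  then obtain y z where "(y, z) \<in> warcs D" "y \<in> S" "z \<in> S" "x = arc (y, z)"
    by (rule us_within[OF x(1)])
  then show ?thesis unfolding arcs[symmetric] by auto
qed

lemma far_pair_pattern:
  assumes arcs: "{(x, y) \<in> warcs D. x \<in> S \<and> y \<in> S} = W"
    and "P \<in> W" "Q \<in> W" "arc P \<noteq> arc Q"
    and "\<And>x. x \<in> W \<Longrightarrow> x \<noteq> P \<Longrightarrow> far (arc x) (arc P)"
    and "\<And>x. x \<in> W \<Longrightarrow> x \<noteq> Q \<Longrightarrow> far (arc x) (arc Q)"
  shows False
proof (rule lq_list_far_pair[OF lq])
  show "arc P \<in> set us" "arc Q \<in> set us"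
    using assms(1-3) by (auto simp: set_us)
  fix x assume x: "x \<in> set us" "x adds elcm (arc P) (arc Q)"
  then obtain y where "y \<in> W" "x = arc y"
    using us_within_elcm[OF arcs _ _ x] assms(2,3) by blast
  then show "(x \<noteq> arc P \<longrightarrow> far x (arc P)) \<and> (x \<noteq> arc Q \<longrightarrow> far x (arc Q))"
    using assms(5,6) by metis
qed (use assms in simp)

lemma induced_arcs:
  "warcs (induced_wograph D S) = {(x, y) \<in> warcs D. x \<in> S \<and> y \<in> S}"
  by (simp add: induced_wograph_def)

lemma weight_induced: "weight (induced_wograph D S) = weight D"
  by (simp add: induced_wograph_def)

lemma D1_free: "pattern_free is_D1 D"
  unfolding pattern_free_def is_D1_def
proof clarify
  fix S x1 x2 x3
  assume H: "distinct [x1, x2, x3]" "warcs (induced_wograph D S) = {(x1, x2), (x2, x3)}"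
    "weight (induced_wograph D S) x2 > 1" "weight (induced_wograph D S) x3 > 1"
  note w = H(3,4)[unfolded weight_induced]
  have "far (arc (x1, x2)) (arc (x2, x3))"
    using w H(1) by (intro farI2[of x1 x2]) (auto simp: lookup_simps)
  moreover have "far (arc (x2, x3)) (arc (x1, x2))"
    using w H(1) by (intro farI1[of _ x3]) (auto simp: lookup_simps)
  ultimately show False
    using far_irrefl
    by (intro far_pair_pattern[OF H(2)[unfolded induced_arcs], of "(x1, x2)" "(x2, x3)"]) auto
qed

lemma D2_free: "pattern_free is_D2 D"
  unfolding pattern_free_def is_D2_def
proof clarify
  fix S x1 x2 x3
  assume H: "distinct [x1, x2, x3]" "warcs (induced_wograph D S) = {(x2, x1), (x2, x3)}"
    "weight (induced_wograph D S) x1 > 1" "weight (induced_wograph D S) x3 > 1"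
  note w = H(3,4)[unfolded weight_induced]
  have "far (arc (x2, x1)) (arc (x2, x3))"
    using w H(1) by (intro farI1[of _ x1]) (auto simp: lookup_simps)
  moreover have "far (arc (x2, x3)) (arc (x2, x1))"
    using w H(1) by (intro farI1[of _ x3]) (auto simp: lookup_simps)
  ultimately show False
    using far_irrefl
    by (intro far_pair_pattern[OF H(2)[unfolded induced_arcs], of "(x2, x1)" "(x2, x3)"]) auto
qed

lemma D3_free: "pattern_free is_D3 D"
  unfolding pattern_free_def is_D3_def
proof clarify
  fix S x1 x2 x3
  assume H: "distinct [x1, x2, x3]" "warcs (induced_wograph D S) = {(x1, x2), (x2, x3), (x3, x1)}"
    "weight (induced_wograph D S) x1 > 1" "weight (induced_wograph D S) x2 > 1"
    "weight (induced_wograph D S) x3 > 1"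
  note w = H(3-5)[unfolded weight_induced]
  have f: "far (arc (x1, x2)) (arc (x2, x3))"
    using w H(1) by (intro farI2[of x1 x2]) (auto simp: lookup_simps)
  moreover have "far (arc (x3, x1)) (arc (x2, x3))"
    using w H(1) by (intro farI1[of _ x1]) (auto simp: lookup_simps)
  moreover have "far (arc (x2, x3)) (arc (x1, x2))"
    using w H(1) by (intro farI1[of _ x3]) (auto simp: lookup_simps)
  moreover have "far (arc (x3, x1)) (arc (x1, x2))"
    using w H(1) by (intro farI2[of x1 x3]) (auto simp: lookup_simps)
  ultimately show False
    using far_irrefl[OF f]
    by (intro far_pair_pattern[OF H(2)[unfolded induced_arcs], of "(x1, x2)" "(x2, x3)"]) auto
qed

text \<open>The two arcs into \<open>x2\<close> are one linear step apart, so no isolated pair is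
  available for them; instead the arc \<open>p\<close> into \<open>x3\<close> is separated from
  both.\<close>

lemma D4_free: "pattern_free is_D4 D"
  unfolding pattern_free_def is_D4_def
proof clarify
  fix S x1 x2 x3
  assume H: "distinct [x1, x2, x3]" "warcs (induced_wograph D S) = {(x1, x2), (x3, x2), (x1, x3)}"
    "weight (induced_wograph D S) x2 > 1" "weight (induced_wograph D S) x3 > 1"
  note w = H(3,4)[unfolded weight_induced]
  define p where "p = arc (x1, x3)"
  define q where "q = arc (x1, x2)"
  define q' where "q' = arc (x3, x2)"
  have f: "far p q" "far p q'" "far q p" "far q' p"
    unfolding p_def q_def q'_def
    by (rule farI1[of _ x3] farI2[of x1 x3] farI1[of _ x2],
        use w H(1) in \<open>auto simp: lookup_simps\<close>)+
  have mem: "p \<in> set us" "q \<in> set us"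
    using H(2) unfolding induced_arcs p_def q_def by (auto intro: arc_expo_mem)
  obtain x y where xy: "x \<in> set us" "y \<in> set us" "x adds elcm p q" "y adds elcm p q" "x = p" "y \<noteq> p"
    "\<not> far x y \<or> \<not> far y x"
    using lq_list_cross[OF lq mem, of "\<lambda>x. x = p"] far_irrefl[OF f(1)] by blast
  have "y \<in> {q, q', p}"
    using us_within_elcm[OF H(2)[unfolded induced_arcs] _ _ xy(2,4)] by (simp add: p_def q_def q'_def)
  then show False using xy f by auto
qed

lemma D5_free: "pattern_free is_D5 D"
  unfolding pattern_free_def is_D5_def
proof clarify
  fix S x1 x2 x3 x4
  assume H: "distinct [x1, x2, x3, x4]" "warcs (induced_wograph D S) = {(x1, x2), (x2, x3), (x3, x4)}"
    "weight (induced_wograph D S) x2 = 1" "weight (induced_wograph D S) x3 > 1"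
    "weight (induced_wograph D S) x4 = 1"
  note w = H(3-5)[unfolded weight_induced]
  have f: "far (arc (x1, x2)) (arc (x3, x4))"
    using w H(1) by (intro farI2[of x1 x2]) (auto simp: lookup_simps)
  moreover have "far (arc (x2, x3)) (arc (x3, x4))"
    using w H(1) by (intro farI2[of x2 x3]) (auto simp: lookup_simps)
  moreover have "far (arc (x2, x3)) (arc (x1, x2))"
    using w H(1) by (intro farI1[of _ x3]) (auto simp: lookup_simps)
  moreover have "far (arc (x3, x4)) (arc (x1, x2))"
    using w H(1) by (intro farI2[of x3 x4]) (auto simp: lookup_simps)
  ultimately show False
    using far_irrefl[OF f]
    by (intro far_pair_pattern[OF H(2)[unfolded induced_arcs], of "(x1, x2)" "(x3, x4)"]) auto
qed

text \<open>At stage \<open>length us\<close> the relation \<open>late\<close> is non-adjacency, so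
  \<open>c\<close> is a cycle in it. The triangle over its closing edge would need a vertex next to
  both ends, which a chordless cycle on at least four vertices does not have.\<close>

lemma no_anticycle:
  assumes "4 \<le> m" "inj_on c {..<m}"
    and adj: "\<And>i j. i < j \<Longrightarrow> j < m \<Longrightarrow> A (c i) (c j) \<longleftrightarrow> j \<noteq> Suc i \<and> \<not> (i = 0 \<and> Suc j = m)"
  shows False
proof -
  define l where "l = m - 1"
  have l: "3 \<le> l" "{..<m} = {..l}" "m = Suc l" using assms(1) by (auto simp: l_def)
  have late: "late (length us) x y \<longleftrightarrow> \<not> A x y" for x y
    using rank_less by (auto simp: late_def)
  have "late (length us) (c i) (c (Suc i))" if "i < l" for i
    using adj[of i "Suc i"] that l by (simp add: late)
  moreover have "late (length us) (c 0) (c l)" using adj[of 0 l] l by (simp add: late)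
  ultimately obtain x where x: "0 < x" "x < l" "\<not> A (c 0) (c x)" "\<not> A (c x) (c l)"
    using late_triangle[of l c "length us"] l assms(2) by (auto simp: late)
  then show False using adj[of 0 x] adj[of x l] l by auto
qed

lemma co_chordal_underlying:
  assumes "wverts D = UNIV"
  shows "co_chordal (underlying_graph D)"
  unfolding co_chordal_def chordal_def
proof (intro allI impI notI)
  fix m :: nat assume m: "3 < m"
    and ind: "has_induced (complement_graph (underlying_graph D)) (cycle_graph m)"
  have U: "uverts (underlying_graph D) = UNIV" using assms by (simp add: underlying_graph_def)
  obtain f where inj: "inj_on f {..<m}"
    and f: "\<And>i j. i < m \<Longrightarrow> j < m \<Longrightarrow> {f i, f j} \<in> uedges (complement_graph (underlying_graph D)) \<longleftrightarrow>
      {i, j} \<in> uedges (cycle_graph m)"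
    by (rule has_inducedE[OF ind]) (use m in \<open>auto simp: cycle_graph_def\<close>)
  show False
  proof (rule no_anticycle[of m f])
    fix i j assume ij: "i < j" "j < m"
    have "f i \<noteq> f j" using inj_on_eq_iff[OF inj, of i j] ij by simp
    then have "\<not> A (f i) (f j) \<longleftrightarrow> {f i, f j} \<in> uedges (complement_graph (underlying_graph D))"
      using U by (auto simp: complement_graph_def mem_underlying_graph)
    also have "\<dots> \<longleftrightarrow> (\<exists>k<m. {i, j} = {k, Suc k mod m})"
      using f ij by (auto simp: cycle_graph_def)
    also have "\<dots> \<longleftrightarrow> j = Suc i \<or> (i = 0 \<and> Suc j = m)"
    proof
      assume "\<exists>k<m. {i, j} = {k, Suc k mod m}"
      then obtain k where k: "k < m" "{i, j} = {k, Suc k mod m}" by blast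
      then show "j = Suc i \<or> (i = 0 \<and> Suc j = m)"
        using ij by (cases "Suc k = m") (auto simp: doubleton_eq_iff)
    next
      assume "j = Suc i \<or> (i = 0 \<and> Suc j = m)"
      then show "\<exists>k<m. {i, j} = {k, Suc k mod m}"
      proof
        assume "j = Suc i"
        then show ?thesis using ij by (intro exI[of _ i]) auto
      next
        assume "i = 0 \<and> Suc j = m"
        then show ?thesis using ij by (intro exI[of _ j]) auto
      qed
    qed
    finally show "A (f i) (f j) \<longleftrightarrow> j \<noteq> Suc i \<and> \<not> (i = 0 \<and> Suc j = m)" by blast
  qed (use m inj in auto)
qed

end

section \<open>Patterns excluded by the first shift ideal\<close>

locale homological_edge_order = edge_order D us
  for D :: "'v::finite wograph" and us :: "'v expo list" +
  assumes HS_lq: "\<And>k. \<exists>vs. lq_list vs \<and> set vs \<subseteq> U k \<and> (\<forall>a\<in>U k. \<exists>u\<in>set vs. u adds a)"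
begin

text \<open>Elements of \<open>U k\<close> need not be minimal generators, so \<open>p\<close> and
  \<open>q\<close> are first replaced by listed generators dividing them; hence the assumptions on
  \<open>C\<close> for all divisors.\<close>

lemma U_cross:
  assumes "p \<in> U k" "q \<in> U k" "\<And>x. x \<in> U k \<Longrightarrow> x adds p \<Longrightarrow> C x" "\<And>x. x \<in> U k \<Longrightarrow> x adds q \<Longrightarrow> \<not> C x"
  obtains x y where "x \<in> U k" "y \<in> U k" "keys x \<subseteq> keys p \<union> keys q" "keys y \<subseteq> keys p \<union> keys q"
    "C x" "\<not> C y" "\<not> far x y \<or> \<not> far y x"
proof -
  obtain vs where vs: "lq_list vs" "set vs \<subseteq> U k" "\<forall>a\<in>U k. \<exists>u\<in>set vs. u adds a"
    using HS_lq by blast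
  obtain p' q' where pq: "p' \<in> set vs" "p' adds p" "q' \<in> set vs" "q' adds q"
    using vs assms by blast
  then have "C p'" "\<not> C q'" using assms(3,4) vs by auto
  from lq_list_cross[OF vs(1) pq(1,3), of C, OF this]
  obtain x y where xy: "x \<in> set vs" "y \<in> set vs" "x adds elcm p' q'" "y adds elcm p' q'" "C x" "\<not> C y"
    "\<not> far x y \<or> \<not> far y x" .
  have "keys (elcm p' q') \<subseteq> keys p \<union> keys q"
    using adds_keys_mono[OF pq(2)] adds_keys_mono[OF pq(4)] by (auto simp: keys_elcm)
  then show ?thesis
    using that[of x y] xy vs(2) adds_keys_mono[OF xy(3)] adds_keys_mono[OF xy(4)] by blast
qed

text \<open>The path \<open>a\<close>, \<open>s\<close>, \<open>u\<close>, \<open>b\<close> may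
  close up with \<open>a = b\<close>. Both outer edges are far from \<open>su\<close>, so
  \<open>su\<close> has no colon variable among these vertices and comes first; then
  \<open>as\<close> gains only \<open>u\<close> and \<open>ub\<close> only \<open>s\<close>. The two
  resulting degrees are all of \<open>U 1\<close> in this range, and they are far from each
  other.\<close>

lemma middle_edge:
  assumes as: "A a s" and su: "A s u" and ub: "A u b"
    and edges: "\<And>x y. A x y \<Longrightarrow> x \<in> {a, s, u, b} \<Longrightarrow> y \<in> {a, s, u, b} \<Longrightarrow>
      {x, y} \<in> {{a, s}, {s, u}, {u, b}}"
    and far: "far (ex a s) (ex s u)" "far (ex u b) (ex s u)"
      "far (ex a s + expo_var u) (ex u b + expo_var s)"
      "far (ex u b + expo_var s) (ex a s + expo_var u)"
  shows False
proof -
  have ex: "ex x y = ex c d" if "A x y" "A c d" "{x, y} = {c, d}" for x y c d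
    using that edge_expo_inject keys_edge_expo by metis
  have neq: "{a, s} \<noteq> {s, u}" "{u, b} \<noteq> {s, u}"
    using far_irrefl[OF far(1)] far_irrefl[OF far(2)] ex as su ub by metis+
  have ne: "a \<noteq> s" "s \<noteq> u" "u \<noteq> b" using as su ub adj_irrefl by auto
  have dist: "a \<noteq> u" "b \<noteq> s" using neq by auto
  have none: "lq_vars us (r s u) \<inter> {a, s, u, b} = {}"
  proof (rule ccontr)
    assume "lq_vars us (r s u) \<inter> {a, s, u, b} \<noteq> {}"
    then obtain v where v: "v \<in> lq_vars us (r s u)" "v \<in> {a, s, u, b}" by auto
    obtain x where x: "x \<in> {s, u}" "A v x" "r v x < r s u" "ex v x adds ex s u + expo_var v" "v \<notin> {s, u}"
      using mem_lq_varsE[OF su v(1)] .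
    have "x \<in> {a, s, u, b}" using x(1) by blast
    from edges[OF x(2) v(2) this] have "{v, x} \<in> {{a, s}, {s, u}, {u, b}}" .
    moreover have "{v, x} \<noteq> {s, u}" using x(5) by blast
    ultimately consider "{v, x} = {a, s}" | "{v, x} = {u, b}" by blast
    then have "ex v x = ex a s \<or> ex v x = ex u b"
      using ex[OF x(2) as] ex[OF x(2) ub] by cases blast+
    then show False using far x(4) by (auto simp: far_def)
  qed
  have first: "r s u < r x y"
    if xy: "A x y" "{x, y} \<noteq> {s, u}" "x \<in> {a, s, u, b}" "y \<in> {a, s, u, b}" for x y
  proof (rule ccontr)
    assume "\<not> ?thesis"
    then have "r x y < r s u" using rank_eq_iff[OF xy(1) su] xy(2) by auto
    then obtain v where "v \<in> {x, y}" "v \<in> lq_vars us (r s u)" by (rule earlier_edge[OF su xy(1)])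
    then show False using none xy by auto
  qed
  have ul: "u \<in> lq_vars us (r a s)"
    using first[OF as neq(1)] rank_sym[OF su] su adj_sym ne dist by (intro lq_varsI[of _ _ _ s] as) auto
  have sl: "s \<in> lq_vars us (r u b)"
    using first[OF ub neq(2)] su ne dist by (intro lq_varsI[of _ _ _ u] ub) auto
  define p where "p = ex a s + expo_var u"
  define q where "q = ex u b + expo_var s"
  have es: "esum {v} = expo_var v" for v :: 'v by (simp add: esum_def)
  have pU: "p \<in> U 1" unfolding mem_U_iff
    by (rule exI[of _ a], rule exI[of _ s], rule exI[of _ "{u}"]) (simp add: p_def es as ul)
  have qU: "q \<in> U 1" unfolding mem_U_iff
    by (rule exI[of _ u], rule exI[of _ b], rule exI[of _ "{s}"]) (simp add: q_def es ub sl)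
  have only: "x = p \<or> x = q"
    if xU: "x \<in> U 1" "keys x \<subseteq> {a, s, u, b}" for x
  proof -
    obtain c d T where cd: "A c d" "x = ex c d + esum T" "T \<subseteq> lq_vars us (r c d)" "card T = 1"
      using xU(1) unfolding mem_U_iff by blast
    obtain v where v: "T = {v}" using cd(4) card_1_singletonE by blast
    have "{c, d, v} \<subseteq> {a, s, u, b}"
      using xU(2) cd(1,2) v by (auto simp: keys_add_eq keys_edge_expo keys_esum)
    then have in4: "c \<in> {a, s, u, b}" "d \<in> {a, s, u, b}" "v \<in> {a, s, u, b}" by auto
    obtain z where z: "z \<in> {c, d}" "A v z" "r v z < r c d" "v \<notin> {c, d}"
      using mem_lq_varsE[OF cd(1), of v] cd(3) v by auto
    have "{c, d} \<noteq> {s, u}"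
    proof
      assume "{c, d} = {s, u}"
      then have "r c d = r s u" using rank_eq_iff[OF cd(1) su] by simp
      then show False using none cd(3) v in4 by auto
    qed
    then have cd': "{c, d} = {a, s} \<or> {c, d} = {u, b}" using edges[OF cd(1) in4(1,2)] by auto
    have "z \<in> {a, s, u, b}" using z(1) in4 by auto
    from edges[OF z(2) in4(3) this] have vz: "{v, z} \<in> {{a, s}, {s, u}, {u, b}}" .
    from cd' show ?thesis
    proof
      assume c: "{c, d} = {a, s}"
      have "v = u"
        using vz z(1,4) c in4(3) dist ne by (auto simp: doubleton_eq_iff)
      then show ?thesis using ex[OF cd(1) as c] cd(2) v by (simp add: es p_def)
    next
      assume c: "{c, d} = {u, b}"
      have "v = s"
        using vz z(1,4) c in4(3) dist ne by (auto simp: doubleton_eq_iff)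
      then show ?thesis using ex[OF cd(1) ub c] cd(2) v by (simp add: es q_def)
    qed
  qed
  have kpq: "keys p \<subseteq> {a, s, u, b}" "keys q \<subseteq> {a, s, u, b}"
    using as ub by (auto simp: p_def q_def keys_add_eq keys_edge_expo)
  have pqf: "far p q" "far q p" using far by (simp_all add: p_def q_def)
  have nadds: "\<not> p adds q" "\<not> q adds p"
    using pqf adds_trans adds_add(1) unfolding far_def by blast+
  obtain x y where "x \<in> U 1" "y \<in> U 1" "keys x \<subseteq> keys p \<union> keys q" "keys y \<subseteq> keys p \<union> keys q"
    "x = p" "y \<noteq> p" "\<not> far x y \<or> \<not> far y x"
  proof (rule U_cross[of p 1 q "\<lambda>x. x = p"])
    show "p \<in> U 1" "q \<in> U 1" by (fact pU qU)+
    show "x = p" if "x \<in> U 1" "x adds p" for x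
      using only[of x] that kpq(1) adds_keys_mono[OF that(2)] nadds by blast
    show "x \<noteq> p" if "x \<in> U 1" "x adds q" for x
      using that nadds by blast
  qed
  then show False using only[of y] kpq pqf by auto
qed

lemma middle_edge_arcs:
  assumes arcs: "{(x, y) \<in> warcs D. x \<in> S \<and> y \<in> S} = W" and S: "S = {a, s, u, b}"
    and W: "\<And>x y. (x, y) \<in> W \<Longrightarrow> {x, y} \<in> {{a, s}, {s, u}, {u, b}}"
    and P: "P1 \<in> W" "P2 \<in> W" "P3 \<in> W"
      "{fst P1, snd P1} = {a, s}" "{fst P2, snd P2} = {s, u}" "{fst P3, snd P3} = {u, b}"
    and far: "far (arc P1) (arc P2)" "far (arc P3) (arc P2)"
      "far (arc P1 + expo_var u) (arc P3 + expo_var s)"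
      "far (arc P3 + expo_var s) (arc P1 + expo_var u)"
  shows False
proof -
  have arc: "A c d \<and> ex c d = arc Q" if "Q \<in> W" "{fst Q, snd Q} = {c, d}" for Q c d
  proof -
    obtain x y where Q: "Q = (x, y)" by (cases Q)
    then have xy: "(x, y) \<in> warcs D" "{x, y} = {c, d}" using that arcs by auto
    then have "A x y" "ex x y = arc (x, y)" by (auto simp: adj_def edge_expo_def)
    moreover have "ex x y = ex y x" "A y x" using \<open>A x y\<close> edge_expo_sym adj_sym by auto
    ultimately show ?thesis using xy(2) Q by (auto simp: doubleton_eq_iff)
  qed
  have "{x, y} \<in> {{a, s}, {s, u}, {u, b}}" if "A x y" "x \<in> {a, s, u, b}" "y \<in> {a, s, u, b}" for x y
  proof -
    have "(x, y) \<in> W \<or> (y, x) \<in> W" using that unfolding arcs[symmetric] S adj_def by auto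
    then show ?thesis using W[of x y] W[of y x] insert_commute[of x y "{}"] by metis
  qed
  then show False
    using middle_edge[of a s u b] arc[OF P(1,4)] arc[OF P(2,5)] arc[OF P(3,6)] far by auto
qed

lemma D6_free: "pattern_free is_D6 D"
  unfolding pattern_free_def is_D6_def
proof clarify
  fix S x1 x2 x3 x4
  assume H: "distinct [x1, x2, x3, x4]" "warcs (induced_wograph D S) = {(x1, x2), (x2, x3), (x3, x4)}"
    "weight (induced_wograph D S) x2 > 1" "weight (induced_wograph D S) x3 = 1"
    "weight (induced_wograph D S) x4 > 1" "wverts (induced_wograph D S) = {x1, x2, x3, x4}"
  note w = H(3-5)[unfolded weight_induced]
  have S: "S = {x1, x2, x3, x4}" using H by (simp add: induced_wograph_def)
  show False
  proof (rule middle_edge_arcs[OF H(2)[unfolded induced_arcs] S,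
        of "(x1, x2)" "(x2, x3)" "(x3, x4)"])
    show "far (arc (x1, x2)) (arc (x2, x3))"
      using w H(1) by (intro farI2[of x1 x2]) (auto simp: lookup_simps)
    show "far (arc (x3, x4)) (arc (x2, x3))"
      using w H(1) by (intro farI1[of _ x4]) (auto simp: lookup_simps)
    show "far (arc (x1, x2) + expo_var x3) (arc (x3, x4) + expo_var x2)"
      using w H(1) by (intro farI2[of x1 x2]) (auto simp: lookup_simps)
    show "far (arc (x3, x4) + expo_var x2) (arc (x1, x2) + expo_var x3)"
      using w H(1) by (intro farI1[of _ x4]) (auto simp: lookup_simps)
  qed auto
qed

text \<open>The triangle is the degenerate path with both ends at \<open>x2\<close>. Each of the two
  degrees in \<open>U 1\<close> contains the heavy variable of the other to the first power, so
  farness by one variable asks for weights above 2 instead of 1.\<close>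

lemma D7_free: "pattern_free is_D7 D"
  unfolding pattern_free_def is_D7_def
proof clarify
  fix S x1 x2 x3
  assume H: "distinct [x1, x2, x3]" "warcs (induced_wograph D S) = {(x1, x2), (x2, x3), (x3, x1)}"
    "weight (induced_wograph D S) x1 = 1" "weight (induced_wograph D S) x2 > 2"
    "weight (induced_wograph D S) x3 > 2" "wverts (induced_wograph D S) = {x1, x2, x3}"
  note w = H(3-5)[unfolded weight_induced]
  have S: "S = {x2, x1, x3, x2}" using H by (auto simp: induced_wograph_def)
  show False
  proof (rule middle_edge_arcs[OF H(2)[unfolded induced_arcs] S,
        of "(x1, x2)" "(x3, x1)" "(x2, x3)"])
    show "far (arc (x1, x2)) (arc (x3, x1))"
      using w H(1) by (intro farI1[of _ x2]) (auto simp: lookup_simps)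
    show "far (arc (x2, x3)) (arc (x3, x1))"
      using w H(1) by (intro farI1[of _ x3]) (auto simp: lookup_simps)
    show "far (arc (x1, x2) + expo_var x3) (arc (x2, x3) + expo_var x1)"
      using w H(1) by (intro farI1[of _ x2]) (auto simp: lookup_simps)
    show "far (arc (x2, x3) + expo_var x1) (arc (x1, x2) + expo_var x3)"
      using w H(1) by (intro farI1[of _ x3]) (auto simp: lookup_simps)
  qed auto
qed

lemma D8_free: "pattern_free is_D8 D"
  unfolding pattern_free_def is_D8_def
proof (rule notI, elim exE conjE)
  fix S x1 x2 x3 x4
  assume H: "distinct [x1, x2, x3, x4]"
    "warcs (induced_wograph D S) = {(x2, x1), (x3, x4), (x2, x3)} \<or>
     warcs (induced_wograph D S) = {(x2, x1), (x3, x4), (x3, x2)}"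
    "weight (induced_wograph D S) x1 > 1" "weight (induced_wograph D S) x2 = 1"
    "weight (induced_wograph D S) x3 = 1"
    "weight (induced_wograph D S) x4 > 1" "wverts (induced_wograph D S) = {x1, x2, x3, x4}"
  note w = H(3-6)[unfolded weight_induced]
  have S: "S = {x1, x2, x3, x4}" using H by (simp add: induced_wograph_def)
  \<comment> \<open>As \<open>x2\<close> and \<open>x3\<close> have weight 1, the middle edge has
    the same exponent in both orientations.\<close>
  have *: False if "warcs (induced_wograph D S) = {(x2, x1), (x3, x4), M}" "M = (x2, x3) \<or> M = (x3, x2)" for M
  proof (rule middle_edge_arcs[OF that(1)[unfolded induced_arcs] S,
        of "(x2, x1)" M "(x3, x4)"])
    show "far (arc (x2, x1)) (arc M)"
      using w H(1) that(2) by (intro farI1[of _ x1]) (auto simp: lookup_simps)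
    show "far (arc (x3, x4)) (arc M)"
      using w H(1) that(2) by (intro farI1[of _ x4]) (auto simp: lookup_simps)
    show "far (arc (x2, x1) + expo_var x3) (arc (x3, x4) + expo_var x2)"
      using w H(1) by (intro farI1[of _ x1]) (auto simp: lookup_simps)
    show "far (arc (x3, x4) + expo_var x2) (arc (x2, x1) + expo_var x3)"
      using w H(1) by (intro farI1[of _ x4]) (auto simp: lookup_simps)
  qed (use that(2) in auto)
  show False using H(2) *[of "(x2, x3)"] *[of "(x3, x2)"] by blast
qed

end

section \<open>The graphs \<open>H\<^sub>n\<close>\<close>

context homological_edge_order
begin

text \<open>The complement of a path \<open>P 1, \<dots>, P m\<close> with whiskers at its two ends, that is, the complement of
  \<open>H\<^sub>n\<close> for \<open>n = m + 2\<close>.\<close>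

definition whiskered :: "(nat \<Rightarrow> 'v) \<Rightarrow> nat \<Rightarrow> 'v \<Rightarrow> 'v \<Rightarrow> bool" where
  "whiskered P m u v \<longleftrightarrow> 4 \<le> m \<and> inj_on P {1..m} \<and> u \<notin> P ` {1..m} \<and> v \<notin> P ` {1..m} \<and> u \<noteq> v \<and> \<not> A u v \<and>
     (\<forall>i j. 1 \<le> i \<and> i < j \<and> j \<le> m \<longrightarrow> (A (P i) (P j) \<longleftrightarrow> j \<noteq> Suc i)) \<and>
     (\<forall>i. 1 \<le> i \<and> i \<le> m \<longrightarrow> (A u (P i) \<longleftrightarrow> i = 1) \<and> (A v (P i) \<longleftrightarrow> i = m))"

lemma whiskeredD:
  assumes "whiskered P m u v"
  shows "4 \<le> m" "inj_on P {1..m}" "u \<notin> P ` {1..m}" "v \<notin> P ` {1..m}" "u \<noteq> v" "\<not> A u v"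
    and "\<And>i j. 1 \<le> i \<Longrightarrow> i < j \<Longrightarrow> j \<le> m \<Longrightarrow> A (P i) (P j) \<longleftrightarrow> j \<noteq> Suc i"
    and "\<And>i. 1 \<le> i \<Longrightarrow> i \<le> m \<Longrightarrow> A u (P i) \<longleftrightarrow> i = 1"
    and "\<And>i. 1 \<le> i \<Longrightarrow> i \<le> m \<Longrightarrow> A v (P i) \<longleftrightarrow> i = m"
  using assms unfolding whiskered_def by blast+

lemma image_reverse: "(\<lambda>i. P (Suc m - i)) ` {1..m} = P ` {1..m}"
proof -
  have "(\<lambda>i. Suc m - i) ` {1..m} = {1..m}"
  proof
    show "{1..m} \<subseteq> (\<lambda>i. Suc m - i) ` {1..m}"
    proof
      fix x assume "x \<in> {1..m}"
      then show "x \<in> (\<lambda>i. Suc m - i) ` {1..m}"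
        by (intro image_eqI[of _ _ "Suc m - x"]) auto
    qed
  qed auto
  then show ?thesis by (metis image_image)
qed

lemma whiskered_reverse:
  assumes "whiskered P m u v"
  shows "whiskered (\<lambda>i. P (Suc m - i)) m v u"
proof -
  have inj: "inj_on P {1..m}" using assms by (simp add: whiskered_def)
  have "inj_on (\<lambda>i. P (Suc m - i)) {1..m}"
  proof (rule inj_onI)
    fix x y assume xy: "x \<in> {1..m}" "y \<in> {1..m}" "P (Suc m - x) = P (Suc m - y)"
    then have "Suc m - x \<in> {1..m}" "Suc m - y \<in> {1..m}" by auto
    then have "Suc m - x = Suc m - y" using inj_onD[OF inj xy(3)] by blast
    then show "x = y" using xy by auto
  qed
  moreover have "A (P (Suc m - i)) (P (Suc m - j)) \<longleftrightarrow> j \<noteq> Suc i" if "1 \<le> i" "i < j" "j \<le> m" for i j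
    using whiskeredD(7)[OF assms, of "Suc m - j" "Suc m - i"] that
      adj_sym[of "P (Suc m - i)" "P (Suc m - j)"] by auto
  moreover have "(A v (P (Suc m - i)) \<longleftrightarrow> i = 1) \<and> (A u (P (Suc m - i)) \<longleftrightarrow> i = m)" if "1 \<le> i" "i \<le> m" for i
    using whiskeredD(8,9)[OF assms, of "Suc m - i"] that by auto
  ultimately show ?thesis
    using whiskeredD(1-6)[OF assms] adj_sym[of u v] unfolding whiskered_def image_reverse by blast
qed

text \<open>The support \<open>X\<close> of a multidegree \<open>u\<^sub>i x\<^sub>T\<close>, with \<open>u\<^sub>i\<close> coming from the edge \<open>ab\<close>, satisfies
  \<open>star_at X a b\<close>.\<close>

definition star_at :: "'v set \<Rightarrow> 'v \<Rightarrow> 'v \<Rightarrow> bool" where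
  "star_at X a b \<longleftrightarrow> A a b \<and> a \<in> X \<and> b \<in> X \<and>
     (\<forall>c\<in>X - {a, b}. \<exists>x\<in>{a, b}. A c x \<and> r c x < r a b)"

text \<open>Within \<open>X\<close> the only neighbour of \<open>u\<close> is \<open>P 1\<close>, so
  either \<open>ab\<close> is the edge of \<open>u\<close> and \<open>P 1\<close>, or
  \<open>P 1\<close> lies on \<open>ab\<close> and that edge is earlier. Neither \<open>v\<close>
  nor \<open>P 2\<close> is adjacent to \<open>u\<close> or \<open>P 1\<close>, so if present it
  hangs by an earlier edge on the other end of \<open>ab\<close>. That edge and the edge of
  \<open>u\<close> and \<open>P 1\<close> are joined only by \<open>ab\<close>, which comes too late
  for \<open>disjoint_edges\<close>.\<close>

lemma whiskered_star_whisker: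
  assumes w: "whiskered P m u v" and star: "star_at X a b" and X: "X \<subseteq> insert u (insert v (P ` {1..m}))"
    and u: "u \<in> X"
  shows "v \<notin> X \<and> P 2 \<notin> X"
proof -
  note m = whiskeredD(1)[OF w] and inj = whiskeredD(2)[OF w] and uP = whiskeredD(3)[OF w]
    and vP = whiskeredD(4)[OF w] and uv = whiskeredD(5,6)[OF w] and PP = whiskeredD(7)[OF w]
    and Au = whiskeredD(8)[OF w] and Av = whiskeredD(9)[OF w]
  have Pne: "P i \<noteq> P j" if "i \<noteq> j" "1 \<le> i" "i \<le> m" "1 \<le> j" "j \<le> m" for i j
    using inj_on_eq_iff[OF inj, of i j] that by simp
  have ne: "u \<noteq> P i" "v \<noteq> P i" if "1 \<le> i" "i \<le> m" for i
    using that uP vP by auto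
  have ab: "A a b" "a \<in> X" "b \<in> X" "a \<noteq> b" using star adj_irrefl by (auto simp: star_at_def)
  have early: "\<exists>x\<in>{a, b}. A c x \<and> r c x < r a b" if "c \<in> X" "c \<notin> {a, b}" for c
    using star that by (simp add: star_at_def)
  have nbu: "x = P 1" if "A u x" "x \<in> X" for x
    using that X Au uv adj_irrefl by auto
  have nbv: "x = P m" if "A v x" "x \<in> X" for x
    using that X Av uv adj_irrefl adj_sym[of u v] by auto
  have u_end: "{a, b} = {u, P 1} \<or> (u \<notin> {a, b} \<and> P 1 \<in> {a, b} \<and> r u (P 1) < r a b)"
  proof (cases "u \<in> {a, b}")
    case True
    then show ?thesis using nbu[of a] nbu[of b] ab adj_sym by auto
  next
    case False
    then obtain x where "x \<in> {a, b}" "A u x" "r u x < r a b" using early u by blast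
    then show ?thesis using nbu[of x] ab False by auto
  qed
  have v: "v \<notin> X"
  proof
    assume vX: "v \<in> X"
    show False
    proof (cases "{a, b} = {u, P 1}")
      case True
      then have "v \<notin> {a, b}" using uv ne[of 1] m by auto
      then obtain x where "x \<in> {u, P 1}" "A v x" using early[OF vX] True by auto
      then show False using uv Av[of 1] m adj_sym by auto
    next
      case False
      then have u1: "u \<notin> {a, b}" "P 1 \<in> {a, b}" "r u (P 1) < r a b" using u_end by auto
      have "v \<notin> {a, b}"
      proof
        assume "v \<in> {a, b}"
        then have "A v (P 1)" using u1 ab adj_sym ne[of 1] m by auto
        then show False using Av[of 1] m by simp
      qed
      then obtain x where x: "x \<in> {a, b}" "A v x" "r v x < r a b" using early[OF vX] by blast
      then have xm: "x = P m" using nbv ab by auto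
      have AuP: "A u (P 1)" using Au[of 1] m by simp
      have "P 1 \<noteq> P m" using Pne[of 1 m] m by simp
      then have "{a, b} = {P 1, P m}" using u1 x xm by auto
      then have rab: "r a b = r (P 1) (P m)" using ab(1) PP[of 1 m] m rank_eq_iff by simp
      obtain y z where yz: "y \<in> {u, P 1}" "z \<in> {v, P m}" "A y z" "r y z < max (r u (P 1)) (r v (P m))"
        using disjoint_edges[OF AuP x(2)[unfolded xm]] uv ne[of 1] ne[of m] \<open>P 1 \<noteq> P m\<close> m by auto
      then have "r y z < r a b" using u1 x xm by auto
      moreover have "y = P 1 \<and> z = P m"
        using yz(1-3) uv Au[of m] Av[of 1] m adj_sym by auto
      ultimately show False using rab by simp
    qed
  qed
  have "P 2 \<notin> X"
  proof
    assume P2: "P 2 \<in> X"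
    have n12: "\<not> A (P 2) (P 1)" "\<not> A (P 2) u"
      using PP[of 1 2] Au[of 2] m adj_sym by (auto simp: numeral_2_eq_2)
    have P2ne: "P 2 \<noteq> P 1" "P 2 \<noteq> u" using Pne[of 1 2] ne[of 2] m by auto
    show False
    proof (cases "{a, b} = {u, P 1}")
      case True
      then obtain x where "x \<in> {u, P 1}" "A (P 2) x" using early[OF P2] P2ne by auto
      then show False using n12 by auto
    next
      case False
      then have u1: "u \<notin> {a, b}" "P 1 \<in> {a, b}" "r u (P 1) < r a b" using u_end by auto
      then obtain y where y: "{a, b} = {P 1, y}" "y \<in> X" "A (P 1) y" using ab adj_sym by blast
      have y': "y \<noteq> u" "y \<noteq> P 1" "y \<noteq> P 2" using y u1 n12 adj_sym adj_irrefl by auto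
      have rab: "r a b = r (P 1) y" using rank_eq_iff[OF ab(1) y(3)] y(1) by simp
      have "P 2 \<notin> {a, b}" using y y' P2ne by auto
      then obtain x where "x \<in> {P 1, y}" "A (P 2) x" "r (P 2) x < r a b" using early[OF P2] y by auto
      then have P2y: "A (P 2) y" "r (P 2) y < r a b" using n12 by auto
      have AuP: "A u (P 1)" using Au[of 1] m by simp
      have nuy: "\<not> A u y" using nbu[of y] y(2) y' by auto
      obtain p q where pq: "p \<in> {u, P 1}" "q \<in> {P 2, y}" "A p q" "r p q < max (r u (P 1)) (r (P 2) y)"
        using disjoint_edges[OF AuP P2y(1)] P2ne y' by auto
      then have "r p q < r a b" using u1 P2y by auto
      moreover have "p = P 1 \<and> q = y" using pq(1-3) n12 nuy adj_sym by auto
      ultimately show False using rab by simp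
    qed
  qed
  with v show ?thesis by blast
qed

text \<open>The stretch of the path between the ends of \<open>ab\<close>, closed by
  \<open>ab\<close>, is a cycle of pairs not joined by edges before \<open>ab\<close>. The triangle
  over \<open>ab\<close> gives a vertex of \<open>X\<close> joined to neither end by an earlier
  edge, against \<open>star\<close>.\<close>

lemma whiskered_star_path:
  assumes w: "whiskered P m u v" and star: "star_at X a b" and X: "X = P ` {1..m}"
  shows False
proof -
  note m = whiskeredD(1)[OF w] and inj = whiskeredD(2)[OF w] and PP = whiskeredD(7)[OF w]
  have ab: "A a b" "a \<in> X" "b \<in> X" using star by (auto simp: star_at_def)
  obtain i j where ij: "1 \<le> i" "i < j" "j \<le> m" "{a, b} = {P i, P j}"
  proof -
    obtain i j where ij: "i \<in> {1..m}" "j \<in> {1..m}" "a = P i" "b = P j" using ab X by auto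
    then have "i \<noteq> j" using ab adj_irrefl by auto
    then consider "i < j" | "j < i" by linarith
    then show ?thesis
    proof cases
      case 1
      then show ?thesis using that[of i j] ij by auto
    next
      case 2
      then show ?thesis using that[of j i] ij by auto
    qed
  qed
  have Aij: "A (P i) (P j)" "r (P i) (P j) = r a b"
    using ab(1) ij(4) adj_sym rank_sym by (auto simp: doubleton_eq_iff)
  then have j: "j \<noteq> Suc i" using PP ij by auto
  define c where "c k = P (i + k)" for k
  have "inj_on c {..j - i}"
  proof (rule inj_onI)
    fix x y assume xy: "x \<in> {..j - i}" "y \<in> {..j - i}" "c x = c y"
    then show "x = y"
      using inj_on_eq_iff[OF inj, of "i + x" "i + y"] ij by (simp add: c_def)
  qed
  moreover have "\<forall>k<j - i. late (r a b) (c k) (c (Suc k))"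
  proof (intro allI impI)
    fix k assume "k < j - i"
    then show "late (r a b) (c k) (c (Suc k))"
      using PP[of "i + k" "Suc (i + k)"] ij by (simp add: late_def c_def)
  qed
  moreover have "late (r a b) (c 0) (c (j - i))"
    using ij Aij by (simp add: c_def late_def)
  moreover have "2 \<le> j - i" using ij j by auto
  ultimately obtain x where x: "0 < x" "x < j - i" "late (r a b) (c 0) (c x)" "late (r a b) (c x) (c (j - i))"
    using late_triangle[of "j - i" c "r a b"] by metis
  have "c x \<in> X" using x ij by (auto simp: X c_def)
  moreover have "c x \<notin> {a, b}"
    unfolding ij(4) c_def
    using inj_on_eq_iff[OF inj, of "i + x" i] inj_on_eq_iff[OF inj, of "i + x" j] x ij by simp
  ultimately obtain y where "y \<in> {P i, P j}" "A (c x) y" "r (c x) y < r a b"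
    using star ij(4) unfolding star_at_def by blast
  moreover have "late (r a b) (c x) (P i)" "late (r a b) (c x) (P j)"
    using x(3,4) late_sym ij by (auto simp: c_def)
  ultimately show False by (auto simp: late_def)
qed

text \<open>The closed neighbourhood of \<open>P 1\<close> inside the whiskered
  configuration.\<close>

definition half :: "(nat \<Rightarrow> 'v) \<Rightarrow> nat \<Rightarrow> 'v \<Rightarrow> 'v set" where
  "half P m u = insert u (P ` ({1..m} - {2}))"

lemma card_half:
  assumes "whiskered P m u v"
  shows "card (half P m u) = m"
proof -
  have inj: "inj_on P ({1..m} - {2})" and u: "u \<notin> P ` {1..m}" and m: "4 \<le> m"
    using whiskeredD(1-3)[OF assms] by (auto intro: inj_on_subset)
  then have "u \<notin> P ` ({1..m} - {2})" by auto
  then show ?thesis using card_image[OF inj] m by (simp add: half_def)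
qed

text \<open>A support containing a whisker is confined to one half and equals it by counting; a
  support avoiding both whiskers would, again by counting, be the whole path.\<close>

lemma whiskered_star:
  assumes w: "whiskered P m u v" and star: "star_at X a b" and X: "X \<subseteq> insert u (insert v (P ` {1..m}))"
    and card: "card X = m"
  shows "X = half P m u \<or> X = half (\<lambda>i. P (Suc m - i)) m v"
proof -
  have fin: "finite X" by simp
  have *: "X = half P m u" if w: "whiskered P m u v" and X: "X \<subseteq> insert u (insert v (P ` {1..m}))" and "u \<in> X" for P u v
  proof -
    have "v \<notin> X \<and> P 2 \<notin> X" using whiskered_star_whisker[OF w star X \<open>u \<in> X\<close>] .
    then have "X \<subseteq> half P m u" using X by (auto simp: half_def)
    then show ?thesis using card_half[OF w] card by (intro card_subset_eq) (auto simp: half_def)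
  qed
  show ?thesis
  proof (cases "u \<in> X \<or> v \<in> X")
    case True
    then show ?thesis
    proof
      assume "u \<in> X"
      then show ?thesis using *[OF w X] by blast
    next
      assume "v \<in> X"
      moreover have "X \<subseteq> insert v (insert u ((\<lambda>i. P (Suc m - i)) ` {1..m}))"
        using X image_reverse[of P m] by auto
      ultimately show ?thesis using *[OF whiskered_reverse[OF w]] by blast
    qed
  next
    case False
    then have "X \<subseteq> P ` {1..m}" using X by auto
    moreover have "card (P ` {1..m}) = m"
      using card_image[OF whiskeredD(2)[OF w]] by simp
    ultimately have "X = P ` {1..m}" using card by (intro card_subset_eq) auto
    then show ?thesis using whiskered_star_path[OF w star] by blast
  qed
qed

text \<open>All vertices of the half other than \<open>P 1\<close> are leaves of a star centred
  there. For the last edge of this star the remaining leaves are colon variables, and together they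
  fill the half.\<close>

lemma half_mem_U:
  assumes w: "whiskered P m u v"
  obtains x where "x \<in> U (m - 2)" "keys x = half P m u"
proof -
  note m = whiskeredD(1)[OF w] and inj = whiskeredD(2)[OF w] and uP = whiskeredD(3)[OF w]
    and PP = whiskeredD(7)[OF w] and Au = whiskeredD(8)[OF w]
  define L where "L = half P m u - {P 1}"
  have adjL: "A c (P 1)" if cL: "c \<in> L" for c
  proof -
    have "c = u \<or> c \<in> P ` ({1..m} - {2})" "c \<noteq> P 1" using cL by (auto simp: L_def half_def)
    then consider "c = u" | i where "c = P i" "i \<in> {1..m}" "i \<noteq> 2" "i \<noteq> 1" by blast
    then show ?thesis
    proof cases
      case 1
      then show ?thesis using Au[of 1] m by simp
    next
      case 2
      then have "1 < i" by auto
      then show ?thesis using 2 PP[of 1 i] adj_sym by auto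
    qed
  qed
  have P1: "P 1 \<in> half P m u" using m by (auto simp: half_def)
  have "u \<in> L" using uP m by (auto simp: L_def half_def)
  then have ne: "finite L" "L \<noteq> {}" by auto
  define M where "M = Max ((\<lambda>c. r c (P 1)) ` L)"
  have "M \<in> (\<lambda>c. r c (P 1)) ` L" unfolding M_def using ne by (intro Max_in) auto
  then obtain c where c: "c \<in> L" "r c (P 1) = M" by auto
  have max: "r d (P 1) \<le> r c (P 1)" if "d \<in> L" for d
    using that ne unfolding c(2) M_def by (intro Max_ge) auto
  have Ac: "A c (P 1)" using adjL c by blast
  have "d \<in> lq_vars us (r c (P 1))" if d: "d \<in> L - {c}" for d
  proof (rule lq_varsI[OF Ac])
    show "A d (P 1)" using adjL d by blast
    then have "r d (P 1) \<noteq> r c (P 1)"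
      using rank_eq_iff[OF _ Ac] d by (auto simp: doubleton_eq_iff)
    then show "r d (P 1) < r c (P 1)" using max d by (simp add: le_neq_implies_less)
    show "d \<notin> {c, P 1}" using d by (auto simp: L_def)
  qed simp
  moreover have "card (L - {c}) = m - 2"
    using card_half[OF w] P1 c(1) ne by (simp add: L_def)
  ultimately have "ex c (P 1) + esum (L - {c}) \<in> U (m - 2)"
    unfolding mem_U_iff using Ac by blast
  moreover have "keys (ex c (P 1) + esum (L - {c})) = half P m u"
    using Ac c P1 by (auto simp: keys_add_eq keys_edge_expo keys_esum L_def)
  ultimately show ?thesis by (rule that)
qed

lemma no_whiskered:
  assumes w: "whiskered P m u v"
  shows False
proof -
  define Q where "Q i = P (Suc m - i)" for i
  have w': "whiskered Q m v u" using whiskered_reverse[OF w] by (simp add: Q_def[abs_def])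
  note m = whiskeredD(1)[OF w] and inj = whiskeredD(2)[OF w] and uP = whiskeredD(3)[OF w]
    and vP = whiskeredD(4)[OF w] and uv = whiskeredD(5,6)[OF w]
  have QP: "Q ` {1..m} = P ` {1..m}" unfolding Q_def by (rule image_reverse)
  obtain p where p: "p \<in> U (m - 2)" "keys p = half P m u" using half_mem_U[OF w] .
  obtain q where q: "q \<in> U (m - 2)" "keys q = half Q m v" using half_mem_U[OF w'] .
  have sub: "half P m u \<union> half Q m v \<subseteq> insert u (insert v (P ` {1..m}))"
    using QP by (auto simp: half_def)
  have only: "keys x = half P m u \<or> keys x = half Q m v"
    if "x \<in> U (m - 2)" "keys x \<subseteq> insert u (insert v (P ` {1..m}))" for x
  proof -
    obtain a b T where abT: "A a b" "x = ex a b + esum T" "T \<subseteq> lq_vars us (r a b)" "card T = m - 2"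
      using \<open>x \<in> U (m - 2)\<close> unfolding mem_U_iff by blast
    have kx: "keys x = {a, b} \<union> T"
      using abT by (auto simp: keys_add_eq keys_edge_expo keys_esum)
    have disj: "{a, b} \<inter> T = {}" using mem_lq_varsE[OF abT(1)] abT(3) by blast
    have "a \<noteq> b" using abT(1) adj_irrefl by auto
    then have card: "card (keys x) = m"
      using disj abT(4) m unfolding kx by (subst card_Un_disjoint) auto
    have "star_at (keys x) a b"
      unfolding star_at_def kx
    proof (intro conjI ballI)
      fix c assume "c \<in> {a, b} \<union> T - {a, b}"
      then have "c \<in> lq_vars us (r a b)" using abT by auto
      then show "\<exists>x\<in>{a, b}. A c x \<and> r c x < r a b" using mem_lq_varsE[OF abT(1)] by metis
    qed (use abT in auto)
    from whiskered_star[OF w this that(2) card] show ?thesis by (simp add: Q_def[abs_def])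
  qed
  have uS: "u \<in> half P m u" "v \<in> half Q m v" by (auto simp: half_def)
  have vS: "v \<notin> half P m u" "u \<notin> half Q m v"
    using uP vP uv QP by (auto simp: half_def)
  have Pne: "P i \<noteq> P j" if "i \<noteq> j" "1 \<le> i" "i \<le> m" "1 \<le> j" "j \<le> m" for i j
    using inj_on_eq_iff[OF inj, of i j] that by simp
  \<comment> \<open>\<open>P (m - 1)\<close> is \<open>Q 2\<close>, the path vertex left out of the
    half at the other end.\<close>
  have halfQ: "P i \<notin> half Q m v" if i: "i = m - 1" for i
  proof
    assume "P i \<in> half Q m v"
    then obtain k where k: "k \<in> {1..m}" "k \<noteq> 2" "P i = Q k"
    proof -
      have "v \<noteq> P i" using vP i m by auto
      then have "P i \<in> Q ` ({1..m} - {2})" using \<open>P i \<in> half Q m v\<close> by (simp add: half_def)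
      then show ?thesis using that by blast
    qed
    then have "i \<noteq> Suc m - k" "1 \<le> Suc m - k" "Suc m - k \<le> m" "1 \<le> i" "i \<le> m"
      using i m by auto
    then show False using Pne[of i "Suc m - k"] k(3) by (simp add: Q_def)
  qed
  have "P (m - 1) \<in> half P m u" using m by (auto simp: half_def)
  moreover have "u \<noteq> P (m - 1)" using uP m by auto
  ultimately have d1: "\<not> half P m u \<subseteq> insert w (half Q m v)" for w
    using halfQ[of "m - 1"] uS vS by blast
  have halfP: "P 2 \<notin> half P m u"
  proof
    assume "P 2 \<in> half P m u"
    moreover have "P 2 \<noteq> u" using uP m by auto
    ultimately have "P 2 \<in> P ` ({1..m} - {2})" by (simp add: half_def)
    then obtain j where "j \<in> {1..m}" "j \<noteq> 2" "P 2 = P j" by blast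
    then show False using Pne[of 2 j] m by simp
  qed
  have "Suc m - (m - 1) = 2" using m by simp
  then have "P 2 = Q (m - 1)" by (simp only: Q_def)
  then have "P 2 \<in> half Q m v" using m by (auto simp: half_def)
  moreover have "v \<noteq> P 2" using vP m by auto
  ultimately have d2: "\<not> half Q m v \<subseteq> insert w (half P m u)" for w
    using halfP uS vS by blast
  \<comment> \<open>Multiplication by a variable enlarges a support by at most one vertex, so
    \<open>d1\<close> and \<open>d2\<close> exclude linear steps in both directions for all
    exponents.\<close>
  have notadds: "\<not> x adds y + expo_var w" if "\<not> keys x \<subseteq> insert w (keys y)" for x y w
    using adds_keys_mono[of x "y + expo_var w"] that by (auto simp: keys_add_eq split: if_splits)
  obtain x y where xy: "x \<in> U (m - 2)" "y \<in> U (m - 2)" "keys x \<subseteq> keys p \<union> keys q"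
    "keys y \<subseteq> keys p \<union> keys q" "keys x = half P m u" "keys y \<noteq> half P m u" "\<not> far x y \<or> \<not> far y x"
  proof (rule U_cross[OF p(1) q(1), of "\<lambda>x. keys x = half P m u"])
    show "keys x = half P m u" if "x \<in> U (m - 2)" "x adds p" for x
      using only[OF that(1)] adds_keys_mono[OF that(2)] p(2) sub uS vS by blast
    show "keys x \<noteq> half P m u" if "x \<in> U (m - 2)" "x adds q" for x
      using only[OF that(1)] adds_keys_mono[OF that(2)] q(2) sub uS vS by blast
  qed
  then have "keys y = half Q m v" using only[OF xy(2)] p q sub by blast
  then have "\<not> x adds y + expo_var w" "\<not> y adds x + expo_var w" for w
    by (intro notadds; simp add: xy(5) d1 d2)+
  then have "far x y" "far y x" unfolding far_def by blast+
  then show False using xy(7) by blast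
qed

lemma H_complement_free:
  assumes n: "6 \<le> n"
  shows "\<not> has_induced (underlying_graph D) (complement_graph (H_graph n))"
proof
  assume ind: "has_induced (underlying_graph D) (complement_graph (H_graph n))"
  obtain f where inj: "inj_on f {1..n}"
    and f: "\<And>i j. i \<in> {1..n} \<Longrightarrow> j \<in> {1..n} \<Longrightarrow>
      A (f i) (f j) \<longleftrightarrow> {i, j} \<in> uedges (complement_graph (H_graph n))"
    by (rule has_inducedE[OF ind]) (auto simp: complement_graph_def H_graph_def mem_underlying_graph)
  have adj: "A (f i) (f j) \<longleftrightarrow> {i, j} \<notin> uedges (H_graph n)"
    if "i \<in> {1..n}" "j \<in> {1..n}" "i \<noteq> j" for i j
    using f[of i j] that by (auto simp: complement_graph_def H_graph_def)
  \<comment> \<open>The path of \<open>H\<^sub>n\<close> runs through the vertices \<open>1, \<dots>, n - 4, n - 2, n - 3\<close> in this order.\<close>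
  define s where "s i = (if i = n - 3 then n - 2 else if i = n - 2 then n - 3 else i)" for i
  \<comment> \<open>The path has \<open>n - 2\<close> vertices. The vertices \<open>n - 1\<close>
    and \<open>n\<close>, now \<open>m + 1\<close> and \<open>m + 2\<close>, become the whiskers: in
    the complement each keeps a single neighbour, an end of the path.\<close>
  define m where "m = n - 2"
  have m: "4 \<le> m" "n = m + 2" using n by (auto simp: m_def)
  have s: "s i = (if i = m - 1 then m else if i = m then m - 1 else i)" for i
    by (simp add: s_def m_def)
  have s_range: "s i \<in> {1..m}" if "1 \<le> i" "i \<le> m" for i
    using that m by (auto simp: s)
  have inj_s: "inj_on s {1..m}" by (auto simp: inj_on_def s split: if_splits)
  have H: "uedges (H_graph n) = {{i, i + 1} | i. 1 \<le> i \<and> i \<le> m - 3} \<union> {{m - 2, m}, {m, m - 1}} \<union>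
      {{m + 1, j} | j. 1 \<le> j \<and> j \<le> m + 2 \<and> j \<noteq> 1 \<and> j \<noteq> m + 1} \<union>
      {{m + 2, j} | j. 1 \<le> j \<and> j \<le> m + 2 \<and> j \<noteq> m - 1 \<and> j \<noteq> m + 2}"
    using m by (simp add: H_graph_def numeral_eq_Suc)
  have m1: "{x, y} \<in> {{i, i + 1} | i. 1 \<le> i \<and> i \<le> k} \<longleftrightarrow>
      1 \<le> x \<and> x \<le> k \<and> y = x + 1 \<or> 1 \<le> y \<and> y \<le> k \<and> x = y + 1" for x y k :: nat
    by (auto simp: doubleton_eq_iff)
  have m2: "{x, y} \<in> {{a, b}, {b, c}} \<longleftrightarrow>
      x = a \<and> y = b \<or> y = a \<and> x = b \<or> x = b \<and> y = c \<or> y = b \<and> x = c" for x y a b c :: nat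
    by (auto simp: doubleton_eq_iff)
  have m3: "{x, y} \<in> {{a, j} | j. Q j} \<longleftrightarrow> x = a \<and> Q y \<or> y = a \<and> Q x" for x y a :: nat and Q
    by (auto simp: doubleton_eq_iff)
  have mem: "{x, y} \<in> uedges (H_graph n) \<longleftrightarrow>
      1 \<le> x \<and> x \<le> m - 3 \<and> y = x + 1 \<or> 1 \<le> y \<and> y \<le> m - 3 \<and> x = y + 1 \<or>
      x = m - 2 \<and> y = m \<or> y = m - 2 \<and> x = m \<or> x = m \<and> y = m - 1 \<or> y = m \<and> x = m - 1 \<or>
      x = m + 1 \<and> 1 \<le> y \<and> y \<le> m + 2 \<and> y \<noteq> 1 \<and> y \<noteq> m + 1 \<or>
      y = m + 1 \<and> 1 \<le> x \<and> x \<le> m + 2 \<and> x \<noteq> 1 \<and> x \<noteq> m + 1 \<or>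
      x = m + 2 \<and> 1 \<le> y \<and> y \<le> m + 2 \<and> y \<noteq> m - 1 \<and> y \<noteq> m + 2 \<or>
      y = m + 2 \<and> 1 \<le> x \<and> x \<le> m + 2 \<and> x \<noteq> m - 1 \<and> x \<noteq> m + 2" for x y
    by (simp only: H Un_iff m1 m2 m3 disj_assoc)
  have mem_path: "{x, y} \<in> uedges (H_graph n) \<longleftrightarrow>
      x \<le> m - 3 \<and> y = x + 1 \<or> x = m - 2 \<and> y = m \<or> y = m \<and> x = m - 1"
    if "1 \<le> x" "x < y" "y \<le> m" for x y
  proof -
    have h: "x \<noteq> m + 1" "y \<noteq> m + 1" "x \<noteq> m + 2" "y \<noteq> m + 2" "x \<noteq> y + 1" "x \<noteq> m" using that by auto
    show ?thesis by (simp only: mem h that(1) simp_thms)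
  qed
  have path: "{s i, s j} \<in> uedges (H_graph n) \<longleftrightarrow> j = Suc i" if ij: "1 \<le> i" "i < j" "j \<le> m" for i j
  proof -
    consider "j \<le> m - 2" | "j = m - 1" | "j = m" "i \<le> m - 2" | "j = m" "i = m - 1"
      using ij by linarith
    then show ?thesis
    proof cases
      case 1
      then have "s i = i" "s j = j" using ij m by (auto simp: s)
      moreover have "j = i + 1 \<and> i \<le> m - 3 \<longleftrightarrow> j = Suc i" "j \<noteq> m" using 1 ij m by auto
      ultimately show ?thesis using mem_path[of i j] ij by auto
    next
      case 2
      then have "s i = i" "s j = m" using ij m by (auto simp: s)
      moreover have "i = m - 2 \<longleftrightarrow> j = Suc i" "i \<noteq> m - 1" "\<not> (m = i + 1 \<and> i \<le> m - 3)" "i < m"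
        using 2 ij m by auto
      ultimately show ?thesis using mem_path[of i m] ij by auto
    next
      case 3
      then have "s i = i" "s j = m - 1" using ij m by (auto simp: s)
      moreover have "\<not> (m - 1 = i + 1 \<and> i \<le> m - 3)" "m - 1 \<noteq> m" "i < m - 1" "j \<noteq> Suc i"
        using 3 ij m by auto
      ultimately show ?thesis using mem_path[of i "m - 1"] ij by auto
    next
      case 4
      then have "s i = m" "s j = m - 1" using ij m by (auto simp: s)
      then show ?thesis using mem_path[of "m - 1" m] 4 m by (simp add: insert_commute)
    qed
  qed
  have u: "{m + 1, s i} \<in> uedges (H_graph n) \<longleftrightarrow> i \<noteq> 1" if "1 \<le> i" "i \<le> m" for i
  proof -
    have y: "1 \<le> s i" "s i \<le> m" using s_range[OF that] by auto
    then have h: "\<not> m + 1 \<le> m - 3" "\<not> (s i \<le> m - 3 \<and> m + 1 = s i + 1)" "m + 1 \<noteq> m - 2" "m + 1 \<noteq> m"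
      "m + 1 \<noteq> m - 1" "s i \<noteq> m + 1" "m + 1 \<noteq> m + 2" "s i \<noteq> m + 2" "s i \<le> m + 2"
      using m by auto
    have "{m + 1, s i} \<in> uedges (H_graph n) \<longleftrightarrow> s i \<noteq> 1"
      by (simp only: mem h y simp_thms)
    also have "\<dots> \<longleftrightarrow> i \<noteq> 1" using m by (auto simp: s)
    finally show ?thesis .
  qed
  have v: "{m + 2, s i} \<in> uedges (H_graph n) \<longleftrightarrow> i \<noteq> m" if "1 \<le> i" "i \<le> m" for i
  proof -
    have y: "1 \<le> s i" "s i \<le> m" using s_range[OF that] by auto
    then have h: "\<not> m + 2 \<le> m - 3" "\<not> (s i \<le> m - 3 \<and> m + 2 = s i + 1)" "m + 2 \<noteq> m - 2" "m + 2 \<noteq> m"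
      "m + 2 \<noteq> m - 1" "s i \<noteq> m + 1" "m + 2 \<noteq> m + 1" "s i \<noteq> m + 2" "s i \<le> m + 2"
      using m by auto
    have "{m + 2, s i} \<in> uedges (H_graph n) \<longleftrightarrow> s i \<noteq> m - 1"
      by (simp only: mem h y simp_thms)
    also have "\<dots> \<longleftrightarrow> i \<noteq> m" using m by (auto simp: s)
    finally show ?thesis .
  qed
  have uv: "{m + 1, m + 2} \<in> uedges (H_graph n)" using m unfolding mem by simp
  have fne: "f i \<noteq> f j" if "i \<noteq> j" "i \<in> {1..n}" "j \<in> {1..n}" for i j
    using inj_on_eq_iff[OF inj, of i j] that by simp
  have "whiskered (\<lambda>i. f (s i)) m (f (m + 1)) (f (m + 2))"
    unfolding whiskered_def
  proof (intro conjI allI impI)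
    have "inj_on f (s ` {1..m})" using s_range m by (intro inj_on_subset[OF inj]) force
    then show "inj_on (\<lambda>i. f (s i)) {1..m}"
      using comp_inj_on[OF inj_s] by (simp add: comp_def)
    have "f k \<noteq> f (s i)" if "k = m + 1 \<or> k = m + 2" "i \<in> {1..m}" for k i
      using that s_range[of i] m by (intro fne) auto
    then show "f (m + 1) \<notin> (\<lambda>i. f (s i)) ` {1..m}" "f (m + 2) \<notin> (\<lambda>i. f (s i)) ` {1..m}" by blast+
    show "f (m + 1) \<noteq> f (m + 2)" using m by (intro fne) auto
    show "\<not> A (f (m + 1)) (f (m + 2))" using adj[of "m + 1" "m + 2"] m uv by simp
  next
    fix i j assume ij: "1 \<le> i \<and> i < j \<and> j \<le> m"
    have "s i \<noteq> s j" using inj_on_eq_iff[OF inj_s, of i j] ij by simp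
    then show "A (f (s i)) (f (s j)) \<longleftrightarrow> j \<noteq> Suc i"
      using adj[of "s i" "s j"] path[of i j] s_range[of i] s_range[of j] ij m by auto
  next
    fix i assume i: "1 \<le> i \<and> i \<le> m"
    show "A (f (m + 1)) (f (s i)) \<longleftrightarrow> i = 1"
      using adj[of "m + 1" "s i"] u[of i] s_range[of i] i m by auto
    show "A (f (m + 2)) (f (s i)) \<longleftrightarrow> i = m"
      using adj[of "m + 2" "s i"] v[of i] s_range[of i] i m by auto
  qed (rule m(1))
  then show False by (rule no_whiskered)
qed

end

text \<open>Divisibility forces equal two-vertex supports and hence equal arcs. So all edges are
  minimal generators, and the order given by linear quotients lists every one of them.\<close>

lemma adds_arc_expo:
  fixes D :: "'v::finite wograph"
  assumes D: "weighted_oriented_graph D" and "(x, y) \<in> warcs D" "(x', y') \<in> warcs D"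
    and adds: "arc_expo D (x, y) adds arc_expo D (x', y')"
  shows "arc_expo D (x, y) = arc_expo D (x', y')"
proof -
  have "{x, y} \<subseteq> {x', y'}"
    using adds_keys_mono[OF adds] assms(2,3) by (simp add: keys_arc_expo[OF D])
  moreover have "x \<noteq> y" "(y', x') \<notin> warcs D"
    using D assms(2,3) by (auto simp: weighted_oriented_graph_def)
  ultimately show ?thesis using assms(2) by auto
qed

theorem corollary4p9:
  fixes D :: "'v::finite wograph"
  assumes "weighted_oriented_graph D"
    and "wverts D = UNIV"
    and "homological_linear_quotients (edge_ideal D :: ('v, 'k::field) mpoly set)"
  shows "(\<forall>P \<in> {is_D1, is_D2, is_D3, is_D4, is_D5, is_D6, is_D7, is_D8}. pattern_free P D) \<and>
         co_chordal (underlying_graph D) \<and>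
         (\<forall>n \<ge> 6. \<not> has_induced (underlying_graph D) (complement_graph (H_graph n)))"
proof -
  define J :: "('v, 'k) mpoly set" where "J = edge_ideal D"
  define E where "E = arc_expo D ` warcs D"
  have J: "J = ideal_of (xpow ` E)"
  proof -
    have e: "var x * var y ^ weight D y = (xpow (arc_expo D (x, y)) :: ('v, 'k) mpoly)" for x y
      by (simp only: var_power) (simp add: var_eq_xpow xpow_mult arc_expo_def)
    have "{var x * var y ^ weight D y | x y. (x, y) \<in> warcs D} = (xpow ` E :: ('v, 'k) mpoly set)"
      unfolding e E_def by auto
    then show ?thesis by (simp add: J_def edge_ideal_def)
  qed
  have finE: "finite E" by (simp add: E_def)
  have HS: "linear_quotients (HS k J)" for k
    using assms(3) by (simp add: homological_linear_quotients_def J_def)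
  have "HS 0 J = ideal_of (xpow ` E)" unfolding J by (rule HS_zero[OF finE])
  then have "linear_quotients (ideal_of (xpow ` E) :: ('v, 'k) mpoly set)"
    using HS[of 0] by simp
  then obtain us where us: "lq_list us" "set us \<subseteq> E" "\<forall>a\<in>E. \<exists>u\<in>set us. u adds a"
    and colon: "\<And>i. i < length us \<Longrightarrow>
      colon_ideal (ideal_of (xpow ` set (take i us))) (xpow (us ! i)) =
        (ideal_of (var ` lq_vars us i) :: ('v, 'k) mpoly set)"
    by (rule linear_quotients_list) blast
  have "E \<subseteq> set us"
  proof
    fix a assume a: "a \<in> E"
    then obtain u where u: "u \<in> set us" "u adds a" using us by blast
    then have "u \<in> E" using us by blast
    then have "u = a" using a u(2) adds_arc_expo[OF assms(1)] by (auto simp: E_def)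
    then show "a \<in> set us" using u by simp
  qed
  then have setE: "set us = E" using us by blast
  interpret edge_order D us
    using assms(1) us(1) setE by unfold_locales (simp_all add: E_def)
  \<comment> \<open>The support consists of the two ends of the edge and the set \<open>T\<close>
    disjoint from them, so equal degrees have sets \<open>T\<close> of equal size, as
    \<open>HS_linear_quotients\<close> requires.\<close>
  have card: "card (keys (us ! i + esum T)) = 2 + card T" if "i < length us" "T \<subseteq> lq_vars us i" for i T
  proof -
    have "keys (us ! i) \<inter> T = {}" using lq_vars_disjoint[OF that(1)] that(2) by blast
    then show ?thesis
      using card_keys_us[OF nth_mem[OF that(1)]] by (simp add: keys_add_eq keys_esum card_Un_disjoint)
  qed
  have "card S = card T" if "i < length us" "j < length us" "S \<subseteq> lq_vars us i" "T \<subseteq> lq_vars us j"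
    "us ! i + esum S = us ! j + esum T" for i j S T
    using card[of i S] card[of j T] that by simp
  from HS_linear_quotients[OF colon this] have "HS k J = ideal_of (xpow ` U k)" for k
    by (simp add: J U_def setE)
  then have "\<exists>vs. lq_list vs \<and> set vs \<subseteq> U k \<and> (\<forall>a\<in>U k. \<exists>u\<in>set vs. u adds a)" for k
    using linear_quotients_list[of "U k"] HS[of k] by metis
  then interpret homological_edge_order D us by unfold_locales
  show ?thesis
    using D1_free D2_free D3_free D4_free D5_free D6_free D7_free D8_free
      co_chordal_underlying[OF assms(2)] H_complement_free by blast
qed

end
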